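(* Let $k$ be a field. Let $R=k\langle x_1,\ldots,x_n\rangle$ and let $I$ be an ideal of $R$. Let $S=k\langle y_1,\ldots,y_m\rangle$ and let $J$ be an ideal of $S$. Here $k\langle\cdot\rangle$ denotes either the formal power series ring in both cases ($k$ an arbitrary field), or the convergent power series ring in both cases ($k$ a complete valued field). Assume that there exists an isomorphism of $k$-algebras $R/I\cong S/J$. Then $\mathrm{rt}_R(I)=\mathrm{rt}_S(J)$.
   Context: Notation: $k\langle x_1,\ldots,x_n\rangle$ stands for either the formal power series ring $k[[x_1,\ldots,x_n]]$ over an arbitrary field $k$, or the ring $k\{x_1,\ldots,x_n\}\subseteq k[[x_1,\ldots,x_n]]$ of convergent power series, where in the latter case $k$ is a complete valued field. Relation type of a standard graded algebra: Let $R$ be a commutative ring and let $A=\bigoplus_{n\ge 0}A_n$ be a standard graded $R$-algebra, i.e. a commutative graded algebra with $A_0=R$ generated as an $R$-algebra by finitely many elements $f_1,\ldots,f_m$ of degree $1$. Let $\varphi: R[T_1,\ldots,T_m]\to A$ be the graded surjection $T_i\mapsto f_i$, with kernel $\mathcal Q=\bigoplus_{\ell\ge1}\mathcal Q_\ell$, and let $\mathcal Q\langle \ell\rangle$ be the ideal generated by the elements of $\mathcal Q$ of degree at most $\ell$. The relation type $\mathrm{rt}_R(A)$ is the least integer $\ell\ge 1$ with $\mathcal Q\langle\ell\rangle=\mathcal Q$; it does not depend on the chosen generators. Relation type of an ideal: for an ideal $I$ of a Noetherian ring $R$, $\mathrm{rt}_R(I):=\mathrm{rt}_R(\mathcal R_R(I))$,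 where $\mathcal R_R(I)=\bigoplus_{n\ge0}I^nt^n=R[It]\subseteq R[t]$ is the Rees algebra of $I$. *)

theory Defs
  imports
    "HOL-Library.Multiset"
    "HOL-Library.Extended_Nat"
    "HOL-Analysis.Infinite_Sum"
    "HOL-Algebra.UnivPoly"
    "HOL-Algebra.Ideal_Product"
    "HOL-Algebra.QuotRing"
begin

section \<open>Formal and convergent power series rings\<close>

text \<open>
  A monomial is the multiset of its variables: the
  variable with index \<open>i\<close> has exponent \<open>count a i\<close>, the total degree is \<open>size a\<close>, and the product of
  monomials is the sum of multisets. The variables are indexed from \<open>0\<close> to \<open>n - 1\<close>.
\<close>

definition monomials :: "nat \<Rightarrow> nat multiset set" where
  "monomials n = {a. set_mset a \<subseteq> {..<n}}"

definition formal_series :: "nat \<Rightarrow> (nat multiset \<Rightarrow> 'k::field) ring" where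
  "formal_series n =
    \<lparr>carrier = {f. \<forall>a. a \<notin> monomials n \<longrightarrow> f a = 0},
     mult = (\<lambda>f g c. \<Sum>a \<in> {a. a \<subseteq># c}. f a * g (c - a)),
     one = (\<lambda>a. if a = {#} then 1 else 0),
     zero = (\<lambda>a. 0),
     add = (\<lambda>f g a. f a + g a)\<rparr>"

definition constant_series :: "'k::field \<Rightarrow> nat multiset \<Rightarrow> 'k" where
  "constant_series c = (\<lambda>a. if a = {#} then c else 0)"

text \<open>
  The absolute value may be Archimedean or not, and the trivial one is allowed (it makes every formal
  power series convergent).
\<close>

locale complete_valued_field =
  fixes absval :: "'k::field \<Rightarrow> real"
  assumes absval_nonneg: "0 \<le> absval x"
    and absval_eq_0_iff: "absval x = 0 \<longleftrightarrow> x = 0"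
    and absval_mult: "absval (x * y) = absval x * absval y"
    and absval_triangle: "absval (x + y) \<le> absval x + absval y"
    and complete: "(\<forall>e>0. \<exists>N. \<forall>i\<ge>N. \<forall>j\<ge>N. absval (X i - X j) < e) \<Longrightarrow>
                     \<exists>l. (\<lambda>i. absval (X i - l)) \<longlonglongrightarrow> 0"

text \<open>Convergence means absolute convergence on some polydisc with positive radii \<open>r i\<close>.\<close>

definition convergent_series ::
    "('k::field \<Rightarrow> real) \<Rightarrow> nat \<Rightarrow> (nat multiset \<Rightarrow> 'k) ring" where
  "convergent_series absval n = (formal_series n)
    \<lparr>carrier := {f \<in> carrier (formal_series n).
       \<exists>r. (\<forall>i<n. 0 < r i) \<and>
           (\<lambda>a. absval (f a) * (\<Prod>i\<in>#a. r i)) summable_on monomials n}\<rparr>"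


section \<open>Relation type of a standard graded algebra\<close>

definition poly_ring :: "('a, 'c) ring_scheme \<Rightarrow> nat \<Rightarrow> (nat multiset \<Rightarrow> 'a) ring" where
  "poly_ring R m =
    \<lparr>carrier = {p. (\<forall>a. p a \<in> carrier R) \<and> finite {a. p a \<noteq> \<zero>\<^bsub>R\<^esub>} \<and>
                   (\<forall>a. a \<notin> monomials m \<longrightarrow> p a = \<zero>\<^bsub>R\<^esub>)},
     mult = (\<lambda>p q c. \<Oplus>\<^bsub>R\<^esub>a \<in> {a. a \<subseteq># c}. p a \<otimes>\<^bsub>R\<^esub> q (c - a)),
     one = (\<lambda>a. if a = {#} then \<one>\<^bsub>R\<^esub> else \<zero>\<^bsub>R\<^esub>),
     zero = (\<lambda>a. \<zero>\<^bsub>R\<^esub>),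
     add = (\<lambda>p q a. p a \<oplus>\<^bsub>R\<^esub> q a)\<rparr>"

definition poly_eval ::
    "('a, 'c) ring_scheme \<Rightarrow> ('a, 'b, 'd) module_scheme \<Rightarrow> 'b list \<Rightarrow> (nat multiset \<Rightarrow> 'a) \<Rightarrow> 'b" where
  "poly_eval R A fs p =
    (\<Oplus>\<^bsub>A\<^esub>a \<in> {a. p a \<noteq> \<zero>\<^bsub>R\<^esub>}.
       p a \<odot>\<^bsub>A\<^esub> (\<Otimes>\<^bsub>A\<^esub>i \<in> {..<length fs}. (fs ! i) [^]\<^bsub>A\<^esub> count a i))"

text \<open>Here \<open>\<A>\<close> is the family of homogeneous components of the graded \<open>R\<close>-algebra \<open>A\<close>.\<close>

definition standard_generators ::
    "('a, 'c) ring_scheme \<Rightarrow> ('a, 'b, 'd) module_scheme \<Rightarrow> (nat \<Rightarrow> 'b set) \<Rightarrow> 'b list \<Rightarrow> bool" where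
  "standard_generators R A \<A> fs \<longleftrightarrow>
     set fs \<subseteq> \<A> 1 \<and> poly_eval R A fs ` carrier (poly_ring R (length fs)) = carrier A"

definition relations ::
    "('a, 'c) ring_scheme \<Rightarrow> ('a, 'b, 'd) module_scheme \<Rightarrow> 'b list \<Rightarrow> (nat multiset \<Rightarrow> 'a) set" where
  "relations R A fs = {p \<in> carrier (poly_ring R (length fs)). poly_eval R A fs p = \<zero>\<^bsub>A\<^esub>}"

definition relations_generated_upto ::
    "('a, 'c) ring_scheme \<Rightarrow> ('a, 'b, 'd) module_scheme \<Rightarrow> 'b list \<Rightarrow> nat \<Rightarrow> (nat multiset \<Rightarrow> 'a) set" where
  "relations_generated_upto R A fs l =
     genideal (poly_ring R (length fs))
       {p \<in> relations R A fs. \<forall>a. p a \<noteq> \<zero>\<^bsub>R\<^esub> \<longrightarrow> size a \<le> l}"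

definition relation_type_wrt ::
    "('a, 'c) ring_scheme \<Rightarrow> ('a, 'b, 'd) module_scheme \<Rightarrow> 'b list \<Rightarrow> enat" where
  "relation_type_wrt R A fs =
     (INF l \<in> {l. 1 \<le> l \<and> relations_generated_upto R A fs l = relations R A fs}. enat l)"

text \<open>
  For a standard graded algebra \<open>A\<close>, the value \<open>relation_type_wrt R A fs\<close> is the same for all finite
  systems \<open>fs\<close> of generators of degree one, so the infimum below is that common value. It is \<open>\<infinity>\<close> if
  no such system exists or if the relations are not generated in bounded degree; neither happens for
  Rees algebras of ideals of Noetherian rings.
\<close>

definition relation_type ::
    "('a, 'c) ring_scheme \<Rightarrow> ('a, 'b, 'd) module_scheme \<Rightarrow> (nat \<Rightarrow> 'b set) \<Rightarrow> enat" where
  "relation_type R A \<A> = (INF fs \<in> {fs. standard_generators R A \<A> fs}. relation_type_wrt R A fs)"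


section \<open>Rees algebra and relation type of an ideal\<close>

definition rees_algebra :: "('a, 'c) ring_scheme \<Rightarrow> 'a set \<Rightarrow> ('a, nat \<Rightarrow> 'a) up_ring" where
  "rees_algebra R I = (UP R)
    \<lparr>carrier := {p \<in> carrier (UP R). \<forall>d. coeff (UP R) p d \<in> I [^]\<^bsub>ideals_set R\<^esub> d}\<rparr>"

definition rees_component :: "('a, 'c) ring_scheme \<Rightarrow> 'a set \<Rightarrow> nat \<Rightarrow> (nat \<Rightarrow> 'a) set" where
  "rees_component R I d = (\<lambda>a. monom (UP R) a d) ` (I [^]\<^bsub>ideals_set R\<^esub> d)"

definition ideal_relation_type :: "('a, 'c) ring_scheme \<Rightarrow> 'a set \<Rightarrow> enat" where
  "ideal_relation_type R I = relation_type R (rees_algebra R I) (rees_component R I)"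

end

theory Submission
  imports Defs "HOL-Library.Multiset_Order" "HOL-Library.Poly_Mapping"
    "HOL-Computational_Algebra.Polynomial"
begin

text \<open>
  Both ideals are compared inside a power series ring that contains all the variables at once. Let \<open>V\<close>
  be the variables of \<open>R\<close>, let \<open>W\<close> be those of \<open>S\<close> (renamed so that \<open>V\<close> and \<open>W\<close> are disjoint) and let
  \<open>T = k\<langle>V \<union> W\<rangle>\<close>. Lift the image in \<open>R/I\<close> of each variable \<open>y\<^sub>j\<close> of \<open>S\<close> to a series \<open>h\<^sub>j \<in> R\<close> without
  constant term, and likewise each \<open>x\<^sub>i\<close> to \<open>g\<^sub>i \<in> S\<close>. This gives retractions \<open>\<pi> : T \<rightarrow> R\<close> with
  \<open>y\<^sub>j \<mapsto> h\<^sub>j\<close> and \<open>\<rho> : T \<rightarrow> S\<close> with \<open>x\<^sub>i \<mapsto> g\<^sub>i\<close>. The two maps from \<open>T\<close> to \<open>R/I \<cong> S/J\<close> agree on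
  polynomials, so they agree modulo every power of the maximal ideal, and therefore they agree, because
  ideals of \<open>S\<close> are closed (\<open>ideal_closed\<close>). Hence \<open>\<pi>\<close> and \<open>\<rho>\<close> pull \<open>I\<close> and \<open>J\<close> back to the same
  ideal \<open>K\<close> of \<open>T\<close> (\<open>ideal_rt_le_corr\<close>), and it remains to see that the relation type of \<open>I\<close> in \<open>R\<close>
  is that of \<open>K\<close> in \<open>T\<close>.

  For this the variables of \<open>W\<close> are adjoined one at a time (\<open>retraction_chain\<close>). Each step is a ring
  \<open>T\<close> with a subring \<open>A\<close> and a retraction \<open>T \<rightarrow> A\<close> whose kernel is generated by one nonzerodivisor
  \<open>z\<close> (here \<open>z = y\<^sub>j - h\<^sub>j\<close>), and the preimage of an ideal generated by \<open>f\<^sub>1, \<dots>, f\<^sub>m \<in> A\<close> is generated by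
  \<open>z, f\<^sub>1, \<dots>, f\<^sub>m\<close>. Its relations are generated by those of the \<open>f\<^sub>i\<close> over \<open>A\<close> and the linear relations
  \<open>z F\<^sub>i - f\<^sub>i Z\<close>: subtract from a relation its value under \<open>z, Z \<mapsto> 0\<close>; modulo the linear relations the
  rest is a multiple \<open>Z p'\<close>, and \<open>p'\<close> is a relation of smaller degree because \<open>z\<close> is a nonzerodivisor
  (\<open>rt_le_extend\<close>). The converse comparison applies \<open>z, Z \<mapsto> 0\<close> to a system of generating relations
  (\<open>rt_le_retract\<close>). The bound does not depend on the generators of the ideal (\<open>rt_le_independent\<close>).

  All facts about power series come from one division theorem (\<open>division\<close>), for finitely many
  divisors whose leading monomials are given. It yields that ideals are closed, that series with
  nonzero constant term are units, and that \<open>k\<langle>V, y\<rangle> / (y - h) = k\<langle>V\<rangle>\<close>; the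
  resulting retraction plays the part of the substitution \<open>y \<mapsto> h\<close>. Formal power series are the
  convergent ones for the trivial absolute value (\<open>formal_series_eq\<close>), so that only convergent series
  have to be treated.

  The arguments are carried out for subrings of a commutative ring type. The last sections identify
  the relation type of the Rees algebra with this picture (\<open>ideal_relation_type_eq\<close>).
\<close>

section \<open>Subrings, ideals and polynomials over a subring\<close>

definition is_subring :: "'a::comm_ring_1 set \<Rightarrow> bool" where
  "is_subring A \<longleftrightarrow> 0 \<in> A \<and> 1 \<in> A \<and> (\<forall>x\<in>A. \<forall>y\<in>A. x + y \<in> A \<and> x * y \<in> A) \<and> (\<forall>x\<in>A. - x \<in> A)"

definition is_ideal :: "'a::comm_ring_1 set \<Rightarrow> 'a set \<Rightarrow> bool" where
  "is_ideal A I \<longleftrightarrow> I \<subseteq> A \<and> 0 \<in> I \<and> (\<forall>x\<in>I. \<forall>y\<in>I. x + y \<in> I) \<and> (\<forall>a\<in>A. \<forall>x\<in>I. a * x \<in> I)"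

definition hom_on :: "'a::comm_ring_1 set \<Rightarrow> ('a \<Rightarrow> 'b::comm_ring_1) \<Rightarrow> bool" where
  "hom_on A \<phi> \<longleftrightarrow> \<phi> 1 = 1 \<and> (\<forall>x\<in>A. \<forall>y\<in>A. \<phi> (x + y) = \<phi> x + \<phi> y \<and> \<phi> (x * y) = \<phi> x * \<phi> y)"

inductive_set gen_ideal :: "'a::comm_ring_1 set \<Rightarrow> 'a set \<Rightarrow> 'a set" for B X where
  zero: "0 \<in> gen_ideal B X"
| add: "b \<in> B \<Longrightarrow> x \<in> X \<Longrightarrow> y \<in> gen_ideal B X \<Longrightarrow> b * x + y \<in> gen_ideal B X"

lemma subringD:
  assumes "is_subring A"
  shows "0 \<in> A" "1 \<in> A" "x \<in> A \<Longrightarrow> y \<in> A \<Longrightarrow> x + y \<in> A" "x \<in> A \<Longrightarrow> y \<in> A \<Longrightarrow> x * y \<in> A"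
    "x \<in> A \<Longrightarrow> - x \<in> A" "x \<in> A \<Longrightarrow> y \<in> A \<Longrightarrow> x - y \<in> A"
  using assms unfolding is_subring_def by (auto, metis diff_conv_add_uminus)

lemma subring_sum: "is_subring A \<Longrightarrow> (\<And>i. i \<in> F \<Longrightarrow> f i \<in> A) \<Longrightarrow> sum f F \<in> A"
  by (induction F rule: infinite_finite_induct) (auto simp: subringD)

lemma subring_prod_mset: "is_subring A \<Longrightarrow> (\<And>i. i \<in># a \<Longrightarrow> f i \<in> A) \<Longrightarrow> prod_mset (image_mset f a) \<in> A"
  by (induction a) (auto simp: subringD)

lemma idealD:
  assumes "is_ideal A I"
  shows "0 \<in> I" "x \<in> I \<Longrightarrow> x \<in> A" "x \<in> I \<Longrightarrow> y \<in> I \<Longrightarrow> x + y \<in> I" "a \<in> A \<Longrightarrow> x \<in> I \<Longrightarrow> a * x \<in> I"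
    "x \<in> I \<Longrightarrow> a \<in> A \<Longrightarrow> x * a \<in> I"
  using assms unfolding is_ideal_def by (auto simp: mult.commute)

lemma ideal_minus:
  assumes "is_subring A" "is_ideal A I"
  shows "x \<in> I \<Longrightarrow> - x \<in> I" "x \<in> I \<Longrightarrow> y \<in> I \<Longrightarrow> x - y \<in> I"
proof -
  have m: "- x \<in> I" if "x \<in> I" for x
    using idealD(4)[OF assms(2), of "-1" x] that subringD[OF assms(1)] by auto
  show "x \<in> I \<Longrightarrow> - x \<in> I" by (rule m)
  show "x \<in> I \<Longrightarrow> y \<in> I \<Longrightarrow> x - y \<in> I"
    using idealD(3)[OF assms(2), of x "- y"] m by auto
qed

lemma ideal_sum: "is_ideal A I \<Longrightarrow> (\<And>i. i \<in> F \<Longrightarrow> f i \<in> I) \<Longrightarrow> sum f F \<in> I"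
  by (induction F rule: infinite_finite_induct) (auto simp: idealD)

lemma homD:
  assumes "hom_on A \<phi>" "is_subring A"
  shows "\<phi> 0 = 0" "\<phi> 1 = 1" "x \<in> A \<Longrightarrow> y \<in> A \<Longrightarrow> \<phi> (x + y) = \<phi> x + \<phi> y"
    "x \<in> A \<Longrightarrow> y \<in> A \<Longrightarrow> \<phi> (x * y) = \<phi> x * \<phi> y" "x \<in> A \<Longrightarrow> \<phi> (- x) = - \<phi> x"
    "x \<in> A \<Longrightarrow> y \<in> A \<Longrightarrow> \<phi> (x - y) = \<phi> x - \<phi> y"
proof -
  show 1: "\<phi> 1 = 1" and 2: "\<And>x y. x \<in> A \<Longrightarrow> y \<in> A \<Longrightarrow> \<phi> (x + y) = \<phi> x + \<phi> y"
    and 3: "x \<in> A \<Longrightarrow> y \<in> A \<Longrightarrow> \<phi> (x * y) = \<phi> x * \<phi> y"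
    using assms unfolding hom_on_def by auto
  show 0: "\<phi> 0 = 0" using 2[of 0 0] subringD[OF assms(2)] by auto
  have 4: "\<phi> (- x) = - \<phi> x" if "x \<in> A" for x
    using 2[of x "- x"] 0 subringD[OF assms(2)] that by (auto simp: add_eq_0_iff)
  show "x \<in> A \<Longrightarrow> \<phi> (- x) = - \<phi> x" by (rule 4)
  show "x \<in> A \<Longrightarrow> y \<in> A \<Longrightarrow> \<phi> (x - y) = \<phi> x - \<phi> y"
    using 2[of x "- y"] 4[of y] subringD[OF assms(2)] by auto
qed

lemma hom_on_comp: "hom_on A \<phi> \<Longrightarrow> hom_on B \<psi> \<Longrightarrow> (\<And>a. a \<in> A \<Longrightarrow> \<phi> a \<in> B) \<Longrightarrow> hom_on A (\<psi> \<circ> \<phi>)"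
  unfolding hom_on_def by simp

lemma hom_on_id: "hom_on A id"
  unfolding hom_on_def by simp

lemma hom_prod_mset:
  assumes "hom_on A \<phi>" "is_subring A" "\<And>i. i \<in># a \<Longrightarrow> f i \<in> A"
  shows "\<phi> (prod_mset (image_mset f a)) = prod_mset (image_mset (\<lambda>i. \<phi> (f i)) a)"
  using assms(3) by (induction a) (auto simp: homD[OF assms(1,2)] subring_prod_mset[OF assms(2)])

lemma hom_sum:
  assumes "hom_on A \<phi>" "is_subring A" "\<And>i. i \<in> F \<Longrightarrow> f i \<in> A"
  shows "\<phi> (sum f F) = (\<Sum>i\<in>F. \<phi> (f i))"
  using assms(3)
  by (induction F rule: infinite_finite_induct) (auto simp: homD[OF assms(1,2)] subring_sum[OF assms(2)])

lemma gen_ideal_add: "x \<in> gen_ideal B X \<Longrightarrow> y \<in> gen_ideal B X \<Longrightarrow> x + y \<in> gen_ideal B X"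
  by (induction x rule: gen_ideal.induct) (auto simp: add.assoc intro: gen_ideal.add)

lemma gen_ideal_mult:
  assumes "is_subring B" "c \<in> B"
  shows "x \<in> gen_ideal B X \<Longrightarrow> c * x \<in> gen_ideal B X"
proof (induction x rule: gen_ideal.induct)
  case (add b x y)
  have "(c * b) * x + c * y \<in> gen_ideal B X"
    using add assms by (auto intro!: gen_ideal.add subringD(4))
  then show ?case by (simp add: algebra_simps)
qed (auto intro: gen_ideal.zero)

lemma gen_ideal_in: "is_subring B \<Longrightarrow> x \<in> X \<Longrightarrow> x \<in> gen_ideal B X"
  using gen_ideal.add[of 1 B x X 0] gen_ideal.zero subringD(2) by fastforce

lemma gen_ideal_least:
  assumes "is_ideal B I" "X \<subseteq> I"
  shows "gen_ideal B X \<subseteq> I"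
proof
  show "x \<in> I" if "x \<in> gen_ideal B X" for x
    using that by induction (use assms in \<open>auto simp: idealD\<close>)
qed

lemma gen_ideal_ideal:
  assumes "is_subring B" "X \<subseteq> B"
  shows "is_ideal B (gen_ideal B X)"
proof -
  have "is_ideal B B" using assms(1) unfolding is_ideal_def by (auto simp: subringD)
  then have "gen_ideal B X \<subseteq> B" using gen_ideal_least assms(2) by blast
  then show ?thesis unfolding is_ideal_def
    using gen_ideal_add gen_ideal_mult[OF assms(1)] gen_ideal.zero by blast
qed

lemma gen_ideal_map:
  assumes "is_subring B" "hom_on B \<phi>" "X \<subseteq> B" "\<And>b. b \<in> B \<Longrightarrow> \<phi> b \<in> C" "\<And>x. x \<in> X \<Longrightarrow> \<phi> x \<in> Y"
  shows "x \<in> gen_ideal B X \<Longrightarrow> \<phi> x \<in> gen_ideal C Y"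
proof (induction x rule: gen_ideal.induct)
  case zero
  then show ?case using homD(1)[OF assms(2,1)] gen_ideal.zero by metis
next
  case (add b x y)
  have "y \<in> B" using add idealD(2)[OF gen_ideal_ideal[OF assms(1,3)]] by blast
  then have "\<phi> (b * x + y) = \<phi> b * \<phi> x + \<phi> y"
    using add assms(1,3) by (subst homD(3)[OF assms(2,1)]) (auto simp: homD[OF assms(2,1)] subringD)
  then show ?case using add assms gen_ideal.add by metis
qed

abbreviation "lookup \<equiv> Poly_Mapping.lookup"
abbreviation "keys \<equiv> Poly_Mapping.keys"
abbreviation "single \<equiv> Poly_Mapping.single"

text \<open>
  Variables are indexed by an arbitrary type \<open>'i\<close>, so that a variable can be added by passing to
  \<open>'i option\<close>. Polynomials are finitely supported functions on multisets of variables, and \<open>polys A M\<close>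
  are those with coefficients in \<open>A\<close> and monomials in \<open>M\<close>.
\<close>

definition mons :: "'i set \<Rightarrow> 'i multiset set" where
  "mons N = {a. set_mset a \<subseteq> N}"

definition polys :: "'a::comm_ring_1 set \<Rightarrow> 'i multiset set \<Rightarrow> ('i multiset \<Rightarrow>\<^sub>0 'a) set" where
  "polys A M = {p. (\<forall>a. lookup p a \<in> A) \<and> keys p \<subseteq> M}"

definition peval :: "('a::comm_ring_1 \<Rightarrow> 'b::comm_ring_1) \<Rightarrow> ('i \<Rightarrow> 'b) \<Rightarrow> ('i multiset \<Rightarrow>\<^sub>0 'a) \<Rightarrow> 'b" where
  "peval \<phi> L p = (\<Sum>a\<in>keys p. \<phi> (lookup p a) * prod_mset (image_mset L a))"

text \<open>
  The evaluation \<open>X\<^sub>i \<mapsto> f\<^sub>i t\<close> with values in \<open>'a[t]\<close>, which contains the Rees algebra.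
\<close>

abbreviation rees_eval :: "('i \<Rightarrow> 'a::comm_ring_1) \<Rightarrow> ('i multiset \<Rightarrow>\<^sub>0 'a) \<Rightarrow> 'a poly" where
  "rees_eval f \<equiv> peval (\<lambda>c. [:c:]) (\<lambda>i. [:0, f i:])"

lemma mons_simps [simp]: "{#} \<in> mons N" "add_mset i a \<in> mons N \<longleftrightarrow> i \<in> N \<and> a \<in> mons N"
  "a + b \<in> mons N \<longleftrightarrow> a \<in> mons N \<and> b \<in> mons N"
  unfolding mons_def by auto

lemma polys_single: "is_subring A \<Longrightarrow> a \<in> M \<Longrightarrow> c \<in> A \<Longrightarrow> single a c \<in> polys A M"
  unfolding polys_def by (auto simp: lookup_single when_def subringD)

lemma polys_zero: "is_subring A \<Longrightarrow> 0 \<in> polys A M"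
  unfolding polys_def by (auto simp: subringD)

lemma polys_add:
  assumes "is_subring A" "p \<in> polys A M" "q \<in> polys A M"
  shows "p + q \<in> polys A M"
  using assms keys_add[of p q] unfolding polys_def by (auto simp: lookup_add subringD)

lemma polys_induct [consumes 2, case_names zero add]:
  assumes A: "is_subring A" and p: "p \<in> polys A M"
    and z: "P 0" and s: "\<And>a c p. a \<in> M \<Longrightarrow> c \<in> A \<Longrightarrow> p \<in> polys A M \<Longrightarrow> P p \<Longrightarrow> P (single a c + p)"
  shows "P p"
  using p
proof (induction "card (keys p)" arbitrary: p)
  case 0
  then have "p = 0" by (metis card_0_eq finite_keys keys_eq_empty)
  then show ?case using z by simp
next
  case (Suc n)
  then obtain a where a: "a \<in> keys p" by fastforce
  define q where "q = p - single a (lookup p a)"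
  have l: "lookup q b = (if b = a then 0 else lookup p b)" for b
    unfolding q_def by (auto simp: lookup_minus lookup_single when_def)
  have k: "keys q = keys p - {a}"
    by (auto simp: in_keys_iff l split: if_splits)
  have q: "q \<in> polys A M" using Suc.prems A k unfolding polys_def by (auto simp: l subringD)
  have "P q" using Suc(1)[of q] Suc(2) k a q by auto
  then have "P (single a (lookup p a) + q)"
    using s Suc.prems a q unfolding polys_def by blast
  then show ?case unfolding q_def by simp
qed

text \<open>
  Stated for three sets of monomials because it serves both for \<open>mons N\<close>, where products stay in the set,
  and for dropping all conditions on monomials.
\<close>

lemma polys_mult_aux:
  assumes A: "is_subring A" and M: "\<And>a b. a \<in> M \<Longrightarrow> b \<in> M' \<Longrightarrow> a + b \<in> M''"
    and p: "p \<in> polys A M" and q: "q \<in> polys A M'"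
  shows "p * q \<in> polys A M''"
  using A p
proof (induction p rule: polys_induct)
  case zero
  then show ?case using A by (simp add: polys_zero)
next
  case (add a c p)
  have "single a c * q \<in> polys A M''" using A q
  proof (induction q rule: polys_induct)
    case zero
    then show ?case using A by (simp add: polys_zero)
  next
    case (add b d q)
    then show ?case using A M \<open>a \<in> M\<close> \<open>c \<in> A\<close>
      by (auto simp: distrib_left mult_single intro!: polys_add polys_single subringD(4)[OF A])
  qed
  then show ?case using add A by (auto simp: distrib_right intro!: polys_add)
qed

lemma polys_subring: 
  assumes "is_subring A" shows "is_subring (polys A (mons N))"
  unfolding is_subring_def
proof safe
  show "1 \<in> polys A (mons N)"
    using polys_single[OF assms, of "{#}" "mons N" 1] subringD[OF assms] by simp
  show "p * q \<in> polys A (mons N)" if "p \<in> polys A (mons N)" "q \<in> polys A (mons N)" for p q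
    using polys_mult_aux[OF assms _ that, of "mons N"] by auto
  show "- p \<in> polys A (mons N)" if "p \<in> polys A (mons N)" for p
    using that subringD[OF assms] unfolding polys_def by (auto simp: in_keys_iff)
qed (use assms polys_add polys_zero in auto)

lemma peval_superset:
  assumes "\<phi> 0 = 0" "finite K" "keys p \<subseteq> K"
  shows "peval \<phi> L p = (\<Sum>a\<in>K. \<phi> (lookup p a) * prod_mset (image_mset L a))"
  unfolding peval_def using assms
  by (intro sum.mono_neutral_left) (auto simp: in_keys_iff)

lemma peval_zero [simp]: "peval \<phi> L 0 = 0"
  unfolding peval_def by simp

lemma peval_single: "\<phi> 0 = 0 \<Longrightarrow> peval \<phi> L (single a c) = \<phi> c * prod_mset (image_mset L a)"
  by (subst peval_superset[of _ "{a}"]) auto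

lemma peval_add:
  assumes "is_subring A" "hom_on A \<phi>" "p \<in> polys A M" "q \<in> polys A M'"
  shows "peval \<phi> L (p + q) = peval \<phi> L p + peval \<phi> L q"
proof -
  have h: "\<phi> (lookup p a + lookup q a) = \<phi> (lookup p a) + \<phi> (lookup q a)" for a
    using assms(3,4) by (auto simp: homD(3)[OF assms(2,1)] polys_def)
  show ?thesis
    using keys_add[of p q] homD(1)[OF assms(2,1)]
    by (simp add: peval_superset[of \<phi> "keys p \<union> keys q"] lookup_add h
        distrib_right sum.distrib)
qed

lemma peval_mult:
  assumes A: "is_subring A" and h: "hom_on A \<phi>" and p: "p \<in> polys A M" and q: "q \<in> polys A M'"
  shows "peval \<phi> L (p * q) = peval \<phi> L p * peval \<phi> L q"
proof -
  note h0 = homD(1)[OF h A]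
  have inU: "r \<in> polys A UNIV" if "r \<in> polys A X" for r X using that unfolding polys_def by auto
  show ?thesis using A p
  proof (induction p rule: polys_induct)
    case (add a c p)
    have 1: "peval \<phi> L (single a c * q) = peval \<phi> L (single a c) * peval \<phi> L q"
      using A q
    proof (induction q rule: polys_induct)
      case (add b d q)
      have "peval \<phi> L (single a c * (single b d + q))
        = peval \<phi> L (single (a + b) (c * d) + single a c * q)"
        by (simp add: distrib_left mult_single)
      also have "\<dots> = peval \<phi> L (single (a + b) (c * d)) + peval \<phi> L (single a c * q)"
        by (rule peval_add[OF A h, of _ UNIV _ UNIV])
          (use add \<open>c \<in> A\<close> inU in \<open>auto intro!: polys_single polys_mult_aux[OF A, of UNIV UNIV] A subringD(4)[OF A]\<close>)
      also have "\<dots> = peval \<phi> L (single a c) * peval \<phi> L (single b d + q)"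
        unfolding peval_add[OF A h polys_single[OF A UNIV_I \<open>d \<in> A\<close>] inU[OF \<open>q \<in> polys A M'\<close>]]
        using add \<open>c \<in> A\<close>
        by (simp add: peval_single h0 homD(4)[OF h A] algebra_simps)
      finally show ?case .
    qed simp
    have "peval \<phi> L ((single a c + p) * q) = peval \<phi> L (single a c * q) + peval \<phi> L (p * q)"
      unfolding distrib_right
      by (rule peval_add[OF A h, of _ UNIV _ UNIV])
          (use add q inU in \<open>auto intro!: polys_single polys_mult_aux[OF A, of UNIV UNIV] A\<close>)
    also have "\<dots> = peval \<phi> L (single a c + p) * peval \<phi> L q"
      using add 1 by (simp add: peval_add[OF A h polys_single[OF A, of a UNIV c] inU] distrib_right)
    finally show ?case .
  qed simp
qed

lemma peval_hom:
  assumes "is_subring A" "hom_on A \<phi>"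
  shows "hom_on (polys A M) (peval \<phi> L)"
proof -
  have "peval \<phi> L 1 = 1"
    using peval_single[of \<phi> L "{#}" 1] homD[OF assms(2,1)] by simp
  then show ?thesis unfolding hom_on_def using peval_add[OF assms] peval_mult[OF assms] by blast
qed

lemma peval_in:
  assumes "is_subring B" "\<And>c. c \<in> A \<Longrightarrow> \<phi> c \<in> B" "\<And>i. i \<in> N \<Longrightarrow> L i \<in> B" "p \<in> polys A (mons N)"
  shows "peval \<phi> L p \<in> B"
  unfolding peval_def
  by (intro subring_sum subringD(4) subring_prod_mset assms(1,2,3))
     (use assms(4) in \<open>auto simp: polys_def mons_def\<close>)

lemma peval_comp:
  assumes A: "is_subring A" and B: "is_subring B" and \<phi>: "hom_on A \<phi>" and \<psi>: "hom_on B \<psi>"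
    and c: "\<And>c. c \<in> A \<Longrightarrow> \<phi> c \<in> B" and L: "\<And>i. i \<in> N \<Longrightarrow> L i \<in> B" and p: "p \<in> polys A (mons N)"
  shows "\<psi> (peval \<phi> L p) = peval (\<lambda>c. \<psi> (\<phi> c)) (\<lambda>i. \<psi> (L i)) p"
proof -
  have sub: "i \<in> N" if "a \<in> keys p" "i \<in># a" for a i
    using p that unfolding polys_def mons_def by auto
  have lk: "lookup p a \<in> A" for a using p unfolding polys_def by auto
  have pm: "prod_mset (image_mset L a) \<in> B" if "a \<in> keys p" for a
    using that sub L by (intro subring_prod_mset B) auto
  show ?thesis unfolding peval_def
    by (subst hom_sum[OF \<psi> B])
       (auto simp: sub lk c L pm hom_prod_mset[OF \<psi> B] homD(4)[OF \<psi> B] subringD(4)[OF B] intro!: sum.cong)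
qed

lemma peval_cong:
  assumes "\<And>a. a \<in> keys p \<Longrightarrow> \<phi> (lookup p a) = \<psi> (lookup p a)" "\<And>a i. a \<in> keys p \<Longrightarrow> i \<in># a \<Longrightarrow> L i = K i"
  shows "peval \<phi> L p = peval \<psi> K p"
  unfolding peval_def using assms by (auto intro!: sum.cong arg_cong2[of _ _ _ _ "(*)"] arg_cong[of _ _ prod_mset] image_mset_cong)

definition var :: "'i \<Rightarrow> 'i multiset \<Rightarrow>\<^sub>0 'a::comm_ring_1" where
  "var i = single {#i#} 1"

lemma prod_mset_var: "prod_mset (image_mset var a) = single a 1"
  by (induction a) (auto simp: var_def mult_single)

lemma peval_var_id: "peval (single {#}) var p = p"
proof -
  have "is_subring (UNIV :: 'b set)" by (auto simp: is_subring_def)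
  moreover have "p \<in> polys UNIV UNIV" by (auto simp: polys_def)
  moreover have h: "hom_on UNIV (single ({#} :: 'a multiset) :: 'b \<Rightarrow> _)"
    by (auto simp: hom_on_def single_add mult_single)
  ultimately show ?thesis
  proof (induction p rule: polys_induct)
    case (add a c p)
    have "peval (single {#}) var (single a c + p)
      = peval (single {#}) var (single a c) + peval (single {#}) var p"
      by (rule peval_add[of UNIV _ _ UNIV _ UNIV]) (use add in \<open>auto simp: polys_def is_subring_def\<close>)
    also have "\<dots> = single a c + p"
      using add by (simp add: peval_single prod_mset_var mult_single)
    finally show ?case .
  qed simp
qed

lemma hom_const: "hom_on A (single {#})"
  by (auto simp: hom_on_def single_add mult_single)

lemma var_in: "is_subring A \<Longrightarrow> i \<in> N \<Longrightarrow> var i \<in> polys A (mons N)"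
  unfolding var_def by (auto intro!: polys_single simp: subringD)

lemma peval_var: "hom_on A \<phi> \<Longrightarrow> is_subring A \<Longrightarrow> peval \<phi> L (var i) = L i"
  unfolding var_def by (subst peval_single) (auto simp: homD)

definition deg_le :: "nat \<Rightarrow> ('i multiset \<Rightarrow>\<^sub>0 'a::comm_ring_1) \<Rightarrow> bool" where
  "deg_le l p \<longleftrightarrow> (\<forall>a. lookup p a \<noteq> 0 \<longrightarrow> size a \<le> l)"

lemma deg_le_add: "deg_le l p \<Longrightarrow> deg_le l q \<Longrightarrow> deg_le l (p + q)"
  unfolding deg_le_def by (metis lookup_add add.right_neutral)

lemma deg_le_sum: "(\<And>i. i \<in> F \<Longrightarrow> deg_le l (f i)) \<Longrightarrow> deg_le l (sum f F)"
  by (induction F rule: infinite_finite_induct) (auto intro!: deg_le_add simp: deg_le_def[of _ 0])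

lemma deg_le_mult:
  assumes "deg_le l p" "deg_le m q" shows "deg_le (l + m) (p * q)"
  unfolding deg_le_def
proof (intro allI impI)
  fix a assume "lookup (p * q) a \<noteq> 0"
  then have "a \<in> keys (p * q)" by (simp add: in_keys_iff)
  then obtain b c where "a = b + c" "b \<in> keys p" "c \<in> keys q"
    using keys_mult[of p q] by blast
  then show "size a \<le> l + m" using assms unfolding deg_le_def in_keys_iff by (auto intro: add_mono)
qed

lemma deg_le_mono: "deg_le l p \<Longrightarrow> l \<le> m \<Longrightarrow> deg_le m p"
  unfolding deg_le_def by fastforce

lemma deg_le_prod_mset:
  "(\<And>i. i \<in># a \<Longrightarrow> deg_le 1 (L i)) \<Longrightarrow> deg_le (size a) (prod_mset (image_mset L a))"
proof (induction a)
  case empty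
  then show ?case by (auto simp: deg_le_def lookup_one when_def split: if_splits)
next
  case (add i a)
  have "deg_le (1 + size a) (L i * prod_mset (image_mset L a))"
    using add by (intro deg_le_mult) auto
  then show ?case by simp
qed

lemma deg_le_peval:
  assumes "deg_le l p" "\<And>a i. a \<in> keys p \<Longrightarrow> i \<in># a \<Longrightarrow> deg_le 1 (L i)"
  shows "deg_le l (peval (\<lambda>c. single {#} (\<phi> c)) L p)"
  unfolding peval_def
proof (rule deg_le_sum)
  fix a assume a: "a \<in> keys p"
  have "deg_le 0 (single {#} (\<phi> (lookup p a)))"
    by (auto simp: deg_le_def lookup_single when_def split: if_splits)
  from deg_le_mult[OF this deg_le_prod_mset[of a L]] assms(2)[OF a]
  have "deg_le (size a) (single {#} (\<phi> (lookup p a)) * prod_mset (image_mset L a))"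
    by auto
  then show "deg_le l (single {#} (\<phi> (lookup p a)) * prod_mset (image_mset L a))"
    using assms(1) a by (auto simp: deg_le_def[of _ p] in_keys_iff intro: deg_le_mono)
qed

section \<open>The relation type of a generating family\<close>

text \<open>
  The relations between the elements \<open>f\<^sub>i t\<close> of the Rees algebra, and the ideal generated by the
  relations of degree at most \<open>l\<close>; \<open>rt_le\<close> says that these generate everything, so that the relation
  type with respect to the family \<open>f\<close> is at most \<open>l\<close>.
\<close>

definition Rel :: "'a::comm_ring_1 set \<Rightarrow> 'i set \<Rightarrow> ('i \<Rightarrow> 'a) \<Rightarrow> ('i multiset \<Rightarrow>\<^sub>0 'a) set" where
  "Rel A N f = {p \<in> polys A (mons N). rees_eval f p = 0}"

definition low_gen :: "'a::comm_ring_1 set \<Rightarrow> 'i set \<Rightarrow> ('i \<Rightarrow> 'a) \<Rightarrow> nat \<Rightarrow> ('i multiset \<Rightarrow>\<^sub>0 'a) set" where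
  "low_gen A N f l = gen_ideal (polys A (mons N)) {r \<in> Rel A N f. deg_le l r}"

definition rt_le :: "'a::comm_ring_1 set \<Rightarrow> 'i set \<Rightarrow> ('i \<Rightarrow> 'a) \<Rightarrow> nat \<Rightarrow> bool" where
  "rt_le A N f l \<longleftrightarrow> Rel A N f \<subseteq> low_gen A N f l"

lemma hom_pCons: "hom_on A (\<lambda>c. [:c:])"
  by (auto simp: hom_on_def one_pCons)

lemma prod_mset_linear: "prod_mset (image_mset (\<lambda>i. [:0, f i:]) a) = Polynomial.monom (prod_mset (image_mset f a)) (size a)"
  by (induction a) (auto simp: monom_Suc monom_0 one_pCons smult_monom)

lemma low_gen_ideal:
  assumes "is_subring A" shows "is_ideal (polys A (mons N)) (low_gen A N f l)"
  unfolding low_gen_def by (rule gen_ideal_ideal[OF polys_subring[OF assms]]) (auto simp: Rel_def)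

lemma low_gen_in:
  assumes "is_subring A" "r \<in> Rel A N f" "deg_le l r" shows "r \<in> low_gen A N f l"
  unfolding low_gen_def by (rule gen_ideal_in[OF polys_subring[OF assms(1)]]) (use assms in auto)

lemma Rel_ideal:
  assumes A: "is_subring A" shows "is_ideal (polys A (mons N)) (Rel A N f)"
  unfolding is_ideal_def Rel_def
  using polys_subring[OF A, of N] peval_add[OF A hom_pCons, of _ "mons N" _ "mons N"]
    peval_mult[OF A hom_pCons, of _ "mons N" _ "mons N"]
  by (auto simp: subringD)

lemma low_gen_subset: "is_subring A \<Longrightarrow> low_gen A N f l \<subseteq> Rel A N f"
  unfolding low_gen_def by (rule gen_ideal_least[OF Rel_ideal]) auto

text \<open>
  Applying \<open>\<phi>\<close> to the coefficients and to the \<open>f\<^sub>i\<close> applies \<open>\<phi>\<close> to the value in \<open>A[t]\<close>. In particular it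
  turns relations into relations. With \<open>\<phi> = id\<close> it says that values have coefficients in \<open>A\<close>.
\<close>

lemma coeff_peval_map:
  assumes A: "is_subring A" and \<phi>: "hom_on A \<phi>" and f: "\<And>i. i \<in> N \<Longrightarrow> f i \<in> A" and p: "p \<in> polys A (mons N)"
  shows "Polynomial.coeff (peval (\<lambda>c. [:\<phi> c:]) (\<lambda>i. [:0, \<phi> (f i):]) p) d = \<phi> (Polynomial.coeff (rees_eval f p) d)
    \<and> Polynomial.coeff (rees_eval f p) d \<in> A"
  using A p
proof (induction p rule: polys_induct)
  case zero
  then show ?case using A \<phi> by (simp add: homD subringD)
next
  case (add a c p)
  have h: "hom_on A (\<lambda>c. [:\<phi> c:])" using \<phi> unfolding hom_on_def by (auto simp: one_pCons)
  have s: "single a c \<in> polys A (mons N)" using add A polys_single by blast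
  have a: "i \<in> N" if "i \<in># a" for i using that add unfolding mons_def by auto
  have pr: "prod_mset (image_mset f a) \<in> A"
    using a f by (intro subring_prod_mset A) auto
  have ph: "prod_mset (image_mset (\<lambda>i. \<phi> (f i)) a) = \<phi> (prod_mset (image_mset f a))"
    using a f by (subst hom_prod_mset[OF \<phi> A]) auto
  have 1: "Polynomial.coeff (peval (\<lambda>c. [:\<phi> c:]) (\<lambda>i. [:0, \<phi> (f i):]) (single a c)) d
      = (if d = size a then \<phi> (c * prod_mset (image_mset f a)) else 0)"
    using homD(1)[OF h A] add pr
    by (simp add: peval_single prod_mset_linear ph smult_monom homD(4)[OF \<phi> A])
  have 2: "Polynomial.coeff (rees_eval f (single a c)) d
      = (if d = size a then c * prod_mset (image_mset f a) else 0)"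
    by (simp add: peval_single prod_mset_linear smult_monom)
  show ?case
    unfolding peval_add[OF A h s add(3)] peval_add[OF A hom_pCons s add(3)] coeff_add 1 2
    using add pr A \<phi> by (auto simp: homD[OF \<phi> A] subringD)
qed

text \<open>
  One statement for the three changes of the presentation that occur: new generators of the same ideal
  (\<open>\<phi> = id\<close> and \<open>L\<^sub>i\<close> a linear form with value \<open>f\<^sub>i t\<close>), extension of the coefficient ring, and
  specialisation along a retraction.
\<close>

lemma Rel_map:
  assumes A: "is_subring A" and B: "is_subring B" and \<phi>: "hom_on A \<phi>" and \<phi>AB: "\<And>c. c \<in> A \<Longrightarrow> \<phi> c \<in> B"
    and f: "\<And>i. i \<in> N \<Longrightarrow> f i \<in> A"
    and L: "\<And>i. i \<in> N \<Longrightarrow> L i \<in> polys B (mons M)"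
    and ev: "\<And>i. i \<in> N \<Longrightarrow> rees_eval g (L i) = [:0, \<phi> (f i):]"
    and p: "p \<in> Rel A N f"
  shows "peval (\<lambda>c. single {#} (\<phi> c)) L p \<in> Rel B M g"
proof -
  have pA: "p \<in> polys A (mons N)" and p0: "rees_eval f p = 0"
    using p unfolding Rel_def by auto
  have h: "hom_on A (\<lambda>c. single {#} (\<phi> c) :: _ multiset \<Rightarrow>\<^sub>0 _)"
    using \<phi> unfolding hom_on_def by (auto simp: single_add mult_single)
  have in_polys: "peval (\<lambda>c. single {#} (\<phi> c)) L p \<in> polys B (mons M)"
    by (rule peval_in[OF polys_subring[OF B] _ _ pA]) (use L \<phi>AB in \<open>auto intro!: polys_single B\<close>)
  have "rees_eval g (peval (\<lambda>c. single {#} (\<phi> c)) L p)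
    = peval (\<lambda>c. rees_eval g (single {#} (\<phi> c))) (\<lambda>i. rees_eval g (L i)) p"
    by (rule peval_comp[OF A polys_subring[OF B] h peval_hom[OF B hom_pCons] _ L pA])
       (use \<phi>AB in \<open>auto intro!: polys_single B\<close>)
  also have "\<dots> = peval (\<lambda>c. [:\<phi> c:]) (\<lambda>i. [:0, \<phi> (f i):]) p"
    by (rule peval_cong) (use pA ev in \<open>auto simp: peval_single one_pCons polys_def mons_def\<close>)
  also have "\<dots> = 0"
    using coeff_peval_map[OF A \<phi> f pA] homD(1)[OF \<phi> A] by (intro poly_eqI) (simp add: p0)
  finally show ?thesis using in_polys unfolding Rel_def by auto
qed

text \<open>
  The substituted forms \<open>L\<^sub>i\<close> have degree at most one, so the substitution does not raise degrees and it
  respects the bound \<open>l\<close>.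
\<close>

lemma low_gen_map:
  assumes A: "is_subring A" and B: "is_subring B" and \<phi>: "hom_on A \<phi>" and \<phi>AB: "\<And>c. c \<in> A \<Longrightarrow> \<phi> c \<in> B"
    and f: "\<And>i. i \<in> N \<Longrightarrow> f i \<in> A"
    and L: "\<And>i. i \<in> N \<Longrightarrow> L i \<in> polys B (mons M)"
    and ev: "\<And>i. i \<in> N \<Longrightarrow> rees_eval g (L i) = [:0, \<phi> (f i):]"
    and deg: "\<And>i. i \<in> N \<Longrightarrow> deg_le 1 (L i)"
    and p: "p \<in> low_gen A N f l"
  shows "peval (\<lambda>c. single {#} (\<phi> c)) L p \<in> low_gen B M g l"
proof -
  have h: "hom_on A (\<lambda>c. single {#} (\<phi> c) :: _ multiset \<Rightarrow>\<^sub>0 _)"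
    using \<phi> unfolding hom_on_def by (auto simp: single_add mult_single)
  show ?thesis
    using p unfolding low_gen_def
  proof (rule gen_ideal_map[OF polys_subring[OF A] peval_hom[OF A h], rotated -1])
    show "peval (\<lambda>c. single {#} (\<phi> c)) L b \<in> polys B (mons M)" if "b \<in> polys A (mons N)" for b
      by (rule peval_in[OF polys_subring[OF B] _ _ that]) (use L \<phi>AB in \<open>auto intro!: polys_single B\<close>)
    show "peval (\<lambda>c. single {#} (\<phi> c)) L r \<in> {r \<in> Rel B M g. deg_le l r}" if "r \<in> {r \<in> Rel A N f. deg_le l r}" for r
    proof -
      have "r \<in> Rel A N f" "deg_le l r" using that by auto
      have "peval (\<lambda>c. single {#} (\<phi> c)) L r \<in> Rel B M g"
        by (rule Rel_map[OF A B \<phi> \<phi>AB f L ev \<open>r \<in> Rel A N f\<close>])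
      moreover have "deg_le l (peval (\<lambda>c. single {#} (\<phi> c)) L r)"
        by (rule deg_le_peval[OF \<open>deg_le l r\<close> deg]) (use \<open>r \<in> Rel A N f\<close> in \<open>auto simp: Rel_def polys_def mons_def\<close>)
      ultimately show ?thesis by simp
    qed
  qed (auto simp: Rel_def)
qed

lemma linear_form:
  assumes A: "is_subring A" and x: "x \<in> gen_ideal A (g ` M)"
  shows "\<exists>L. L \<in> polys A (mons M) \<and> deg_le 1 L \<and> rees_eval g L = [:0, x:]"
  using x
proof (induction x rule: gen_ideal.induct)
  case zero
  then show ?case by (intro exI[of _ 0]) (auto simp: polys_zero[OF A] deg_le_def)
next
  case (add b x y)
  then obtain L j where L: "L \<in> polys A (mons M)" "deg_le 1 L" "rees_eval g L = [:0, y:]"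
    and j: "j \<in> M" "x = g j" by auto
  have s: "single {#j#} b \<in> polys A (mons M)" using j add by (auto intro!: polys_single A)
  have "deg_le 1 (single {#j#} b)" by (auto simp: deg_le_def lookup_single when_def split: if_splits)
  moreover have "rees_eval g (single {#j#} b + L) = [:0, b * x + y:]"
    unfolding peval_add[OF A hom_pCons s L(1)] by (simp add: peval_single L j)
  ultimately show ?case using L s polys_add[OF A s L(1)] deg_le_add by blast
qed

lemma prod_mset_cong_ideal:
  assumes B: "is_subring B" and H: "is_ideal B H" 
    and "\<And>i. i \<in># a \<Longrightarrow> x i \<in> B \<and> y i \<in> B \<and> x i - y i \<in> H"
  shows "prod_mset (image_mset x a) - prod_mset (image_mset y a) \<in> H"
  using assms(3)
proof (induction a)
  case empty
  then show ?case using idealD(1)[OF H] by simp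
next
  case (add i a)
  have "prod_mset (image_mset y a) \<in> B" using add by (intro subring_prod_mset B) auto
  then have "x i * (prod_mset (image_mset x a) - prod_mset (image_mset y a)) + (x i - y i) * prod_mset (image_mset y a) \<in> H"
    using add by (intro idealD(3,4,5)[OF H]) auto
  then show ?case by (simp add: algebra_simps)
qed

lemma peval_cong_ideal:
  assumes A: "is_subring A" and B: "is_subring B" and H: "is_ideal B H" and \<phi>: "\<And>c. c \<in> A \<Longrightarrow> \<phi> c \<in> B"
    and xy: "\<And>i. i \<in> N \<Longrightarrow> x i \<in> B \<and> y i \<in> B \<and> x i - y i \<in> H" and p: "p \<in> polys A (mons N)"
  shows "peval \<phi> x p - peval \<phi> y p \<in> H"
  unfolding peval_def sum_subtractf[symmetric] right_diff_distrib[symmetric]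
  by (intro ideal_sum[OF H] idealD(4)[OF H] \<phi> prod_mset_cong_ideal[OF B H] xy)
     (use p in \<open>auto simp: polys_def mons_def\<close>)

text \<open>
  Linear forms expressing the \<open>f\<^sub>i\<close> by the \<open>g\<^sub>j\<close> and vice versa give substitutions \<open>\<sigma>\<close> and \<open>\<tau>\<close>. A relation
  \<open>p\<close> between the \<open>g\<^sub>j\<close> is \<open>\<sigma> (\<tau> p)\<close>, which is the image of a relation between the \<open>f\<^sub>i\<close>, up to the ideal
  generated by the relations \<open>X\<^sub>j - \<sigma> (\<tau> X\<^sub>j)\<close>. These have degree at most one, which is why \<open>l \<ge> 1\<close> is needed.
\<close>

lemma rt_le_independent:
  fixes f :: "'i \<Rightarrow> 'a::comm_ring_1" and g :: "'j \<Rightarrow> 'a"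
  assumes A: "is_subring A" and f: "f ` N \<subseteq> A" and g: "g ` M \<subseteq> A" 
    and eq: "gen_ideal A (f ` N) = gen_ideal A (g ` M)"
    and l: "1 \<le> l" and rt: "rt_le A N f l"
  shows "rt_le A M g l"
proof -
  have "\<exists>L. \<forall>i\<in>N. L i \<in> polys A (mons M) \<and> deg_le 1 (L i) \<and> rees_eval g (L i) = [:0, f i:]"
    using linear_form[OF A] gen_ideal_in[OF A] eq by (intro bchoice) blast
  then obtain L where L: "\<And>i. i \<in> N \<Longrightarrow> L i \<in> polys A (mons M)" "\<And>i. i \<in> N \<Longrightarrow> deg_le 1 (L i)"
    "\<And>i. i \<in> N \<Longrightarrow> rees_eval g (L i) = [:0, id (f i):]" by auto
  have "\<exists>L. \<forall>i\<in>M. L i \<in> polys A (mons N) \<and> deg_le 1 (L i) \<and> rees_eval f (L i) = [:0, g i:]"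
    using linear_form[OF A] gen_ideal_in[OF A] eq by (intro bchoice) blast
  then obtain K where K: "\<And>i. i \<in> M \<Longrightarrow> K i \<in> polys A (mons N)" "\<And>i. i \<in> M \<Longrightarrow> deg_le 1 (K i)"
    "\<And>i. i \<in> M \<Longrightarrow> rees_eval f (K i) = [:0, id (g i):]" by auto
  define \<sigma> where "\<sigma> = peval (\<lambda>c. single {#} (id c)) L"
  define \<tau> where "\<tau> = peval (\<lambda>c. single {#} (id c)) K"
  have homA: "hom_on A (\<lambda>c. single {#} (id c))" using hom_const by simp
  have \<sigma>in: "\<sigma> p \<in> polys A (mons M)" if "p \<in> polys A (mons N)" for p
    unfolding \<sigma>_def by (rule peval_in[OF polys_subring[OF A] _ _ that]) (use L in \<open>auto intro!: polys_single A\<close>)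
  show ?thesis unfolding rt_le_def
  proof
    fix p assume p: "p \<in> Rel A M g"
    then have pA: "p \<in> polys A (mons M)" unfolding Rel_def by auto
    have "\<tau> p \<in> Rel A N f"
      unfolding \<tau>_def by (rule Rel_map[OF A A hom_on_id _ _ _ K(3) p]) (use K g in auto)
    then have "\<tau> p \<in> low_gen A N f l" using rt unfolding rt_le_def by auto
    then have 1: "\<sigma> (\<tau> p) \<in> low_gen A M g l"
      unfolding \<sigma>_def by (intro low_gen_map[OF A A hom_on_id _ _ _ L(3)]) (use L f in auto)
    have "\<sigma> (\<tau> p) = peval (\<lambda>c. \<sigma> (single {#} (id c))) (\<lambda>i. \<sigma> (K i)) p"
      unfolding \<tau>_def 
      by (rule peval_comp[OF A polys_subring[OF A] homA _ _ K(1) pA])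
         (use peval_hom[OF A homA] in \<open>auto simp: \<sigma>_def intro!: polys_single A\<close>)
    also have "\<dots> = peval (single {#}) (\<lambda>i. \<sigma> (K i)) p"
      by (rule peval_cong) (auto simp: \<sigma>_def peval_single)
    finally have 2: "\<sigma> (\<tau> p) = peval (single {#}) (\<lambda>i. \<sigma> (K i)) p" .
    have "peval (single {#}) var p - peval (single {#}) (\<lambda>i. \<sigma> (K i)) p \<in> low_gen A M g l"
    proof (rule peval_cong_ideal[OF A polys_subring[OF A] low_gen_ideal[OF A] _ _ pA])
      show "single {#} c \<in> polys A (mons M)" if "c \<in> A" for c using that by (auto intro!: polys_single A)
      fix i assume i: "i \<in> M"
      have v: "var i \<in> polys A (mons M)" using var_in[OF A i] .
      have s: "\<sigma> (K i) \<in> polys A (mons M)" using \<sigma>in K i by auto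
      have d: "var i - \<sigma> (K i) \<in> polys A (mons M)" using subringD(6)[OF polys_subring[OF A] v s] .
      have "K i \<in> polys A (mons N)" using K i by auto
      then have "rees_eval g (\<sigma> (K i))
        = peval (\<lambda>c. rees_eval g (single {#} (id c))) (\<lambda>i. rees_eval g (L i)) (K i)"
        unfolding \<sigma>_def by (intro peval_comp[OF A polys_subring[OF A] homA peval_hom[OF A hom_pCons] _ L(1)])
         (auto intro!: polys_single A)
      also have "\<dots> = rees_eval f (K i)"
        by (rule peval_cong) (use \<open>K i \<in> _\<close> L(3) in \<open>auto simp: peval_single one_pCons polys_def mons_def\<close>)
      also have "\<dots> = [:0, g i:]" using K i by auto
      finally have "rees_eval g (var i - \<sigma> (K i)) = 0"
        unfolding homD(6)[OF peval_hom[OF A hom_pCons] polys_subring[OF A] v s]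
        by (simp add: peval_var[OF hom_pCons[of A] A])
      then have r: "var i - \<sigma> (K i) \<in> Rel A M g" using d unfolding Rel_def by auto
      have "deg_le 1 (\<sigma> (K i))"
        unfolding \<sigma>_def
        by (rule deg_le_peval[OF K(2)[OF i] L(2)]) (use K(1)[OF i] in \<open>auto simp: polys_def mons_def\<close>)
      then have "deg_le 1 (var i - \<sigma> (K i))"
        unfolding deg_le_def var_def by (auto simp: lookup_minus lookup_single when_def split: if_splits)
      then have "var i - \<sigma> (K i) \<in> low_gen A M g l"
        using low_gen_in[OF A r] deg_le_mono l by blast
      then show "var i \<in> polys A (mons M) \<and> \<sigma> (K i) \<in> polys A (mons M) \<and> var i - \<sigma> (K i) \<in> low_gen A M g l"
        using v s by auto
    qed
    then show "p \<in> low_gen A M g l"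
      using idealD(3)[OF low_gen_ideal[OF A] 1] unfolding 2 peval_var_id by fastforce
  qed
qed

definition ideal_rt_le :: "'a::comm_ring_1 set \<Rightarrow> 'a set \<Rightarrow> nat \<Rightarrow> bool" where
  "ideal_rt_le A I l \<longleftrightarrow> (\<exists>(m::nat) f. f ` {..<m} \<subseteq> A \<and> gen_ideal A (f ` {..<m}) = I \<and> rt_le A {..<m} f l)"

section \<open>Simple extensions\<close>

text \<open>
  The model is \<open>A = k\<langle>V\<rangle>\<close> inside \<open>T = k\<langle>V, y\<rangle>\<close> with \<open>z = y - h\<close>, \<open>h \<in> A\<close>, and \<open>\<pi>\<close> the substitution
  \<open>y \<mapsto> h\<close>.
\<close>

locale simple_ext =
  fixes A T :: "'a::comm_ring_1 set" and \<pi> :: "'a \<Rightarrow> 'a" and z :: 'a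
  assumes A: "is_subring A" and T: "is_subring T" and AT: "A \<subseteq> T" and \<pi>: "hom_on T \<pi>"
    and \<pi>A: "\<And>t. t \<in> T \<Longrightarrow> \<pi> t \<in> A" and \<pi>id: "\<And>a. a \<in> A \<Longrightarrow> \<pi> a = a"
    and z: "z \<in> T" and \<pi>z: "\<pi> z = 0"
    and ker: "\<And>t. t \<in> T \<Longrightarrow> \<exists>q\<in>T. t = \<pi> t + q * z"
    and nzd: "\<And>t. t \<in> T \<Longrightarrow> z * t = 0 \<Longrightarrow> t = 0"
begin

text \<open>
  The index \<open>None\<close> belongs to the additional generator \<open>z\<close>. The map \<open>spec\<close> is \<open>z, Z \<mapsto> 0\<close>, from polynomials
  over \<open>T\<close> to polynomials over \<open>A\<close>, and \<open>emb\<close> is the inclusion in the other direction.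
\<close>

definition gens :: "('i \<Rightarrow> 'a) \<Rightarrow> 'i option \<Rightarrow> 'a" where
  "gens f = case_option z f"

definition idx :: "'i set \<Rightarrow> 'i option set" where
  "idx N = insert None (Some ` N)"

definition spec :: "('i option multiset \<Rightarrow>\<^sub>0 'a) \<Rightarrow> 'i multiset \<Rightarrow>\<^sub>0 'a" where
  "spec = peval (\<lambda>c. single {#} (\<pi> c)) (case_option 0 var)"

definition emb :: "('i multiset \<Rightarrow>\<^sub>0 'a) \<Rightarrow> 'i option multiset \<Rightarrow>\<^sub>0 'a" where
  "emb = peval (\<lambda>c. single {#} (id c)) (\<lambda>i. var (Some i))"

lemma hom_spec_const: "hom_on T (\<lambda>c. single {#} (\<pi> c))"
  using \<pi> unfolding hom_on_def by (auto simp: single_add mult_single)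

lemma hom_emb_const: "hom_on A (\<lambda>c. single {#} (id c))"
  unfolding hom_on_def by (auto simp: single_add mult_single)

lemma spec_emb:
  assumes p: "p \<in> polys A (mons N)" shows "spec (emb p) = p"
proof -
  have "spec (emb p) = peval (\<lambda>c. spec (single {#} (id c))) (\<lambda>i. spec (var (Some i))) p"
    unfolding emb_def
    by (rule peval_comp[OF A polys_subring[OF T, of "idx N"] hom_emb_const _ _ _ p])
       (use AT in \<open>auto simp: idx_def spec_def intro!: polys_single var_in T peval_hom[OF T hom_spec_const]\<close>)
  also have "\<dots> = peval (single {#}) var p"
    using p by (intro peval_cong) (auto simp: spec_def peval_var[OF hom_spec_const T] peval_single homD[OF \<pi> T] polys_def \<pi>id)
  finally show ?thesis by (simp add: peval_var_id)
qed

lemma emb_spec: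
  assumes p: "p \<in> polys T (mons (idx N))"
  shows "emb (spec p) = peval (\<lambda>c. single {#} (\<pi> c)) (case_option 0 (\<lambda>i. var (Some i))) p"
proof -
  have "emb (spec p) = peval (\<lambda>c. emb (single {#} (\<pi> c))) (\<lambda>i. emb (case_option 0 var i)) p"
    unfolding spec_def
    by (rule peval_comp[OF T polys_subring[OF A, of N] hom_spec_const _ _ _ p])
       (auto simp: idx_def emb_def \<pi>A intro!: polys_single polys_zero var_in A peval_hom[OF A hom_const])
  also have "\<dots> = peval (\<lambda>c. single {#} (\<pi> c)) (case_option 0 (\<lambda>i. var (Some i))) p"
    by (intro peval_cong) (auto simp: emb_def peval_single peval_var[OF hom_const[of A] A] split: option.split)
  finally show ?thesis .
qed

context
  fixes N :: "'i set" and f :: "'i \<Rightarrow> 'a" and l :: nat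
  assumes fA: "f ` N \<subseteq> A" and l: "1 \<le> l"
begin

lemma spec_Rel: "p \<in> Rel T (idx N) (gens f) \<Longrightarrow> spec p \<in> Rel A N f"
  unfolding spec_def
  using fA AT z by (intro Rel_map[OF T A \<pi>]) 
    (auto simp: idx_def gens_def \<pi>A \<pi>z \<pi>id image_subset_iff peval_var[OF hom_pCons A] intro!: polys_zero var_in A)

lemma spec_low_gen: "p \<in> low_gen T (idx N) (gens f) l \<Longrightarrow> spec p \<in> low_gen A N f l"
  unfolding spec_def
  using fA AT z by (intro low_gen_map[OF T A \<pi>]) 
    (auto simp: idx_def gens_def \<pi>A \<pi>z \<pi>id image_subset_iff peval_var[OF hom_pCons A]
       deg_le_def var_def lookup_single when_def split: if_splits intro!: polys_zero var_in[unfolded var_def] A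
         peval_var[OF hom_pCons A, unfolded var_def])

lemma emb_Rel: "p \<in> Rel A N f \<Longrightarrow> emb p \<in> Rel T (idx N) (gens f)"
  unfolding emb_def
  using fA AT by (intro Rel_map[OF A T hom_on_id]) 
    (auto simp: idx_def gens_def image_subset_iff peval_var[OF hom_pCons A] intro!: var_in T)

lemma emb_low_gen: "p \<in> low_gen A N f l \<Longrightarrow> emb p \<in> low_gen T (idx N) (gens f) l"
  unfolding emb_def
  using fA AT by (intro low_gen_map[OF A T hom_on_id]) 
    (auto simp: idx_def gens_def image_subset_iff peval_single
       deg_le_def var_def lookup_single when_def split: if_splits intro!: var_in[unfolded var_def] T)

text \<open>
  Specialisation maps generating relations of low degree to relations of low degree and fixes the
  relations over \<open>A\<close>.
\<close>

lemma rt_le_retract: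
  assumes "rt_le T (idx N) (gens f) l" shows "rt_le A N f l"
  unfolding rt_le_def
proof
  fix p assume p: "p \<in> Rel A N f"
  then have "spec (emb p) \<in> low_gen A N f l"
    using assms emb_Rel spec_low_gen unfolding rt_le_def by blast
  then show "p \<in> low_gen A N f l" using spec_emb[of p N] p unfolding Rel_def by auto
qed

text \<open>
  If \<open>Z\<close> divides the monomial there is nothing to do. Otherwise write \<open>c = \<pi> c + q z\<close> and replace
  \<open>z F\<^sub>j\<close> by \<open>f\<^sub>j Z\<close> for one variable \<open>F\<^sub>j\<close> of the monomial, using the linear relation
  \<open>z F\<^sub>j - f\<^sub>j Z\<close>.
\<close>

lemma decompose_monomial:
  assumes a: "a \<in> mons (idx N)" "a \<noteq> {#}" "size a \<le> Suc n" and c: "c \<in> T"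
  shows "\<exists>p'\<in>polys T (mons (idx N)). deg_le n p' \<and>
    single a c - peval (\<lambda>c. single {#} (\<pi> c)) (case_option 0 (\<lambda>i. var (Some i))) (single a c) - var None * p'
      \<in> low_gen T (idx N) (gens f) l"
proof (cases "None \<in># a")
  case True
  then obtain b where b: "a = add_mset None b" by (metis insert_DiffM)
  have "deg_le n (single b c)" using a b by (auto simp: deg_le_def lookup_single when_def split: if_splits)
  moreover have "single b c \<in> polys T (mons (idx N))" using a b c by (auto intro!: polys_single T)
  moreover have "single a c - peval (\<lambda>c. single {#} (\<pi> c)) (case_option 0 (\<lambda>i. var (Some i))) (single a c) - var None * single b c = 0"
    using homD(1)[OF \<pi> T] by (simp add: peval_single b var_def mult_single)
  ultimately show ?thesis using idealD(1)[OF low_gen_ideal[OF T]] by metis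
next
  case False
  then obtain j b where b: "a = add_mset (Some j) b" using a(2) by (metis insert_DiffM multiset_nonemptyE not_None_eq)
  then have j: "j \<in> N" using a by (auto simp: idx_def)
  then have fj: "f j \<in> T" using fA AT by auto
  from ker[OF c] obtain q where q: "q \<in> T" "c = \<pi> c + q * z" by auto
  define R where "R = single {#Some j#} z - single {#None#} (f j)"
  have R1: "single {#Some j#} z \<in> polys T (mons (idx N))" "single {#None#} (f j) \<in> polys T (mons (idx N))"
    using z fj j by (auto intro!: polys_single T simp: idx_def)
  have "rees_eval (gens f) R = 0"
    unfolding R_def homD(6)[OF peval_hom[OF T hom_pCons] polys_subring[OF T] R1]
    by (simp add: peval_single gens_def)
  moreover have "R \<in> polys T (mons (idx N))" unfolding R_def by (rule subringD(6)[OF polys_subring[OF T] R1])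
  moreover have "deg_le l R" using l unfolding R_def deg_le_def
    by (auto simp: lookup_minus lookup_single when_def split: if_splits)
  ultimately have "R \<in> low_gen T (idx N) (gens f) l" by (intro low_gen_in T) (auto simp: Rel_def)
  moreover have "single b q \<in> polys T (mons (idx N))" using a b q by (auto intro!: polys_single T)
  ultimately have 1: "single b q * R \<in> low_gen T (idx N) (gens f) l"
    using idealD(4)[OF low_gen_ideal[OF T]] by blast
  have "prod_mset (image_mset (case_option 0 (\<lambda>i. var (Some i))) a) = (prod_mset (image_mset var a) :: 'i option multiset \<Rightarrow>\<^sub>0 'a)"
    using False by (intro arg_cong[of _ _ prod_mset] image_mset_cong) (auto split: option.split)
  then have "peval (\<lambda>c. single {#} (\<pi> c)) (case_option 0 (\<lambda>i. var (Some i))) (single a c) = single a (\<pi> c)"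
    using homD(1)[OF \<pi> T] by (simp add: peval_single prod_mset_var mult_single)
  moreover have "single a c = single a (\<pi> c) + single a (q * z)"
    using q(2) by (metis single_add)
  ultimately have 2: "single a c - peval (\<lambda>c. single {#} (\<pi> c)) (case_option 0 (\<lambda>i. var (Some i))) (single a c)
      - var None * single b (q * f j) = single b q * R"
    by (simp add: R_def b right_diff_distrib mult_single var_def)
  have "deg_le n (single b (q * f j))" using a b by (auto simp: deg_le_def lookup_single when_def split: if_splits)
  moreover have "single b (q * f j) \<in> polys T (mons (idx N))"
    using a b q fj by (auto intro!: polys_single T subringD(4)[OF T])
  ultimately show ?thesis using 1 2 by metis
qed

lemma decompose:
  assumes p: "p \<in> polys T {a \<in> mons (idx N). a \<noteq> {#} \<and> size a \<le> Suc n}"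
  shows "\<exists>p'\<in>polys T (mons (idx N)). deg_le n p' \<and>
    p - peval (\<lambda>c. single {#} (\<pi> c)) (case_option 0 (\<lambda>i. var (Some i))) p - var None * p'
      \<in> low_gen T (idx N) (gens f) l"
  using T p
proof (induction p rule: polys_induct)
  case zero
  then show ?case using idealD(1)[OF low_gen_ideal[OF T]]
    by (intro bexI[of _ 0]) (auto simp: deg_le_def polys_zero[OF T])
next
  case (add a c p)
  let ?r = "peval (\<lambda>c. single {#} (\<pi> c)) (case_option 0 (\<lambda>i. var (Some i)))"
  let ?H = "low_gen T (idx N) (gens f) l"
  obtain p' where p': "p' \<in> polys T (mons (idx N))" "deg_le n p'" "p - ?r p - var None * p' \<in> ?H"
    using add by auto
  obtain q where q: "q \<in> polys T (mons (idx N))" "deg_le n q" "single a c - ?r (single a c) - var None * q \<in> ?H"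
    using decompose_monomial[of a n c] add by auto
  have "(single a c + p) - ?r (single a c + p) - var None * (q + p')
    = (single a c - ?r (single a c) - var None * q) + (p - ?r p - var None * p')"
    by (subst peval_add[OF T hom_spec_const polys_single[OF T] add(3)])
       (use add in \<open>auto simp: algebra_simps\<close>)
  then have "(single a c + p) - ?r (single a c + p) - var None * (q + p') \<in> ?H"
    using idealD(3)[OF low_gen_ideal[OF T] q(3) p'(3)] by (simp only:)
  then show ?case using p' q deg_le_add polys_add[OF T q(1) p'(1)] by blast
qed

lemma coeff_0_eval:
  assumes "p \<in> polys T M"
  shows "Polynomial.coeff (rees_eval g p) 0 = lookup p {#}"
  using T assms
proof (induction p rule: polys_induct)
  case (add a c p)
  have "Polynomial.coeff (rees_eval g (single a c)) 0 = lookup (single a c) {#}"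
    by (auto simp: peval_single prod_mset_linear lookup_single when_def)
  then show ?case using add
    by (simp add: peval_add[OF T hom_pCons polys_single[OF T, of a M c]] lookup_add)
qed simp

text \<open>
  By induction on the degree of the relation: a relation is congruent to \<open>Z p'\<close> modulo the relations of
  degree at most \<open>l\<close>, and \<open>p'\<close> is again a relation, because \<open>Z p'\<close> has \<open>z t\<close> times the
  value of \<open>p'\<close> and \<open>z\<close> is a nonzerodivisor.
\<close>

lemma rt_le_extend:
  assumes rt: "rt_le A N f l" shows "rt_le T (idx N) (gens f) l"
proof -
  let ?H = "low_gen T (idx N) (gens f) l" and ?ev = "rees_eval (gens f)"
  have gT: "gens f i \<in> T" if "i \<in> idx N" for i
    using that fA AT z by (auto simp: idx_def gens_def image_subset_iff)
  have HR: "?H \<subseteq> Rel T (idx N) (gens f)"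
    by (rule low_gen_subset[OF T])
  have const0: "lookup p {#} = 0" if "p \<in> Rel T (idx N) (gens f)" for p
    using that coeff_0_eval[of p "mons (idx N)" "gens f"] unfolding Rel_def by auto
  have "p \<in> ?H" if "p \<in> Rel T (idx N) (gens f)" "deg_le n p" for p n
    using that
  proof (induction n arbitrary: p)
    case 0
    then have "lookup p a = 0" for a
      using const0[of p] unfolding deg_le_def by (cases "a = {#}") auto
    then have "p = 0" by (intro poly_mapping_eqI) auto
    then show ?case using idealD(1)[OF low_gen_ideal[OF T]] by auto
  next
    case (Suc n)
    have pT: "p \<in> polys T (mons (idx N))" and ev: "?ev p = 0" using Suc unfolding Rel_def by auto
    have "p \<in> polys T {a \<in> mons (idx N). a \<noteq> {#} \<and> size a \<le> Suc n}"
      using pT Suc.prems const0[of p] unfolding polys_def deg_le_def by (auto simp: in_keys_iff)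
    from decompose[OF this] obtain p' where p': "p' \<in> polys T (mons (idx N))" "deg_le n p'"
      and d: "p - emb (spec p) - var None * p' \<in> ?H" unfolding emb_spec[OF pT] by auto
    have e: "emb (spec p) \<in> ?H"
      using rt emb_low_gen spec_Rel Suc.prems(1) unfolding rt_le_def by blast
    have s: "p - var None * p' \<in> ?H"
      using idealD(3)[OF low_gen_ideal[OF T] d e] by (simp add: algebra_simps)
    have "var None * p' \<in> Rel T (idx N) (gens f)"
      using ideal_minus(2)[OF polys_subring[OF T] Rel_ideal[OF T] Suc.prems(1), of "p - var None * p'"] s HR by auto
    then have "?ev (var None * p') = 0" unfolding Rel_def by auto
    moreover have "?ev (var None * p') = [:0, z:] * ?ev p'"
      by (subst peval_mult[OF T hom_pCons var_in[OF T, of None "idx N"] p'(1)])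
        (auto simp: idx_def peval_var[OF hom_pCons T] gens_def)
    ultimately have m0: "[:0, z:] * ?ev p' = 0" by simp
    have "?ev p' = 0"
    proof (rule poly_eqI)
      fix k
      have "Polynomial.coeff ([:0, z:] * ?ev p') (Suc k) = z * Polynomial.coeff (?ev p') k"
        by simp
      then have "z * Polynomial.coeff (?ev p') k = 0" by (metis m0 coeff_0)
      moreover have "Polynomial.coeff (?ev p') k \<in> T"
        using coeff_peval_map[OF T hom_on_id _ p'(1), where f = "gens f"] gT by blast
      ultimately show "Polynomial.coeff (?ev p') k = Polynomial.coeff 0 k" using nzd by simp
    qed
    then have "p' \<in> ?H" using Suc.IH p' unfolding Rel_def by auto
    then have "var None * p' \<in> ?H"
      by (intro idealD(4)[OF low_gen_ideal[OF T]] var_in T) (auto simp: idx_def)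
    from idealD(3)[OF low_gen_ideal[OF T] s this] show ?case by simp
  qed
  moreover have "\<exists>n. deg_le n p" for p :: "'i option multiset \<Rightarrow>\<^sub>0 'a"
    using finite_keys[of p] unfolding deg_le_def
    by (intro exI[of _ "Max (size ` keys p)"]) (auto simp: in_keys_iff intro!: Max_ge)
  ultimately show ?thesis unfolding rt_le_def by blast
qed

lemma gens_generate:
  assumes "gen_ideal A (f ` N) = I"
  shows "gen_ideal T (gens f ` idx N) = {t \<in> T. \<pi> t \<in> I}"
proof
  have I: "is_ideal A I" using assms gen_ideal_ideal[OF A fA] by auto
  have K: "is_ideal T {t \<in> T. \<pi> t \<in> I}"
    unfolding is_ideal_def using idealD[OF I] T by (auto simp: homD[OF \<pi> T] subringD \<pi>A)
  show "gen_ideal T (gens f ` idx N) \<subseteq> {t \<in> T. \<pi> t \<in> I}"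
  proof (rule gen_ideal_least[OF K])
    show "gens f ` idx N \<subseteq> {t \<in> T. \<pi> t \<in> I}"
      using z fA AT \<pi>z \<pi>id idealD(1)[OF I] gen_ideal_in[OF A, of _ "f ` N"] assms
      by (auto simp: gens_def idx_def image_subset_iff)
  qed
  have G: "is_ideal T (gen_ideal T (gens f ` idx N))"
    by (rule gen_ideal_ideal[OF T]) (use fA AT z in \<open>auto simp: gens_def idx_def image_subset_iff\<close>)
  have IG: "i \<in> gen_ideal T (gens f ` idx N)" if "i \<in> I" for i
  proof -
    have "id i \<in> gen_ideal T (gens f ` idx N)"
      by (rule gen_ideal_map[OF A hom_on_id fA]) (use AT that assms in \<open>auto simp: gens_def idx_def intro!: image_eqI[of _ _ "Some _"]\<close>)
    then show ?thesis by simp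
  qed
  have zG: "z \<in> gen_ideal T (gens f ` idx N)"
    by (intro gen_ideal_in T image_eqI[of _ _ None]) (auto simp: gens_def idx_def image_subset_iff)
  show "{t \<in> T. \<pi> t \<in> I} \<subseteq> gen_ideal T (gens f ` idx N)"
  proof safe
    fix t assume t: "t \<in> T" "\<pi> t \<in> I"
    from ker[OF t(1)] obtain q where "q \<in> T" "t = \<pi> t + q * z" by auto
    then show "t \<in> gen_ideal T (gens f ` idx N)"
      using idealD(3)[OF G IG[OF t(2)] idealD(4)[OF G _ zG]] by metis
  qed
qed

end

theorem ideal_rt_le_simple_ext:
  assumes I: "is_ideal A I" and l: "1 \<le> l"
  shows "ideal_rt_le A I l \<longleftrightarrow> ideal_rt_le T {t \<in> T. \<pi> t \<in> I} l"
proof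
  assume "ideal_rt_le A I l"
  then obtain m f where f: "f ` {..<m::nat} \<subseteq> A" and g: "gen_ideal A (f ` {..<m}) = I" and rt: "rt_le A {..<m} f l"
    unfolding ideal_rt_le_def by auto
  define h where "h = case_nat z f"
  have im: "gens f ` idx {..<m} = h ` {..<Suc m}"
    unfolding gens_def idx_def h_def lessThan_Suc_eq_insert_0 by (auto simp: image_iff)
  have T': "gens f ` idx {..<m} \<subseteq> T"
    using f AT z by (auto simp: gens_def idx_def image_subset_iff)
  have "rt_le T {..<Suc m} h l"
    by (rule rt_le_independent[OF T T' _ _ l rt_le_extend[OF f l rt]]) (use im T' in auto)
  then show "ideal_rt_le T {t \<in> T. \<pi> t \<in> I} l"
    unfolding ideal_rt_le_def using gens_generate[OF f l g] im T' by metis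
next
  assume "ideal_rt_le T {t \<in> T. \<pi> t \<in> I} l"
  then obtain m g where g: "g ` {..<m::nat} \<subseteq> T" and G: "gen_ideal T (g ` {..<m}) = {t \<in> T. \<pi> t \<in> I}"
    and rt: "rt_le T {..<m} g l"
    unfolding ideal_rt_le_def by auto
  define f where "f = \<pi> \<circ> g"
  have f: "f ` {..<m} \<subseteq> A" using g \<pi>A by (auto simp: f_def)
  have I': "gen_ideal A (f ` {..<m}) = I"
  proof
    show "gen_ideal A (f ` {..<m}) \<subseteq> I"
      by (rule gen_ideal_least[OF I]) (use G gen_ideal_in[OF T, of _ "g ` {..<m}"] in \<open>auto simp: f_def\<close>)
    show "I \<subseteq> gen_ideal A (f ` {..<m})"
    proof
      fix i assume i: "i \<in> I"
      then have iA: "i \<in> A" using idealD[OF I] by auto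
      then have "i \<in> gen_ideal T (g ` {..<m})" using i AT \<pi>id G by auto
      then have "\<pi> i \<in> gen_ideal A (f ` {..<m})"
        by (rule gen_ideal_map[OF T \<pi> g, rotated -1]) (auto simp: \<pi>A f_def)
      then show "i \<in> gen_ideal A (f ` {..<m})" using \<pi>id iA by simp
    qed
  qed
  \<comment> \<open>The \<open>\<pi> g\<^sub>i\<close> generate \<open>I\<close>, so together with \<open>z\<close> they generate the same ideal as the \<open>g\<^sub>i\<close>.\<close>
  have T': "gens f ` idx {..<m} \<subseteq> T"
    using f AT z by (auto simp: gens_def idx_def image_subset_iff)
  have "rt_le T (idx {..<m}) (gens f) l"
    by (rule rt_le_independent[OF T g T' _ l rt]) (use G gens_generate[OF f l I'] in auto)
  then have "rt_le A {..<m} f l" by (rule rt_le_retract[OF f l])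
  then show "ideal_rt_le A I l" unfolding ideal_rt_le_def using f I' by auto
qed

end

section \<open>Formal power series in countably many variables\<close>

text \<open>
  The variables are indexed by all natural numbers. The ring in a finite set of variables is a subset,
  so that adjoining variables is an inclusion of sets.
\<close>

typedef 'k mps = "UNIV :: (nat multiset \<Rightarrow> 'k) set"
  morphisms cf Mps by simp

lemma cf_Mps [simp]: "cf (Mps f) = f"
  by (simp add: Mps_inverse)

lemma Mps_cf [simp]: "Mps (cf f) = f"
  by (simp add: cf_inverse)

lemma mps_eqI: "(\<And>a. cf f a = cf g a) \<Longrightarrow> f = g"
  by (metis cf_inverse ext)

lemma finite_submsets: "finite {a. a \<subseteq># (c :: 'a multiset)}"
proof (induction c)
  case (add x c)
  have "{a. a \<subseteq># add_mset x c} \<subseteq> {a. a \<subseteq># c} \<union> add_mset x ` {a. a \<subseteq># c}"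
  proof
    fix a assume "a \<in> {a. a \<subseteq># add_mset x c}"
    then have a: "a \<subseteq># add_mset x c" by simp
    show "a \<in> {a. a \<subseteq># c} \<union> add_mset x ` {a. a \<subseteq># c}"
    proof (cases "x \<in># a")
      case True
      then have "a = add_mset x (a - {#x#})" by simp
      moreover from this a have "a - {#x#} \<subseteq># c" by (metis mset_subset_eq_add_mset_cancel)
      ultimately show ?thesis by blast
    next
      case False
      then have "a \<subseteq># c" using a by (metis diff_single_trivial subset_eq_diff_conv add_mset_add_single)
      then show ?thesis by simp
    qed
  qed
  then show ?case using add finite_subset by blast
qed simp

definition splits :: "'a multiset \<Rightarrow> ('a multiset \<times> 'a multiset) set" where
  "splits c = {(a, b). a + b = c}"

lemma splits_eq: "splits c = (\<lambda>a. (a, c - a)) ` {a. a \<subseteq># c}"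
  unfolding splits_def by (auto simp: image_iff) 

lemma finite_splits: "finite (splits c)"
  unfolding splits_eq using finite_submsets by blast

lemma sum_splits: "(\<Sum>a\<in>{a. a \<subseteq># c}. f a (c - a)) = (\<Sum>(a, b)\<in>splits c. f a b)"
  unfolding splits_eq by (subst sum.reindex) (auto simp: inj_on_def)

instantiation mps :: (field) comm_ring_1
begin

definition zero_mps where "0 = Mps (\<lambda>_. 0)"
definition one_mps where "1 = Mps (\<lambda>a. if a = {#} then 1 else 0)"
definition plus_mps where "f + g = Mps (\<lambda>a. cf f a + cf g a)"
definition minus_mps where "f - g = Mps (\<lambda>a. cf f a - cf g a)"
definition uminus_mps where "- f = Mps (\<lambda>a. - cf f a)"
definition times_mps where "f * g = Mps (\<lambda>c. \<Sum>a\<in>{a. a \<subseteq># c}. cf f a * cf g (c - a))"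

lemma cf_simps [simp]: "cf 0 a = 0" "cf (f + g) a = cf f a + cf g a" "cf (f - g) a = cf f a - cf g a"
  "cf (- f) a = - cf f a" "cf 1 a = (if a = {#} then 1 else 0)"
  unfolding zero_mps_def plus_mps_def minus_mps_def uminus_mps_def one_mps_def by auto

lemma cf_mult: "cf (f * g) c = (\<Sum>(a, b)\<in>splits c. cf f a * cf g b)"
  unfolding times_mps_def using sum_splits[of "\<lambda>a b. cf f a * cf g b"] by simp

instance
proof
  fix f g h :: "'a mps"
  show "f * g * h = f * (g * h)"
  proof (rule mps_eqI)
    fix c
    have "cf (f * g * h) c = (\<Sum>(p, b)\<in>splits c. \<Sum>(a, a')\<in>splits p. cf f a * cf g a' * cf h b)"
      by (simp add: cf_mult sum_distrib_right case_prod_beta)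
    also have "\<dots> = (\<Sum>((p, b), (a, a'))\<in>(SIGMA x:splits c. splits (fst x)). cf f a * cf g a' * cf h b)"
      by (subst sum.Sigma[symmetric]) (auto simp: finite_splits case_prod_beta)
    also have "\<dots> = (\<Sum>((a, q), (a', b))\<in>(SIGMA x:splits c. splits (snd x)). cf f a * cf g a' * cf h b)"
      by (rule sum.reindex_bij_witness[where i = "\<lambda>((a, q), (a', b)). ((a + a', b), (a, a'))"
            and j = "\<lambda>((p, b), (a, a')). ((a, a' + b), (a', b))"]) (auto simp: splits_def add.assoc)
    also have "\<dots> = (\<Sum>(a, q)\<in>splits c. \<Sum>(a', b)\<in>splits q. cf f a * cf g a' * cf h b)"
      by (subst sum.Sigma[symmetric]) (auto simp: finite_splits case_prod_beta)
    also have "\<dots> = cf (f * (g * h)) c"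
      by (simp add: cf_mult sum_distrib_left case_prod_beta mult.assoc)
    finally show "cf (f * g * h) c = cf (f * (g * h)) c" .
  qed
  show "f * g = g * f"
  proof (rule mps_eqI)
    fix c
    show "cf (f * g) c = cf (g * f) c"
      unfolding cf_mult
      by (rule sum.reindex_bij_witness[where i = "\<lambda>(a, b). (b, a)" and j = "\<lambda>(a, b). (b, a)"])
         (auto simp: splits_def add.commute mult.commute)
  qed
  show "1 * f = f"
  proof (rule mps_eqI)
    fix c
    have "cf (1 * f) c = (\<Sum>(a, b)\<in>{({#}, c)}. cf 1 a * cf f b)"
      unfolding cf_mult by (rule sum.mono_neutral_right[OF finite_splits]) (auto simp: splits_def split: if_splits)
    then show "cf (1 * f) c = cf f c" by simp
  qed
  show "(f + g) * h = f * h + g * h"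
    by (rule mps_eqI) (simp add: cf_mult distrib_right sum.distrib case_prod_beta)
  show "(0::'a mps) \<noteq> 1"
    by (metis cf_simps(1,5) zero_neq_one)
qed (auto intro!: mps_eqI simp: algebra_simps)

end

text \<open>
  The term with coefficient \<open>c\<close> at the monomial \<open>a\<close>.
\<close>

definition mterm :: "nat multiset \<Rightarrow> 'k::field \<Rightarrow> 'k mps" where
  "mterm a c = Mps (\<lambda>b. if b = a then c else 0)"

lemma cf_mterm [simp]: "cf (mterm a c) b = (if b = a then c else 0)"
  unfolding mterm_def by simp

lemma cf_mterm_mult: "cf (mterm a c * f) b = (if a \<subseteq># b then c * cf f (b - a) else 0)"
proof -
  have "cf (mterm a c * f) b = (\<Sum>x\<in>{x. x \<subseteq># b}. if a = x then c * cf f (b - a) else 0)"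
    unfolding times_mps_def by (auto intro!: sum.cong)
  then show ?thesis by (simp add: finite_submsets)
qed

lemma cf_const_mult: "cf (mterm {#} c * f) b = c * cf f b"
  by (simp add: cf_mterm_mult)

lemma cf_sum: "cf (sum f F) a = (\<Sum>i\<in>F. cf (f i) a)"
  by (induction F rule: infinite_finite_induct) auto

text \<open>
  For series in finitely many variables: membership in the \<open>k\<close>-th power of the maximal ideal.
\<close>

definition ordge :: "nat \<Rightarrow> 'k::field mps \<Rightarrow> bool" where
  "ordge k f \<longleftrightarrow> (\<forall>a. cf f a \<noteq> 0 \<longrightarrow> k \<le> size a)"

lemma ordge_add: "ordge k f \<Longrightarrow> ordge k g \<Longrightarrow> ordge k (f + g)"
  unfolding ordge_def by (metis add.right_neutral cf_simps(2))

lemma ordge_sum: "(\<And>i. i \<in> F \<Longrightarrow> ordge k (f i)) \<Longrightarrow> ordge k (sum f F)"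
  by (induction F rule: infinite_finite_induct) (auto simp: ordge_add ordge_def[of _ 0])

lemma ordge_mult:
  assumes "ordge j f" "ordge k g" shows "ordge (j + k) (f * g)"
  unfolding ordge_def
proof (intro allI impI)
  fix c assume "cf (f * g) c \<noteq> 0"
  then obtain x where x: "x \<in> splits c" "(case x of (a, b) \<Rightarrow> cf f a * cf g b) \<noteq> 0"
    unfolding cf_mult by (meson sum.neutral)
  then show "j + k \<le> size c"
    using assms by (auto simp: splits_def ordge_def intro!: add_mono)
qed

section \<open>Convergent power series\<close>

definition rpow :: "(nat \<Rightarrow> real) \<Rightarrow> nat multiset \<Rightarrow> real" where
  "rpow r a = prod_mset (image_mset r a)"

lemma rpow_simps [simp]: "rpow r {#} = 1" "rpow r (add_mset i a) = r i * rpow r a" "rpow r (a + b) = rpow r a * rpow r b"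
  unfolding rpow_def by auto

lemma rpow_pos: "(\<And>i. 0 < r i) \<Longrightarrow> 0 < rpow r a"
  by (induction a) auto

lemma rpow_mono: "(\<And>i. 0 < r i) \<Longrightarrow> (\<And>i. r i \<le> s i) \<Longrightarrow> rpow r a \<le> rpow s a"
proof (induction a)
  case (add x a)
  have "0 \<le> s x" using add.prems(1)[of x] add.prems(2)[of x] by linarith
  then show ?case using add rpow_pos[of r a] by (auto intro!: mult_mono simp: less_imp_le)
qed simp

locale valued_field =
  fixes v :: "'k::field \<Rightarrow> real"
  assumes v_nonneg: "0 \<le> v x" and v_eq_0: "v x = 0 \<longleftrightarrow> x = 0"
    and v_mult: "v (x * y) = v x * v y" and v_tri: "v (x + y) \<le> v x + v y"
begin

lemma v0 [simp]: "v 0 = 0" using v_eq_0 by auto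

lemma v1 [simp]: "v 1 = 1" using v_mult[of 1 1] v_eq_0[of 1] by auto

lemma v_minus [simp]: "v (- x) = v x"
proof -
  have "v (-1) * v (-1) = 1" using v_mult[of "-1" "-1"] by simp
  then have "v (-1) = 1" using v_nonneg[of "-1"] by (metis abs_of_nonneg abs_square_eq_1 power2_eq_square)
  then show ?thesis using v_mult[of "-1" x] by simp
qed

lemma v_sum: "v (sum f F) \<le> (\<Sum>i\<in>F. v (f i))"
  by (induction F rule: infinite_finite_induct) (auto intro: order_trans[OF v_tri])

text \<open>
  \<open>C\<close> bounds the weighted \<open>\<ell>\<^sup>1\<close>-norm of \<open>f\<close> with radii \<open>r\<close>. Bounding the finite partial sums expresses
  this without infinite sums.
\<close>

definition bdd :: "(nat \<Rightarrow> real) \<Rightarrow> 'k mps \<Rightarrow> real \<Rightarrow> bool" where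
  "bdd r f C \<longleftrightarrow> (\<forall>F. finite F \<longrightarrow> (\<Sum>a\<in>F. v (cf f a) * rpow r a) \<le> C)"

lemma bddD: "bdd r f C \<Longrightarrow> finite F \<Longrightarrow> (\<Sum>a\<in>F. v (cf f a) * rpow r a) \<le> C"
  unfolding bdd_def by auto

lemma bdd_nonneg: "bdd r f C \<Longrightarrow> 0 \<le> C"
  using bddD[of r f C "{}"] by simp

lemma bdd_mono: "bdd r f C \<Longrightarrow> C \<le> D \<Longrightarrow> bdd r f D"
  unfolding bdd_def by (meson order_trans)

lemma bdd_scale:
  assumes "bdd r f C" "0 \<le> K" "\<And>a. v (cf g a) * rpow s a \<le> K * (v (cf f a) * rpow r a)"
  shows "bdd s g (K * C)"
  unfolding bdd_def
proof (intro allI impI)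
  fix F :: "nat multiset set" assume "finite F"
  have "(\<Sum>a\<in>F. v (cf g a) * rpow s a) \<le> (\<Sum>a\<in>F. K * (v (cf f a) * rpow r a))"
    by (intro sum_mono assms)
  also have "\<dots> \<le> K * C"
    unfolding sum_distrib_left[symmetric] using assms bddD[OF assms(1) \<open>finite F\<close>] by (intro mult_left_mono) auto
  finally show "(\<Sum>a\<in>F. v (cf g a) * rpow s a) \<le> K * C" .
qed

lemma bdd_add:
  assumes r: "\<And>i. 0 < r i" and "bdd r f C" "bdd r g D" shows "bdd r (f + g) (C + D)"
  unfolding bdd_def
proof (intro allI impI)
  fix F :: "nat multiset set" assume "finite F"
  have "(\<Sum>a\<in>F. v (cf (f + g) a) * rpow r a) \<le> (\<Sum>a\<in>F. v (cf f a) * rpow r a + v (cf g a) * rpow r a)"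
    using rpow_pos[of r, OF r] by (intro sum_mono) (auto simp: distrib_right[symmetric] intro!: mult_right_mono v_tri less_imp_le)
  also have "\<dots> \<le> C + D" using assms \<open>finite F\<close> by (auto simp: sum.distrib intro!: add_mono bddD)
  finally show "(\<Sum>a\<in>F. v (cf (f + g) a) * rpow r a) \<le> C + D" .
qed

lemma bdd_mult:
  assumes r: "\<And>i. 0 < r i" and f: "bdd r f C" and g: "bdd r g D" shows "bdd r (f * g) (C * D)"
  unfolding bdd_def
proof (intro allI impI)
  fix F :: "nat multiset set" assume F: "finite F"
  define G where "G = (\<Union>c\<in>F. {a. a \<subseteq># c})"
  have G: "finite G" unfolding G_def using F finite_submsets by blast
  have p: "0 \<le> rpow r a" for a using rpow_pos[of r, OF r] less_imp_le by blast
  let ?h = "\<lambda>(a, b). (v (cf f a) * rpow r a) * (v (cf g b) * rpow r b)"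
  have "(\<Sum>c\<in>F. v (cf (f * g) c) * rpow r c) \<le> (\<Sum>c\<in>F. \<Sum>x\<in>splits c. ?h x)"
  proof (rule sum_mono)
    fix c
    have "v (cf (f * g) c) * rpow r c \<le> (\<Sum>x\<in>splits c. v (case x of (a, b) \<Rightarrow> cf f a * cf g b)) * rpow r c"
      unfolding cf_mult by (intro mult_right_mono v_sum p)
    also have "\<dots> = (\<Sum>x\<in>splits c. ?h x)"
      unfolding sum_distrib_right by (rule sum.cong) (auto simp: splits_def v_mult)
    finally show "v (cf (f * g) c) * rpow r c \<le> (\<Sum>x\<in>splits c. ?h x)" .
  qed
  also have "\<dots> = sum ?h (\<Union>c\<in>F. splits c)"
    by (rule sum.UNION_disjoint[symmetric]) (auto simp: F finite_splits, auto simp: splits_def)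
  also have "\<dots> \<le> sum ?h (G \<times> G)"
    by (rule sum_mono2[OF finite_cartesian_product[OF G G]]) (auto simp: G_def splits_def intro!: mult_nonneg_nonneg v_nonneg p)
  also have "\<dots> = (\<Sum>a\<in>G. v (cf f a) * rpow r a) * (\<Sum>b\<in>G. v (cf g b) * rpow r b)"
    by (simp add: sum.cartesian_product[symmetric] sum_product)
  also have "\<dots> \<le> C * D"
    using bddD[OF f G] bddD[OF g G] bdd_nonneg[OF f] p
    by (intro mult_mono) (auto intro!: sum_nonneg mult_nonneg_nonneg v_nonneg)
  finally show "(\<Sum>c\<in>F. v (cf (f * g) c) * rpow r c) \<le> C * D" .
qed

lemma bdd_mono_radius:
  assumes "\<And>i. 0 < s i" "\<And>i. s i \<le> r i" "bdd r f C" shows "bdd s f C"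
proof -
  have "bdd s f (1 * C)"
    using rpow_mono[of s r, OF assms(1,2)] by (intro bdd_scale[OF assms(3)]) (auto intro: mult_left_mono v_nonneg)
  then show ?thesis by simp
qed

definition supp :: "nat set \<Rightarrow> 'k mps \<Rightarrow> bool" where
  "supp V f \<longleftrightarrow> (\<forall>a. cf f a \<noteq> 0 \<longrightarrow> a \<in> mons V)"

definition conv :: "nat set \<Rightarrow> 'k mps set" where
  "conv V = {f. supp V f \<and> (\<exists>r C. (\<forall>i. 0 < r i) \<and> bdd r f C)}"

lemma conv_mono: "V \<subseteq> W \<Longrightarrow> conv V \<subseteq> conv W"
  unfolding conv_def supp_def mons_def by blast

lemma conv_single: "a \<in> mons V \<Longrightarrow> mterm a c \<in> conv V"
proof -
  have "bdd (\<lambda>_. 1) (mterm a c) (v c * rpow (\<lambda>_. 1) a)"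
    unfolding bdd_def
  proof (intro allI impI)
    fix F :: "nat multiset set" assume "finite F"
    have p: "0 < rpow (\<lambda>_. 1) a" by (rule rpow_pos) simp
    have "(\<Sum>b\<in>F. v (cf (mterm a c) b) * rpow (\<lambda>_. 1) b) = (\<Sum>b\<in>F. if b = a then v c * rpow (\<lambda>_. 1) a else 0)"
      by (rule sum.cong) auto
    also have "\<dots> \<le> v c * rpow (\<lambda>_. 1) a" using \<open>finite F\<close> p v_nonneg[of c] by simp
    finally show "(\<Sum>b\<in>F. v (cf (mterm a c) b) * rpow (\<lambda>_. 1) b) \<le> v c * rpow (\<lambda>_. 1) a" .
  qed
  moreover assume "a \<in> mons V"
  ultimately show ?thesis unfolding conv_def supp_def by (auto intro!: exI[of _ "\<lambda>_. 1"])
qed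

text \<open>
  Shrinking radii preserves bounds, so finitely many convergent series share one polyradius.
\<close>

lemma common_radius:
  assumes "finite E" "\<And>e. e \<in> E \<Longrightarrow> f e \<in> conv V"
  shows "\<exists>r C. (\<forall>i. 0 < r i) \<and> (\<forall>e\<in>E. bdd r (f e) C)"
  using assms
proof (induction E rule: finite_induct)
  case empty
  then show ?case by (auto intro!: exI[of _ "\<lambda>_. 1"])
next
  case (insert x E)
  then obtain r C where r: "\<And>i. 0 < r i" "\<And>e. e \<in> E \<Longrightarrow> bdd r (f e) C" by (metis insertCI)
  have "f x \<in> conv V" using insert by auto
  then obtain s D where s: "\<And>i. 0 < s i" "bdd s (f x) D" unfolding conv_def by auto
  let ?t = "\<lambda>i. min (r i) (s i)"
  have "bdd ?t (f x) (max C D)"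
    by (rule bdd_mono[OF bdd_mono_radius[OF _ _ s(2)]]) (use r s in auto)
  moreover have "bdd ?t (f e) (max C D)" if "e \<in> E" for e
    by (rule bdd_mono[OF bdd_mono_radius[OF _ _ r(2)[OF that]]]) (use r s in auto)
  ultimately show ?case by (intro exI[of _ ?t] exI[of _ "max C D"]) (use r s in auto)
qed

lemma conv_subring: "is_subring (conv V)"
  unfolding is_subring_def
proof safe
  have "mterm {#} 0 = (0 :: 'k mps)" by (rule mps_eqI) simp
  then show "0 \<in> conv V" using conv_single[of "{#}" V 0] by simp
  have "mterm {#} 1 = (1 :: 'k mps)" by (rule mps_eqI) simp
  then show "1 \<in> conv V" using conv_single[of "{#}" V 1] by simp
  fix f assume f: "f \<in> conv V"
  show "- f \<in> conv V" using f unfolding conv_def supp_def bdd_def by simp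
  fix g assume g: "g \<in> conv V"
  have "\<exists>r C. (\<forall>i. 0 < r i) \<and> (\<forall>e\<in>{f, g}. bdd r (id e) C)"
    by (rule common_radius[of _ _ V]) (use f g in auto)
  then obtain r C where r: "\<And>i. 0 < r i" and b: "bdd r f C" "bdd r g C" by auto
  have s: "supp V f" "supp V g" using f g unfolding conv_def by auto
  have "supp V (f + g)" using s unfolding supp_def by (metis add.right_neutral cf_simps(2))
  then show "f + g \<in> conv V" using bdd_add[OF r b] r unfolding conv_def by blast
  have "supp V (f * g)" unfolding supp_def
  proof (intro allI impI)
    fix c assume "cf (f * g) c \<noteq> 0"
    then obtain x where "x \<in> splits c" "(case x of (a, b) \<Rightarrow> cf f a * cf g b) \<noteq> 0"
      unfolding cf_mult by (meson sum.neutral)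
    then show "c \<in> mons V" using s by (auto simp: splits_def supp_def)
  qed
  then show "f * g \<in> conv V" using bdd_mult[OF r b] r unfolding conv_def by blast
qed

end

section \<open>Division\<close>

text \<open>
  A total order on monomials that is compatible with products and puts small degree first, so that the
  leading monomial of a series is its smallest one. Ties are broken by the multiset order after a renaming
  \<open>\<tau>\<close> of the variables; the renaming decides which variable comes first.
\<close>

definition prec :: "(nat \<Rightarrow> nat) \<Rightarrow> nat multiset \<Rightarrow> nat multiset \<Rightarrow> bool" where
  "prec \<tau> a b \<longleftrightarrow> size a < size b \<or> size a = size b \<and> image_mset \<tau> a < image_mset \<tau> b"

lemma wf_prec: "wf {(a, b). prec \<tau> a b}"
proof -
  have "{(a, b). prec \<tau> a b} = inv_image (less_than <*lex*> {(x, y). x < y}) (\<lambda>a. (size a, image_mset \<tau> a))"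
    unfolding prec_def inv_image_def lex_prod_def by auto
  then show ?thesis using wf_inv_image[OF wf_lex_prod[OF wf_less_than wf_less_multiset]] 
    by (metis (no_types, lifting))
qed

lemma prec_add_right: "prec \<tau> a b \<Longrightarrow> prec \<tau> (a + c) (b + c)"
  unfolding prec_def by auto

lemma prec_add_left: "prec \<tau> a b \<Longrightarrow> prec \<tau> (c + a) (c + b)"
  unfolding prec_def by auto

lemma prec_trans: "prec \<tau> a b \<Longrightarrow> prec \<tau> b c \<Longrightarrow> prec \<tau> a c"
  unfolding prec_def by auto

lemma prec_irrefl: "\<not> prec \<tau> a a"
  unfolding prec_def by auto

lemma prec_total: "inj \<tau> \<Longrightarrow> a = b \<or> prec \<tau> a b \<or> prec \<tau> b a"
  using injD[OF multiset.inj_map[of \<tau>], of a b] unfolding prec_def by (metis linorder_neqE)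

lemma prec_size: "prec \<tau> a b \<Longrightarrow> size a \<le> size b"
  unfolding prec_def by auto

text \<open>
  The largest element by which \<open>M\<close> and \<open>N\<close> differ belongs to \<open>N\<close>, and fewer than \<open>B\<close> smaller elements cannot
  make up for it in base \<open>B\<close>. So the order among monomials of bounded degree is refined by a linear weight.
\<close>

lemma weight_less:
  fixes M N :: "nat multiset"
  assumes "M < N" and B: "size M < B"
  shows "(\<Sum>k\<in>#M. B ^ k) < (\<Sum>k\<in>#N. B ^ k)"
proof -
  from assms(1) obtain X Y where XY: "X \<noteq> {#}" "X \<subseteq># N" "M = (N - X) + Y" "\<And>k. k \<in># Y \<Longrightarrow> \<exists>a. a \<in># X \<and> k < a"
    unfolding less_multiset\<^sub>D\<^sub>M by blast
  define m where "m = Max (set_mset X)"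
  have m: "m \<in># X" "\<And>a. a \<in># X \<Longrightarrow> a \<le> m" unfolding m_def using XY(1) by auto
  have "B * (\<Sum>k\<in>#Y'. B ^ k) \<le> size Y' * B ^ m" if "\<And>k. k \<in># Y' \<Longrightarrow> k < m" for Y'
    using that
  proof (induction Y')
    case (add k Y')
    have "B ^ Suc k \<le> B ^ m" using add B by (intro power_increasing) (auto simp: Suc_le_eq)
    then show ?case using add by (auto simp: distrib_left)
  qed simp
  moreover have "k < m" if "k \<in># Y" for k using XY(4)[OF that] m(2) by (meson less_le_trans)
  ultimately have "B * (\<Sum>k\<in>#Y. B ^ k) \<le> size Y * B ^ m" by blast
  also have "\<dots> < B * B ^ m"
  proof -
    have "size Y < B" using XY(3) B by simp
    then show ?thesis by simp
  qed
  finally have "(\<Sum>k\<in>#Y. B ^ k) < B ^ m" by simp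
  also have "B ^ m \<le> (\<Sum>k\<in>#X. B ^ k)" using m(1) by (metis insert_DiffM image_mset_add_mset sum_mset.add_mset le_add1)
  finally have "(\<Sum>k\<in>#N - X. B ^ k) + (\<Sum>k\<in>#Y. B ^ k) < (\<Sum>k\<in>#N - X. B ^ k) + (\<Sum>k\<in>#X. B ^ k)" by simp
  moreover have "N = (N - X) + X" using XY(2) by simp
  ultimately show ?thesis using XY(3) by (metis image_mset_union sum_mset.union)
qed

lemma pos_lower_bound:
  fixes h :: "'b \<Rightarrow> real"
  assumes "finite E" "\<And>a. a \<in> E \<Longrightarrow> 0 < h a"
  shows "\<exists>s>0. s \<le> 1 \<and> (\<forall>a\<in>E. s \<le> h a)"
  using assms
proof (induction E rule: finite_induct)
  case empty
  then show ?case by (auto intro!: exI[of _ 1])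
next
  case (insert x E)
  then obtain s where "0 < s" "s \<le> 1" "\<forall>a\<in>E. s \<le> h a" by blast
  then show ?case using insert.prems[of x] by (intro exI[of _ "min s (h x)"]) auto
qed

lemma finite_mons_le:
  assumes "finite V" shows "finite {c \<in> mons V. size c \<le> n}"
proof (induction n)
  case (Suc n)
  have "{c \<in> mons V. size c \<le> Suc n} \<subseteq> insert {#} (\<Union>v\<in>V. add_mset v ` {c \<in> mons V. size c \<le> n})"
  proof
    fix c assume c: "c \<in> {c \<in> mons V. size c \<le> Suc n}"
    show "c \<in> insert {#} (\<Union>v\<in>V. add_mset v ` {c \<in> mons V. size c \<le> n})"
    proof (cases c)
      case (add x c')
      then show ?thesis using c by auto
    qed simp
  qed
  moreover have "finite (insert {#} (\<Union>v\<in>V. add_mset v ` {c \<in> mons V. size c \<le> n}))"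
    using Suc assms by simp
  ultimately show ?case by (rule finite_subset)
next
  case 0
  have "{c \<in> mons V. size c \<le> 0} \<subseteq> {{#}}" by auto
  then show ?case using finite_subset by blast
qed

context valued_field
begin

text \<open>
  Radii for which the tails \<open>t\<^sub>a\<close> of the divisors are small compared with their leading monomials \<open>a\<close>.
  Starting from common radii of convergence \<open>r\<^sub>0\<close>, scale the variable \<open>i\<close> by \<open>u s\<^sup>w\<close> with a weight \<open>w\<close>
  that refines the order of monomials: small \<open>s\<close> takes care of the tail monomials of the same degree as \<open>a\<close>,
  and then small \<open>u\<close> of those of larger degree.
\<close>

lemma division_radius:
  assumes E: "finite E" and t: "\<And>a. a \<in> E \<Longrightarrow> t a \<in> conv V" "\<And>a b. a \<in> E \<Longrightarrow> cf (t a) b \<noteq> 0 \<Longrightarrow> prec \<tau> a b"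
    and f: "f \<in> conv V"
  shows "\<exists>r. (\<forall>i. 0 < r i) \<and> (\<exists>C. bdd r f C) \<and> (\<forall>a\<in>E. bdd r (t a) (rpow r a / 2))"
proof -
  obtain r1 C1 where r1: "\<And>i. 0 < r1 i" "\<And>a. a \<in> E \<Longrightarrow> bdd r1 (t a) C1" using common_radius[of E t V, OF E t(1)] by blast
  obtain r2 C2 where r2: "\<And>i. 0 < r2 i" "bdd r2 f C2" using f unfolding conv_def by auto
  define r0 where "r0 i = min (r1 i) (r2 i)" for i
  define C where "C = max C1 1"
  have C: "1 \<le> C" unfolding C_def by auto
  have r0: "0 < r0 i" for i unfolding r0_def using r1 r2 by auto
  have bt: "bdd r0 (t a) C" if "a \<in> E" for a
    by (rule bdd_mono[OF bdd_mono_radius[OF r0 _ r1(2)[OF that]]]) (auto simp: r0_def C_def)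
  have bf: "bdd r0 f C2" by (rule bdd_mono_radius[OF r0 _ r2(2)]) (auto simp: r0_def)
  note p0 = rpow_pos[of r0, OF r0]
  \<comment> \<open>A base that exceeds all degrees occurring in \<open>E\<close>, as \<open>weight_less\<close> requires.\<close>
  define B where "B = Suc (Max (insert 0 (size ` E)))"
  have B: "size a < B" if "a \<in> E" for a
    unfolding B_def using E that by (auto simp: less_Suc_eq_le)
  define W where "W a = (\<Sum>k\<in>#image_mset \<tau> a. B ^ k)" for a
  obtain s where s: "0 < s" "s \<le> 1" "\<And>a. a \<in> E \<Longrightarrow> s \<le> rpow r0 a / (2 * C)"
    using pos_lower_bound[OF E, of "\<lambda>a. rpow r0 a / (2 * C)"] p0 C by auto
  obtain u where u: "0 < u" "u \<le> 1" "\<And>a. a \<in> E \<Longrightarrow> u \<le> s ^ W a * rpow r0 a / (2 * C)"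
    using pos_lower_bound[OF E, of "\<lambda>a. s ^ W a * rpow r0 a / (2 * C)"] p0 C s(1) by auto
  define r where "r i = u * s ^ (B ^ \<tau> i) * r0 i" for i
  have r: "0 < r i" for i unfolding r_def using u s r0 by auto
  have rr: "r i \<le> r0 i" for i
  proof -
    have "u * s ^ (B ^ \<tau> i) \<le> 1 * 1" using u s by (intro mult_mono power_le_one) auto
    then show ?thesis unfolding r_def using r0[of i] by (simp add: mult_left_le_one_le)
  qed
  have rp: "rpow r a = u ^ size a * s ^ W a * rpow r0 a" for a
    by (induction a) (auto simp: r_def W_def power_add algebra_simps)
  have "bdd r (t a) (rpow r a / 2)" if a: "a \<in> E" for a
  proof -
    define K where "K = rpow r a / (2 * C)"
    have K: "0 < K" unfolding K_def using rpow_pos[of r a] r C by auto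
    have key: "rpow r b \<le> K * rpow r0 b" if b: "prec \<tau> a b" for b
    proof -
      have "u ^ size b * s ^ W b \<le> K"
      proof (cases "size a < size b")
        case True
        have "u ^ size b * s ^ W b \<le> u ^ Suc (size a) * 1"
          using True u s by (intro mult_mono power_decreasing power_le_one) auto
        also have "\<dots> \<le> u ^ size a * (s ^ W a * rpow r0 a / (2 * C))"
          using mult_left_mono[OF u(3)[OF a], of "u ^ size a"] u(1) by (simp add: algebra_simps)
        also have "\<dots> = K" unfolding K_def rp by simp
        finally show ?thesis .
      next
        case False
        then have e: "size b = size a" "image_mset \<tau> a < image_mset \<tau> b" using b unfolding prec_def by auto
        have "W a < W b" unfolding W_def using B[OF a] by (intro weight_less e) auto
        then have "u ^ size b * s ^ W b \<le> u ^ size a * s ^ Suc (W a)"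
          using u s unfolding e by (intro mult_left_mono power_decreasing) auto
        also have "\<dots> \<le> u ^ size a * (s ^ W a * (rpow r0 a / (2 * C)))"
          using mult_left_mono[OF s(3)[OF a], of "u ^ size a * s ^ W a"] u(1) s(1) by (simp add: algebra_simps)
        also have "\<dots> = K" unfolding K_def rp by simp
        finally show ?thesis .
      qed
      then show ?thesis unfolding rp using p0[of b] by (intro mult_right_mono) auto
    qed
    have "bdd r (t a) (K * C)"
    proof (rule bdd_scale[OF bt[OF a]])
      show "v (cf (t a) b) * rpow r b \<le> K * (v (cf (t a) b) * rpow r0 b)" for b
      proof (cases "cf (t a) b = 0")
        case False
        have "v (cf (t a) b) * rpow r b \<le> v (cf (t a) b) * (K * rpow r0 b)"
          using key[OF t(2)[OF a False]] v_nonneg by (intro mult_left_mono) auto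
        then show ?thesis by (simp add: algebra_simps)
      qed simp
    qed (use K in auto)
    then show ?thesis unfolding K_def using C by simp
  qed
  then show ?thesis using r bdd_mono_radius[OF r rr bf] by blast
qed

lemma bdd_finite_support:
  assumes "\<And>i. 0 < r i" "finite G" "\<And>a. cf f a \<noteq> 0 \<Longrightarrow> a \<in> G"
  shows "bdd r f (\<Sum>a\<in>G. v (cf f a) * rpow r a)"
  unfolding bdd_def
proof (intro allI impI)
  fix F :: "nat multiset set" assume F: "finite F"
  have "(\<Sum>a\<in>F. v (cf f a) * rpow r a) = (\<Sum>a\<in>F \<inter> G. v (cf f a) * rpow r a)"
    using assms(3) by (intro sum.mono_neutral_right) (auto simp: F v_eq_0)
  also have "\<dots> \<le> (\<Sum>a\<in>G. v (cf f a) * rpow r a)"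
    using rpow_pos[of r, OF assms(1)] by (intro sum_mono2) (auto simp: assms less_imp_le intro!: mult_nonneg_nonneg v_nonneg)
  finally show "(\<Sum>a\<in>F. v (cf f a) * rpow r a) \<le> (\<Sum>a\<in>G. v (cf f a) * rpow r a)" .
qed

text \<open>
  Division with remainder by series with leading monomials \<open>a \<in> E\<close> (Grauert, Hironaka). Every monomial
  divisible by some \<open>a \<in> E\<close> is assigned to one such \<open>a\<close>. A series \<open>F\<close> then splits as
  \<open>F = \<Sum> q\<^sub>a x\<^sup>a + R\<close>, and one needs \<open>F\<close> with \<open>f = F + \<Sum> q\<^sub>a t\<^sub>a\<close>, where \<open>t\<^sub>a\<close> are the tails of the
  divisors. Because tails are larger than leading monomials, this equation determines the coefficients of \<open>F\<close>
  recursively. At the radii of \<open>division_radius\<close> the correction has at most half the norm of \<open>F\<close>, even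
  after truncation at a degree \<open>n\<close>, so the norm of \<open>F\<close> is at most twice that of \<open>f\<close>.
\<close>

theorem division:
  assumes V: "finite V" and E: "finite E" "E \<subseteq> mons V"
    and g: "\<And>a. a \<in> E \<Longrightarrow> g a \<in> conv V" "\<And>a. a \<in> E \<Longrightarrow> cf (g a) a = 1"
      "\<And>a b. a \<in> E \<Longrightarrow> cf (g a) b \<noteq> 0 \<Longrightarrow> b = a \<or> prec \<tau> a b"
    and f: "f \<in> conv V"
  shows "\<exists>q R. (\<forall>a\<in>E. q a \<in> conv V) \<and> R \<in> conv V \<and> f = (\<Sum>a\<in>E. q a * g a) + R
    \<and> (\<forall>b. cf R b \<noteq> 0 \<longrightarrow> (\<forall>a\<in>E. \<not> a \<subseteq># b))"
proof -
  define t where "t a = g a - mterm a 1" for a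
  have tc: "t a \<in> conv V" if "a \<in> E" for a
    unfolding t_def using that g E conv_single by (intro subringD(6)[OF conv_subring]) auto
  have tp: "prec \<tau> a b" if "a \<in> E" "cf (t a) b \<noteq> 0" for a b
    using g(2)[OF that(1)] g(3)[OF that(1), of b] that(2) unfolding t_def by (auto split: if_splits)
  obtain r C where r: "\<And>i. 0 < r i" and C: "bdd r f C" and bt: "\<And>a. a \<in> E \<Longrightarrow> bdd r (t a) (rpow r a / 2)"
    using division_radius[of E t V \<tau> f, OF E(1) tc tp f] by blast
  have rp: "0 < rpow r a" for a by (rule rpow_pos[of r, OF r])
  define sel where "sel c = (SOME a. a \<in> E \<and> a \<subseteq># c)" for c
  have sel: "sel c \<in> E \<and> sel c \<subseteq># c" if "a \<in> E" "a \<subseteq># c" for a c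
    unfolding sel_def by (rule someI[of _ a]) (use that in auto)
  \<comment> \<open>The coefficient at \<open>c\<close> of \<open>f - \<Sum> q\<^sub>a t\<^sub>a\<close>, where \<open>q\<^sub>a\<close> collects the terms of \<open>F\<close> assigned to \<open>a\<close>. It uses \<open>F\<close> only below \<open>c\<close>.\<close>
  define \<Phi> where "\<Phi> F c = cf f c - (\<Sum>a\<in>E. \<Sum>(b, d)\<in>splits c.
      if cf (t a) d \<noteq> 0 \<and> sel (b + a) = a then F (b + a) * cf (t a) d else 0)" for F c
  have adm: "adm_wf {(a, b). prec \<tau> a b} \<Phi>"
    unfolding adm_wf_def
  proof (intro allI impI)
    fix F G :: "nat multiset \<Rightarrow> 'k" and c assume eq: "\<forall>z. (z, c) \<in> {(a, b). prec \<tau> a b} \<longrightarrow> F z = G z"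
    have "F (b + a) = G (b + a)" if "a \<in> E" "(b, d) \<in> splits c" "cf (t a) d \<noteq> 0" for a b d
      using eq prec_add_left[OF tp[OF that(1,3)], of b] that(2) by (auto simp: splits_def)
    then show "\<Phi> F c = \<Phi> G c"
      unfolding \<Phi>_def by (intro arg_cong2[of _ _ _ _ "(-)"] sum.cong refl) auto
  qed
  define F where "F = wfrec {(a, b). prec \<tau> a b} \<Phi>"
  have F: "F c = \<Phi> F c" for c
    unfolding F_def by (rule fun_cong[OF wfrec_fixpoint[OF wf_prec adm]])
  define q where "q a = Mps (\<lambda>b. if sel (b + a) = a then F (b + a) else 0)" for a
  define R where "R = Mps (\<lambda>c. if \<exists>a\<in>E. a \<subseteq># c then 0 else F c)"
  have F1: "F c = cf ((\<Sum>a\<in>E. q a * mterm a 1) + R) c" for c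
  proof -
    have "cf (\<Sum>a\<in>E. q a * mterm a 1) c = (\<Sum>a\<in>E. if a \<subseteq># c \<and> sel c = a then F c else 0)"
      unfolding cf_sum by (rule sum.cong) (auto simp: mult.commute[of _ "mterm _ _"] cf_mterm_mult q_def)
    also have "\<dots> = (if \<exists>a\<in>E. a \<subseteq># c then F c else 0)"
    proof (cases "\<exists>a\<in>E. a \<subseteq># c")
      case True
      then have s: "sel c \<in> E" "sel c \<subseteq># c" using sel by blast+
      have "(\<Sum>a\<in>E. if a \<subseteq># c \<and> sel c = a then F c else 0) = (\<Sum>a\<in>E. if a = sel c then F c else 0)"
        by (rule sum.cong) (use s(2) in auto)
      then show ?thesis using True s(1) E(1) by simp
    next
      case False
      then show ?thesis by (auto intro!: sum.neutral)
    qed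
    finally show ?thesis by (simp add: R_def)
  qed
  have F2: "F c = cf (f - (\<Sum>a\<in>E. q a * t a)) c" for c
    unfolding F[of c] \<Phi>_def cf_simps cf_sum cf_mult
    by (intro arg_cong2[of _ _ _ _ "(-)"] sum.cong refl) (auto simp: q_def)
  have "f = (\<Sum>a\<in>E. q a * mterm a 1) + R + (\<Sum>a\<in>E. q a * t a)"
  proof (rule mps_eqI)
    fix c
    show "cf f c = cf ((\<Sum>a\<in>E. q a * mterm a 1) + R + (\<Sum>a\<in>E. q a * t a)) c"
      using F1[of c] F2[of c] by (simp add: diff_eq_eq)
  qed
  also have "\<dots> = (\<Sum>a\<in>E. q a * g a) + R"
    unfolding t_def by (simp add: right_diff_distrib sum_subtractf)
  finally have eq: "f = (\<Sum>a\<in>E. q a * g a) + R" .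

  have FV: "c \<in> mons V" if "F c \<noteq> 0" for c
    using that
  proof (induction c rule: wf_induct_rule[OF wf_prec[of \<tau>]])
    case (1 c)
    show ?case
    proof (rule ccontr)
      assume c: "c \<notin> mons V"
      have "cf f c = 0" using f c unfolding conv_def supp_def by auto
      moreover have "F (b + a) = 0" if "a \<in> E" "(b, d) \<in> splits c" "cf (t a) d \<noteq> 0" for a b d
      proof -
        have bd: "c = b + d" using that by (auto simp: splits_def)
        have "d \<in> mons V" using tc[OF that(1)] that(3) unfolding conv_def supp_def by auto
        then have "b \<notin> mons V" using c bd by auto
        then have "b + a \<notin> mons V" by simp
        then show ?thesis using 1(1)[of "b + a"] prec_add_left[OF tp[OF that(1,3)], of b] bd by auto
      qed
      ultimately have "F c = 0"
        unfolding F[of c] \<Phi>_def by (auto intro!: sum.neutral)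
      then show False using 1 by auto
    qed
  qed

  \<comment> \<open>Truncation at degree \<open>n\<close> makes all sums finite, so that \<open>S \<le> C + S / 2\<close> can be solved for \<open>S\<close>.\<close>
  have main: "(\<Sum>c\<in>{c \<in> mons V. size c \<le> n}. v (F c) * rpow r c) \<le> 2 * C" for n
  proof -
    define D where "D = {c \<in> mons V. size c \<le> n}"
    have D: "finite D" unfolding D_def by (rule finite_mons_le[OF V])
    define S where "S = (\<Sum>c\<in>D. v (F c) * rpow r c)"
    define qn where "qn a = Mps (\<lambda>b. if b + a \<in> D \<and> sel (b + a) = a then F (b + a) else 0)" for a
    define Q where "Q a = (\<Sum>b\<in>D. v (cf (qn a) b) * rpow r b)" for a
    have bq: "bdd r (qn a) (Q a)" for a
      unfolding Q_def by (rule bdd_finite_support[OF r D]) (auto simp: qn_def D_def split: if_splits)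
    \<comment> \<open>Multiplying by \<open>t\<^sub>a\<close> raises degrees by at least \<open>size a\<close>, so the truncated quotient suffices up to degree \<open>n\<close>.\<close>
    have cq: "cf (q a * t a) c = cf (qn a * t a) c" if a: "a \<in> E" and c: "c \<in> D" for a c
      unfolding cf_mult
    proof (intro sum.cong refl)
      fix x assume x: "x \<in> splits c"
      obtain b d where bd: "x = (b, d)" by force
      show "(case x of (b, d) \<Rightarrow> cf (q a) b * cf (t a) d) = (case x of (b, d) \<Rightarrow> cf (qn a) b * cf (t a) d)"
      proof (cases "cf (t a) d = 0")
        case False
        have "size a \<le> size d" using prec_size[OF tp[OF a False]] .
        then have "b + a \<in> D" using c x bd a E by (auto simp: D_def splits_def)
        then show ?thesis unfolding bd by (auto simp: q_def qn_def)
      qed (simp add: bd)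
    qed
    \<comment> \<open>The monomials of the \<open>q\<^sub>a x\<^sup>a\<close> are distinct monomials of \<open>F\<close>, so the norms of these series add up to at most \<open>S\<close>.\<close>
    have QS: "Q a * rpow r a \<le> (\<Sum>c\<in>D. if sel c = a then v (F c) * rpow r c else 0)" if a: "a \<in> E" for a
    proof -
      let ?D = "{b \<in> D. b + a \<in> D \<and> sel (b + a) = a}"
      have "Q a * rpow r a = (\<Sum>b\<in>D. if b + a \<in> D \<and> sel (b + a) = a then v (F (b + a)) * rpow r (b + a) else 0)"
        unfolding Q_def sum_distrib_right by (rule sum.cong) (auto simp: qn_def)
      also have "\<dots> = (\<Sum>b\<in>?D. v (F (b + a)) * rpow r (b + a))"
        by (rule sum.inter_filter[symmetric, OF D])
      also have "\<dots> = (\<Sum>c\<in>(\<lambda>b. b + a) ` ?D. v (F c) * rpow r c)"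
        by (subst sum.reindex) (auto simp: inj_on_def)
      also have "\<dots> \<le> (\<Sum>c\<in>{c \<in> D. sel c = a}. v (F c) * rpow r c)"
        using rp D by (intro sum_mono2) (auto simp: less_imp_le intro!: mult_nonneg_nonneg v_nonneg)
      also have "\<dots> = (\<Sum>c\<in>D. if sel c = a then v (F c) * rpow r c else 0)"
        by (rule sum.inter_filter[OF D])
      finally show ?thesis .
    qed
    have "(\<Sum>a\<in>E. Q a * rpow r a) \<le> (\<Sum>a\<in>E. \<Sum>c\<in>D. if sel c = a then v (F c) * rpow r c else 0)"
      by (intro sum_mono QS)
    also have "\<dots> = (\<Sum>c\<in>D. \<Sum>a\<in>E. if sel c = a then v (F c) * rpow r c else 0)"
      by (rule sum.swap)
    also have "\<dots> \<le> S"
      unfolding S_def using E rp by (intro sum_mono) (auto simp: sum.delta' less_imp_le intro!: mult_nonneg_nonneg v_nonneg)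
    finally have QS': "(\<Sum>a\<in>E. Q a * rpow r a) \<le> S" .
    have "S \<le> (\<Sum>c\<in>D. v (cf f c) * rpow r c + (\<Sum>a\<in>E. v (cf (qn a * t a) c) * rpow r c))"
      unfolding S_def
    proof (rule sum_mono)
      fix c assume c: "c \<in> D"
      have "v (F c) \<le> v (cf f c) + v (\<Sum>a\<in>E. cf (q a * t a) c)"
        using v_tri[of "cf f c" "- (\<Sum>a\<in>E. cf (q a * t a) c)"] F2[of c] by (simp add: cf_sum)
      also have "\<dots> \<le> v (cf f c) + (\<Sum>a\<in>E. v (cf (qn a * t a) c))"
        using v_sum[of "\<lambda>a. cf (q a * t a) c" E] cq[OF _ c] by simp
      finally have "v (F c) * rpow r c \<le> (v (cf f c) + (\<Sum>a\<in>E. v (cf (qn a * t a) c))) * rpow r c"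
        using rp[of c] by (intro mult_right_mono) auto
      then show "v (F c) * rpow r c \<le> v (cf f c) * rpow r c + (\<Sum>a\<in>E. v (cf (qn a * t a) c) * rpow r c)"
        by (simp add: distrib_right sum_distrib_right)
    qed
    also have "\<dots> = (\<Sum>c\<in>D. v (cf f c) * rpow r c) + (\<Sum>a\<in>E. \<Sum>c\<in>D. v (cf (qn a * t a) c) * rpow r c)"
      by (simp add: sum.distrib sum.swap[of _ E D])
    also have "\<dots> \<le> C + (\<Sum>a\<in>E. Q a * (rpow r a / 2))"
      by (intro add_mono sum_mono bddD[OF C D] bddD[OF bdd_mult[OF r bq bt] D])
    also have "(\<Sum>a\<in>E. Q a * (rpow r a / 2)) = (\<Sum>a\<in>E. Q a * rpow r a) / 2"
      by (simp add: sum_divide_distrib)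
    finally have "S \<le> 2 * C" using QS' by simp
    then show ?thesis unfolding S_def D_def .
  qed
  have bF: "(\<Sum>c\<in>G. v (F c) * rpow r c) \<le> 2 * C" if G: "finite G" for G
  proof -
    define n where "n = Max (insert 0 (size ` G))"
    have n: "size c \<le> n" if "c \<in> G" for c using G that by (auto simp: n_def)
    have "(\<Sum>c\<in>G. v (F c) * rpow r c) = (\<Sum>c\<in>G \<inter> mons V. v (F c) * rpow r c)"
      using FV by (intro sum.mono_neutral_right) (auto simp: G v_eq_0)
    also have "\<dots> \<le> (\<Sum>c\<in>{c \<in> mons V. size c \<le> n}. v (F c) * rpow r c)"
      using rp n finite_mons_le[OF V] by (intro sum_mono2) (auto simp: less_imp_le intro!: mult_nonneg_nonneg v_nonneg)
    also have "\<dots> \<le> 2 * C" by (rule main)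
    finally show ?thesis .
  qed
  have "R \<in> conv V"
  proof -
    have "bdd r R (1 * (2 * C))"
      by (rule bdd_scale[of _ "Mps F"]) (use bF rp in \<open>auto simp: bdd_def R_def less_imp_le intro!: mult_nonneg_nonneg v_nonneg\<close>)
    moreover have "supp V R" unfolding supp_def R_def using FV by auto
    ultimately show ?thesis unfolding conv_def using r by auto
  qed
  moreover have "q a \<in> conv V" if a: "a \<in> E" for a
  proof -
    have "bdd r (q a) (2 * C / rpow r a)"
      unfolding bdd_def
    proof (intro allI impI)
      fix G :: "nat multiset set" assume G: "finite G"
      have "(\<Sum>b\<in>G. v (cf (q a) b) * rpow r b) * rpow r a \<le> (\<Sum>b\<in>G. v (F (b + a)) * rpow r (b + a))"
        unfolding sum_distrib_right using rp 
        by (intro sum_mono) (auto simp: q_def less_imp_le intro!: mult_nonneg_nonneg v_nonneg)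
      also have "\<dots> = (\<Sum>c\<in>(\<lambda>b. b + a) ` G. v (F c) * rpow r c)"
        by (subst sum.reindex) (auto simp: inj_on_def)
      also have "\<dots> \<le> 2 * C" using G by (intro bF) auto
      finally show "(\<Sum>b\<in>G. v (cf (q a) b) * rpow r b) \<le> 2 * C / rpow r a"
        using rp[of a] by (simp add: field_simps)
    qed
    moreover have "supp V (q a)"
      unfolding supp_def
    proof (intro allI impI)
      fix b assume "cf (q a) b \<noteq> 0"
      then have "F (b + a) \<noteq> 0" by (auto simp: q_def split: if_splits)
      from FV[OF this] show "b \<in> mons V" by simp
    qed
    ultimately show ?thesis unfolding conv_def using r by auto
  qed
  moreover have "\<forall>b. cf R b \<noteq> 0 \<longrightarrow> (\<forall>a\<in>E. \<not> a \<subseteq># b)" unfolding R_def by auto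
  ultimately show ?thesis using eq by blast
qed

end

section \<open>Consequences of division\<close>

text \<open>
  Dickson's lemma, by induction on the number of variables. Forget the exponent of the new variable \<open>x\<close> and
  take a basis \<open>E\<^sub>0\<close>; it handles the monomials in which \<open>x\<close> occurs at least \<open>M\<close> times, \<open>M\<close> being the
  largest exponent in \<open>E\<^sub>0\<close>. Each smaller exponent of \<open>x\<close> gets a basis of its own.
\<close>

lemma dickson:
  assumes "finite V" "L \<subseteq> mons V"
  shows "\<exists>E. finite E \<and> E \<subseteq> L \<and> (\<forall>a\<in>L. \<exists>e\<in>E. e \<subseteq># a)"
  using assms
proof (induction V arbitrary: L rule: finite_induct)
  case empty
  then have "L \<subseteq> {{#}}" by (auto simp: mons_def)
  then show ?case by (intro exI[of _ L]) (auto intro: finite_subset)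
next
  case (insert x V)
  define p where "p a = {#y \<in># a. y \<noteq> x#}" for a
  have le: "a \<subseteq># b" if "p a \<subseteq># p b" "count a x \<le> count b x" for a b
  proof (rule mset_subset_eqI)
    fix y show "count a y \<le> count b y"
      using that(2) mset_subset_eq_count[OF that(1), of y] by (cases "y = x") (auto simp: p_def)
  qed
  have ex: "\<exists>E. finite E \<and> E \<subseteq> L' \<and> (\<forall>a\<in>L'. \<exists>e\<in>E. p e \<subseteq># p a)" if "L' \<subseteq> L" for L'
  proof -
    have "p a \<in> mons V" if "a \<in> mons (insert x V)" for a
      using that by (auto simp: p_def mons_def)
    then have "p ` L' \<subseteq> mons V" using that insert.prems by blast
    from insert.IH[OF this] obtain F where F: "finite F" "F \<subseteq> p ` L'" "\<forall>a\<in>p ` L'. \<exists>e\<in>F. e \<subseteq># a" by blast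
    from finite_subset_image[OF F(1,2)] obtain E where "E \<subseteq> L'" "finite E" "F = p ` E" by blast
    moreover from this F(3) have "\<forall>a\<in>L'. \<exists>e\<in>E. p e \<subseteq># p a" by simp
    ultimately show ?thesis by blast
  qed
  obtain E0 where E0: "finite E0" "E0 \<subseteq> L" "\<forall>a\<in>L. \<exists>e\<in>E0. p e \<subseteq># p a" using ex[of L] by blast
  define M where "M = Max (insert 0 ((\<lambda>a. count a x) ` E0))"
  have M: "count e x \<le> M" if "e \<in> E0" for e unfolding M_def using that E0(1) by auto
  have "\<forall>k. \<exists>E. finite E \<and> E \<subseteq> {a \<in> L. count a x = k} \<and> (\<forall>a\<in>{a \<in> L. count a x = k}. \<exists>e\<in>E. p e \<subseteq># p a)"
    using ex by (metis (no_types, lifting) mem_Collect_eq subsetI)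
  from choice[OF this] obtain E1 where "\<forall>k. finite (E1 k) \<and> E1 k \<subseteq> {a \<in> L. count a x = k}
    \<and> (\<forall>a\<in>{a \<in> L. count a x = k}. \<exists>e\<in>E1 k. p e \<subseteq># p a)" by blast
  then have E1: "\<And>k. finite (E1 k)" "\<And>k. E1 k \<subseteq> {a \<in> L. count a x = k}"
    "\<And>k a. a \<in> L \<Longrightarrow> count a x = k \<Longrightarrow> \<exists>e\<in>E1 k. p e \<subseteq># p a" by blast+
  show ?case
  proof (intro exI[of _ "E0 \<union> (\<Union>k<M. E1 k)"] conjI ballI)
    fix a assume a: "a \<in> L"
    show "\<exists>e\<in>E0 \<union> (\<Union>k<M. E1 k). e \<subseteq># a"
    proof (cases "count a x < M")
      case True
      obtain e where e: "e \<in> E1 (count a x)" "p e \<subseteq># p a" using E1(3)[OF a refl] by auto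
      then have "e \<subseteq># a" using E1(2)[of "count a x"] by (auto intro!: le[OF e(2)])
      then show ?thesis using e True by blast
    next
      case False
      obtain e where e: "e \<in> E0" "p e \<subseteq># p a" using E0(3) a by auto
      then have "e \<subseteq># a" using M[of e] False by (auto intro!: le[OF e(2)])
      then show ?thesis using e by blast
    qed
  next
    show "finite (E0 \<union> (\<Union>k<M. E1 k))" using E0(1) E1(1) by simp
    show "E0 \<union> (\<Union>k<M. E1 k) \<subseteq> L" using E0(2) E1(2) by blast
  qed
qed

definition lead :: "(nat \<Rightarrow> nat) \<Rightarrow> 'k::field mps \<Rightarrow> nat multiset \<Rightarrow> bool" where
  "lead \<tau> f a \<longleftrightarrow> cf f a \<noteq> 0 \<and> (\<forall>b. cf f b \<noteq> 0 \<longrightarrow> b = a \<or> prec \<tau> a b)"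

lemma lead_exists:
  assumes "inj \<tau>" "f \<noteq> 0" shows "\<exists>a. lead \<tau> f a"
proof -
  from assms(2) obtain b where "cf f b \<noteq> 0" by (metis mps_eqI cf_simps(1))
  then obtain a where "cf f a \<noteq> 0" "\<And>b. prec \<tau> b a \<Longrightarrow> cf f b = 0"
    using wfE_min[OF wf_prec[of \<tau>], of b "{b. cf f b \<noteq> 0}"] by auto
  then show ?thesis unfolding lead_def using prec_total[OF assms(1)] by metis
qed

lemma lead_mult:
  assumes "lead \<tau> f a" "lead \<tau> g b" shows "cf (f * g) (a + b) \<noteq> 0"
proof -
  have "cf (f * g) (a + b) = (\<Sum>x\<in>{(a, b)}. case x of (a, b) \<Rightarrow> cf f a * cf g b)"
    unfolding cf_mult
  proof (rule sum.mono_neutral_right[OF finite_splits])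
    show "\<forall>x\<in>splits (a + b) - {(a, b)}. (case x of (a, b) \<Rightarrow> cf f a * cf g b) = 0"
    proof
      fix x assume x: "x \<in> splits (a + b) - {(a, b)}"
      obtain a' b' where x': "x = (a', b')" by force
      have s: "(a', b') \<in> splits (a + b)" and n: "(a', b') \<noteq> (a, b)" using x x' by auto
      have e: "a' + b' = a + b" using s by (auto simp: splits_def)
      have "cf f a' * cf g b' = 0"
      proof (rule ccontr)
        assume "\<not> ?thesis"
        then have "a' = a \<or> prec \<tau> a a'" "b' = b \<or> prec \<tau> b b'" using assms unfolding lead_def by auto
        then have "prec \<tau> (a + b) (a' + b')"
          using n prec_add_left[of \<tau> b b' a] prec_add_right[of \<tau> a a' b] prec_add_right[of \<tau> a a' b']
            prec_trans[of \<tau> "a + b" "a + b'" "a' + b'"] by auto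
        then show False using e prec_irrefl by auto
      qed
      then show "(case x of (a, b) \<Rightarrow> cf f a * cf g b) = 0" using x' by simp
    qed
  qed (auto simp: splits_def)
  then show ?thesis using assms unfolding lead_def by auto
qed

context valued_field
begin

lemma const_conv: "mterm {#} c \<in> conv V"
  by (rule conv_single) simp

text \<open>
  Division by the variables.
\<close>

lemma var_decomposition:
  assumes "finite V" "t \<in> conv V"
  shows "\<exists>c q. (\<forall>i\<in>V. q i \<in> conv V) \<and> t = mterm {#} c + (\<Sum>i\<in>V. q i * mterm {#i#} 1)"
proof -
  let ?E = "(\<lambda>i. {#i#}) ` V"
  have "\<exists>q R. (\<forall>a\<in>?E. q a \<in> conv V) \<and> R \<in> conv V \<and> t = (\<Sum>a\<in>?E. q a * mterm a 1) + R
    \<and> (\<forall>b. cf R b \<noteq> 0 \<longrightarrow> (\<forall>a\<in>?E. \<not> a \<subseteq># b))"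
    by (rule division[where \<tau> = id and g = "\<lambda>a. mterm a 1"]) (use assms in \<open>auto intro!: conv_single split: if_splits\<close>)
  then obtain q R where q: "\<forall>a\<in>?E. q a \<in> conv V" and R: "R \<in> conv V" "\<And>b. cf R b \<noteq> 0 \<Longrightarrow> (\<forall>a\<in>?E. \<not> a \<subseteq># b)"
    and t: "t = (\<Sum>a\<in>?E. q a * mterm a 1) + R" by blast
  have "R = mterm {#} (cf R {#})"
  proof (rule mps_eqI)
    fix b
    show "cf R b = cf (mterm {#} (cf R {#})) b"
    proof (cases "b = {#} \<or> cf R b = 0")
      case False
      then have "b \<in> mons V" using R(1) unfolding conv_def supp_def by auto
      moreover obtain x where "x \<in># b" using False by auto
      ultimately have "{#x#} \<in> ?E" "{#x#} \<subseteq># b" by (auto simp: mons_def)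
      then show ?thesis using R(2)[of b] False by blast
    qed auto
  qed
  moreover have "(\<Sum>a\<in>?E. q a * mterm a 1) = (\<Sum>i\<in>V. q {#i#} * mterm {#i#} 1)"
    by (subst sum.reindex) (auto simp: inj_on_def)
  ultimately show ?thesis using q t 
    by (intro exI[of _ "cf R {#}"] exI[of _ "\<lambda>i. q {#i#}"]) (auto simp: add.commute)
qed

text \<open>
  Division of \<open>1\<close> by a series whose leading monomial is \<open>1\<close> leaves no remainder.
\<close>

lemma unit_conv:
  assumes "finite V" "f \<in> conv V" "cf f {#} \<noteq> 0"
  shows "\<exists>u\<in>conv V. u * f = 1"
proof -
  define g where "g = mterm {#} (1 / cf f {#}) * f"
  have g: "g \<in> conv V" "cf g {#} = 1"
    unfolding g_def using assms by (auto intro!: subringD(4)[OF conv_subring] const_conv simp: cf_const_mult)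
  have "\<exists>(q :: nat multiset \<Rightarrow> 'k mps) R. (\<forall>a\<in>{{#}}. q a \<in> conv V) \<and> R \<in> conv V \<and> 1 = (\<Sum>a\<in>{{#}}. q a * g) + R
    \<and> (\<forall>b. cf R b \<noteq> 0 \<longrightarrow> (\<forall>a\<in>{{#}}. \<not> a \<subseteq># b))"
    by (rule division[where \<tau> = id and g = "\<lambda>_. g"]) 
      (use assms(1) g subringD(2)[OF conv_subring] in \<open>auto simp: prec_def nonempty_has_size\<close>)
  then obtain q R where q: "q {#} \<in> conv V" "1 = q {#} * g + R" "\<And>b. cf R b = 0" by auto
  then have "R = 0" by (intro mps_eqI) auto
  then have "(q {#} * mterm {#} (1 / cf f {#})) * f = 1" using q(2) unfolding g_def by (simp add: mult.assoc)
  moreover have "q {#} * mterm {#} (1 / cf f {#}) \<in> conv V"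
    using q(1) by (intro subringD(4)[OF conv_subring] const_conv)
  ultimately show ?thesis by blast
qed

text \<open>
  This replaces Krull's intersection theorem. Divide \<open>f\<close> by elements of \<open>J\<close> whose leading monomials generate
  all leading monomials of \<open>J\<close>. If the remainder \<open>R\<close> were nonzero with leading monomial \<open>a\<close>, an element of
  \<open>J\<close> that agrees with it up to order \<open>size a + 1\<close> would have the leading monomial \<open>a\<close> too, but no monomial
  of \<open>R\<close> is divisible by a leading monomial of \<open>J\<close>.
\<close>

lemma ideal_closed:
  assumes V: "finite V" and J: "is_ideal (conv V) J" and f: "f \<in> conv V"
    and ap: "\<And>k. \<exists>j\<in>J. ordge k (f - j)"
  shows "f \<in> J"
proof -
  define L where "L = {a. \<exists>h\<in>J. lead id h a}"
  have "L \<subseteq> mons V"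
    using idealD(2)[OF J] unfolding L_def lead_def conv_def supp_def by blast
  from dickson[OF V this] obtain E where E: "finite E" "E \<subseteq> L" "\<And>a. a \<in> L \<Longrightarrow> \<exists>e\<in>E. e \<subseteq># a" by blast
  have EV: "E \<subseteq> mons V" using E(2) \<open>L \<subseteq> mons V\<close> by auto
  have "\<forall>a\<in>E. \<exists>h\<in>J. cf h a = 1 \<and> (\<forall>b. cf h b \<noteq> 0 \<longrightarrow> b = a \<or> prec id a b)"
  proof
    fix a assume "a \<in> E"
    then obtain h where h: "h \<in> J" "lead id h a" using E(2) unfolding L_def by auto
    then show "\<exists>h\<in>J. cf h a = 1 \<and> (\<forall>b. cf h b \<noteq> 0 \<longrightarrow> b = a \<or> prec id a b)"
      by (intro bexI[of _ "mterm {#} (1 / cf h a) * h"])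
        (auto simp: cf_const_mult lead_def intro!: idealD(4)[OF J] const_conv)
  qed
  then obtain g where g: "\<And>a. a \<in> E \<Longrightarrow> g a \<in> J" "\<And>a. a \<in> E \<Longrightarrow> cf (g a) a = 1"
    "\<And>a b. a \<in> E \<Longrightarrow> cf (g a) b \<noteq> 0 \<Longrightarrow> b = a \<or> prec id a b" by metis
  have "\<exists>q R. (\<forall>a\<in>E. q a \<in> conv V) \<and> R \<in> conv V \<and> f = (\<Sum>a\<in>E. q a * g a) + R
    \<and> (\<forall>b. cf R b \<noteq> 0 \<longrightarrow> (\<forall>a\<in>E. \<not> a \<subseteq># b))"
    by (rule division[OF V E(1) EV idealD(2)[OF J g(1)] g(2,3) f])
  then obtain q R where q: "\<And>a. a \<in> E \<Longrightarrow> q a \<in> conv V" and R: "\<And>b a. cf R b \<noteq> 0 \<Longrightarrow> a \<in> E \<Longrightarrow> \<not> a \<subseteq># b"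
    and eq: "f = (\<Sum>a\<in>E. q a * g a) + R" by blast
  have s: "(\<Sum>a\<in>E. q a * g a) \<in> J" by (intro ideal_sum[OF J] idealD(4)[OF J] q g)
  have "R = 0"
  proof (rule ccontr)
    assume "R \<noteq> 0"
    from lead_exists[OF inj_on_id this] obtain a where a: "lead id R a" by auto
    obtain j where j: "j \<in> J" "ordge (Suc (size a)) (f - j)" using ap by blast
    define h where "h = j - (\<Sum>a\<in>E. q a * g a)"
    have h: "h \<in> J" unfolding h_def by (rule ideal_minus(2)[OF conv_subring J j(1) s])
    have hR: "cf h b = cf R b - cf (f - j) b" for b unfolding h_def eq by simp
    have small: "cf (f - j) b = 0" if "size b \<le> size a" for b
      using j(2) that unfolding ordge_def by (metis Suc_n_not_le_n order_trans)
    have "lead id h a"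
      unfolding lead_def
    proof (intro conjI allI impI)
      show "cf h a \<noteq> 0" using a small[of a] unfolding hR lead_def by simp
      fix b assume "cf h b \<noteq> 0"
      then show "b = a \<or> prec id a b"
        using a small[of b] unfolding hR lead_def prec_def by (metis diff_zero linorder_le_less_linear)
    qed
    then obtain e where "e \<in> E" "e \<subseteq># a" using E(3) h unfolding L_def by blast
    then show False using R a unfolding lead_def by auto
  qed
  then show ?thesis using eq s by simp
qed

text \<open>
  For an order in which \<open>w\<close> is the first variable, \<open>w - h\<close> has the leading monomial \<open>w\<close>. So division leaves
  a remainder in \<open>k\<langle>V\<rangle>\<close>, and a nonzero multiple of \<open>w - h\<close> involves \<open>w\<close>. The retraction is the remainder.
\<close>

lemma simple_ext_conv:
  assumes V: "finite V" "w \<notin> V" and h: "h \<in> conv V" "cf h {#} = 0"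
  shows "\<exists>\<pi>. simple_ext (conv V) (conv (insert w V)) \<pi> (mterm {#w#} 1 - h)"
proof -
  define z where "z = mterm {#w#} 1 - h"
  let ?T = "conv (insert w V)"
  have VT: "conv V \<subseteq> ?T" by (rule conv_mono) auto
  have z: "z \<in> ?T" unfolding z_def using h VT
    by (intro subringD(6)[OF conv_subring] conv_single) auto
  define \<tau> where "\<tau> u = (if u = w then 0 else Suc u)" for u
  have \<tau>: "inj \<tau>" unfolding \<tau>_def by (auto simp: inj_def)
  have hw: "cf h {#w#} = 0" using h(1) V(2) unfolding conv_def supp_def by (auto simp: mons_def)
  have lz: "lead \<tau> z {#w#}"
    unfolding lead_def
  proof (intro conjI allI impI)
    show "cf z {#w#} \<noteq> 0" unfolding z_def using hw by simp
    fix b assume b: "cf z b \<noteq> 0"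
    show "b = {#w#} \<or> prec \<tau> {#w#} b"
    proof (cases "b = {#w#}")
      case False
      then have hb: "cf h b \<noteq> 0" using b unfolding z_def by auto
      then have bV: "b \<in> mons V" using h(1) unfolding conv_def supp_def by auto
      have "b \<noteq> {#}" using hb h(2) by auto
      then have "size b \<ge> 1" by (simp add: Suc_leI nonempty_has_size)
      then consider "size b > 1" | "size b = 1" by linarith
      then show ?thesis
      proof cases
        case 2
        then obtain u where u: "b = {#u#}" using size_1_singleton_mset by auto
        then have "u \<noteq> w" using bV V(2) by (auto simp: mons_def)
        then have "\<tau> w < \<tau> u" unfolding \<tau>_def by simp
        then show ?thesis unfolding prec_def u by simp
      qed (simp add: prec_def)
    qed auto
  qed
  have ex: "\<exists>r q. r \<in> conv V \<and> q \<in> ?T \<and> t = r + q * z" if t: "t \<in> ?T" for t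
  proof -
    have "\<exists>q R. (\<forall>a\<in>{{#w#}}. q a \<in> ?T) \<and> R \<in> ?T \<and> t = (\<Sum>a\<in>{{#w#}}. q a * z) + R
      \<and> (\<forall>b. cf R b \<noteq> 0 \<longrightarrow> (\<forall>a\<in>{{#w#}}. \<not> a \<subseteq># b))"
      by (rule division[where \<tau> = \<tau> and g = "\<lambda>_. z"]) (use V z t lz hw in \<open>auto simp: lead_def z_def\<close>)
    then obtain q R where q: "q {#w#} \<in> ?T" "R \<in> ?T" "t = q {#w#} * z + R" "\<And>b. cf R b \<noteq> 0 \<Longrightarrow> w \<notin># b"
      by auto
    have "R \<in> conv V" using q(2,4) unfolding conv_def supp_def mons_def by (auto simp: subset_insert)
    then show ?thesis using q by (intro exI[of _ R] exI[of _ "q {#w#}"]) auto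
  qed
  have uniq: "q = 0" if "r \<in> conv V" "r = q * z" for q r
  proof (rule ccontr)
    assume "q \<noteq> 0"
    from lead_exists[OF \<tau> this] obtain a where "lead \<tau> q a" by auto
    from lead_mult[OF this lz] that(2) have "cf r (a + {#w#}) \<noteq> 0" by simp
    then have "a + {#w#} \<in> mons V" using that(1) unfolding conv_def supp_def by blast
    then show False using V(2) by auto
  qed
  define \<pi> where "\<pi> t = (THE r. r \<in> conv V \<and> (\<exists>q\<in>?T. t = r + q * z))" for t
  have \<pi>eq: "\<pi> t = r" if "r \<in> conv V" "q \<in> ?T" "t = r + q * z" for t r q
    unfolding \<pi>_def
  proof (rule the_equality)
    fix r' assume "r' \<in> conv V \<and> (\<exists>q\<in>?T. t = r' + q * z)"
    then obtain q' where q': "r' \<in> conv V" "t = r' + q' * z" by auto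
    have "r - r' = (q' - q) * z" using that q' by (simp add: algebra_simps)
    then have "q' - q = 0" using uniq[OF subringD(6)[OF conv_subring that(1) q'(1)]] by blast
    then show "r' = r" using that q' by simp
  qed (use that in auto)
  have key: "\<pi> t \<in> conv V \<and> (\<exists>q\<in>?T. t = \<pi> t + q * z)" if t: "t \<in> ?T" for t
  proof -
    obtain r q where r: "r \<in> conv V" "q \<in> ?T" "t = r + q * z" using ex[OF t] by blast
    then have "\<pi> t = r" by (rule \<pi>eq)
    then show ?thesis using r by blast
  qed
  note sr = subringD[OF conv_subring]
  have pa: "\<pi> a = a" if "a \<in> conv V" for a
    by (rule \<pi>eq[OF that sr(1)]) simp
  have "simple_ext (conv V) ?T \<pi> z"
  proof
    show "is_subring (conv V)" "is_subring ?T" by (rule conv_subring)+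
    show "conv V \<subseteq> ?T" "z \<in> ?T" by fact+
    show "\<pi> a = a" if "a \<in> conv V" for a by (rule pa[OF that])
    show "\<pi> t \<in> conv V" if "t \<in> ?T" for t using key[OF that] by simp
    show "\<pi> z = 0" by (rule \<pi>eq[OF sr(1,2)]) simp
    show "\<exists>q\<in>?T. t = \<pi> t + q * z" if "t \<in> ?T" for t using key[OF that] by simp
    show "t = 0" if "z * t = 0" for t
      by (rule uniq[OF sr(1)]) (use that in \<open>simp add: mult.commute\<close>)
    show "hom_on ?T \<pi>"
      unfolding hom_on_def
    proof (intro conjI ballI)
      show "\<pi> 1 = 1" by (rule pa[OF sr(2)])
      fix x y assume xT: "x \<in> ?T" and yT: "y \<in> ?T"
      obtain q where q: "q \<in> ?T" "x = \<pi> x + q * z" and px: "\<pi> x \<in> conv V" using key[OF xT] by blast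
      obtain q' where q': "q' \<in> ?T" "y = \<pi> y + q' * z" and py: "\<pi> y \<in> conv V" using key[OF yT] by blast
      have px': "\<pi> x \<in> ?T" and py': "\<pi> y \<in> ?T" using px py VT by auto
      show "\<pi> (x + y) = \<pi> x + \<pi> y"
      proof (rule \<pi>eq[OF sr(3)[OF px py] sr(3)[OF q(1) q'(1)]])
        show "x + y = \<pi> x + \<pi> y + (q + q') * z"
          by (subst q(2), subst q'(2)) (simp add: algebra_simps)
      qed
      show "\<pi> (x * y) = \<pi> x * \<pi> y"
      proof (rule \<pi>eq[OF sr(4)[OF px py]])
        show "\<pi> x * q' + \<pi> y * q + q * q' * z \<in> ?T"
          by (intro sr(3,4) px' py' q(1) q'(1) \<open>z \<in> ?T\<close>)
        show "x * y = \<pi> x * \<pi> y + (\<pi> x * q' + \<pi> y * q + q * q' * z) * z"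
          by (subst q(2), subst q'(2)) (simp add: algebra_simps)
      qed
    qed
  qed
  then show ?thesis unfolding z_def by blast
qed

text \<open>
  Adjoin the variables of \<open>W\<close> one by one. The series \<open>h\<^sub>w\<close> lie in \<open>k\<langle>V\<rangle>\<close>, hence in every intermediate
  ring, and all the intermediate retractions fix them.
\<close>

lemma retraction_chain:
  assumes W: "finite W" and V: "finite V" and disj: "V \<inter> W = {}" 
    and hs: "\<And>w. w \<in> W \<Longrightarrow> hs w \<in> conv V" "\<And>w. w \<in> W \<Longrightarrow> cf (hs w) {#} = 0"
  shows "\<exists>\<pi>. hom_on (conv (V \<union> W)) \<pi> \<and> (\<forall>t\<in>conv (V \<union> W). \<pi> t \<in> conv V) \<and> (\<forall>a\<in>conv V. \<pi> a = a)
    \<and> (\<forall>w\<in>W. \<pi> (mterm {#w#} 1) = hs w)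
    \<and> (\<forall>I l. is_ideal (conv V) I \<longrightarrow> 1 \<le> l \<longrightarrow> ideal_rt_le (conv V) I l = ideal_rt_le (conv (V \<union> W)) {t \<in> conv (V \<union> W). \<pi> t \<in> I} l)"
  using W disj hs
proof (induction W rule: finite_induct)
  case empty
  have "{t \<in> conv V. t \<in> I} = I" if "is_ideal (conv V) I" for I using idealD(2)[OF that] by auto
  then show ?case by (intro exI[of _ id]) (auto simp: hom_on_def)
next
  case (insert w W)
  from insert.IH insert.prems obtain \<pi> where \<pi>: "hom_on (conv (V \<union> W)) \<pi>" "\<And>t. t \<in> conv (V \<union> W) \<Longrightarrow> \<pi> t \<in> conv V"
    "\<And>a. a \<in> conv V \<Longrightarrow> \<pi> a = a" "\<And>w. w \<in> W \<Longrightarrow> \<pi> (mterm {#w#} 1) = hs w"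
    "\<And>I l. is_ideal (conv V) I \<Longrightarrow> 1 \<le> l \<Longrightarrow> ideal_rt_le (conv V) I l = ideal_rt_le (conv (V \<union> W)) {t \<in> conv (V \<union> W). \<pi> t \<in> I} l"
    by auto
  let ?T = "conv (insert w (V \<union> W))"
  have sub: "conv V \<subseteq> conv (V \<union> W)" by (rule conv_mono) auto
  have hw: "hs w \<in> conv (V \<union> W)" "cf (hs w) {#} = 0" using insert.prems sub by auto
  obtain \<rho> where "simple_ext (conv (V \<union> W)) ?T \<rho> (mterm {#w#} 1 - hs w)"
    using simple_ext_conv[of "V \<union> W" w "hs w"] V insert hw by auto
  then interpret E: simple_ext "conv (V \<union> W)" ?T \<rho> "mterm {#w#} 1 - hs w" .
  have T: "insert w (V \<union> W) = V \<union> insert w W" by auto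
  have X: "mterm {#u#} 1 \<in> conv (V \<union> W)" if "u \<in> W" for u using that by (intro conv_single) auto
  have Xw: "mterm {#w#} 1 \<in> ?T" by (intro conv_single) auto
  have "\<rho> (mterm {#w#} 1) - \<rho> (hs w) = 0"
    using E.\<pi>z hw(1) E.AT Xw by (subst homD(6)[OF E.\<pi> E.T, symmetric]) auto
  then have \<rho>w: "\<rho> (mterm {#w#} 1) = hs w" using E.\<pi>id[OF hw(1)] by simp
  show ?case
  proof (intro exI[of _ "\<pi> \<circ> \<rho>"] conjI ballI allI impI, unfold T[symmetric])
    show "hom_on ?T (\<pi> \<circ> \<rho>)" by (rule hom_on_comp[OF E.\<pi> \<pi>(1) E.\<pi>A])
    show "(\<pi> \<circ> \<rho>) t \<in> conv V" if "t \<in> ?T" for t using \<pi>(2) E.\<pi>A that by simp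
    show "(\<pi> \<circ> \<rho>) a = a" if "a \<in> conv V" for a using \<pi>(3) E.\<pi>id that sub by auto
    show "(\<pi> \<circ> \<rho>) (mterm {#u#} 1) = hs u" if "u \<in> insert w W" for u
      using that \<rho>w \<pi>(3)[of "hs w"] \<pi>(4) E.\<pi>id X insert.prems by auto
    fix I and l :: nat assume I: "is_ideal (conv V) I" and l: "1 \<le> l"
    let ?K = "{t \<in> conv (V \<union> W). \<pi> t \<in> I}"
    have K: "is_ideal (conv (V \<union> W)) ?K"
      unfolding is_ideal_def using idealD[OF I] \<pi>(2) subringD[OF conv_subring]
      by (auto simp: homD[OF \<pi>(1) conv_subring])
    have "ideal_rt_le (conv V) I l = ideal_rt_le (conv (V \<union> W)) ?K l" by (rule \<pi>(5)[OF I l])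
    also have "\<dots> = ideal_rt_le ?T {t \<in> ?T. \<rho> t \<in> ?K} l" by (rule E.ideal_rt_le_simple_ext[OF K l])
    also have "{t \<in> ?T. \<rho> t \<in> ?K} = {t \<in> ?T. (\<pi> \<circ> \<rho>) t \<in> I}" using E.\<pi>A by auto
    finally show "ideal_rt_le (conv V) I l = ideal_rt_le ?T {t \<in> ?T. (\<pi> \<circ> \<rho>) t \<in> I} l" .
  qed
qed

end

section \<open>Correspondences between power series rings\<close>

context valued_field
begin

text \<open>
  An isomorphism \<open>k\<langle>V\<rangle> / I \<cong> k\<langle>W\<rangle> / J\<close> of \<open>k\<close>-algebras, written as the relation
  "the classes of \<open>a\<close> and \<open>b\<close> correspond". In this form it is symmetric in the two rings.
\<close>

definition corr :: "nat set \<Rightarrow> 'k mps set \<Rightarrow> nat set \<Rightarrow> 'k mps set \<Rightarrow> ('k mps \<Rightarrow> 'k mps \<Rightarrow> bool) \<Rightarrow> bool" where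
  "corr V I W J rel \<longleftrightarrow> is_ideal (conv V) I \<and> is_ideal (conv W) J
    \<and> (\<forall>a b. rel a b \<longrightarrow> a \<in> conv V \<and> b \<in> conv W)
    \<and> (\<forall>a\<in>conv V. \<exists>b. rel a b) \<and> (\<forall>b\<in>conv W. \<exists>a. rel a b)
    \<and> (\<forall>a b a' b'. rel a b \<longrightarrow> rel a' b' \<longrightarrow> rel (a + a') (b + b') \<and> rel (a * a') (b * b'))
    \<and> (\<forall>c. rel (mterm {#} c) (mterm {#} c))
    \<and> (\<forall>a b. rel a b \<longrightarrow> (a \<in> I \<longleftrightarrow> b \<in> J))
    \<and> (\<forall>a\<in>I. \<forall>b\<in>J. rel a b)"

lemma corrD:
  assumes "corr V I W J rel"
  shows "is_ideal (conv V) I" "is_ideal (conv W) J" "rel a b \<Longrightarrow> a \<in> conv V" "rel a b \<Longrightarrow> b \<in> conv W"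
    "a \<in> conv V \<Longrightarrow> \<exists>b. rel a b" "b \<in> conv W \<Longrightarrow> \<exists>a. rel a b"
    "rel a b \<Longrightarrow> rel a' b' \<Longrightarrow> rel (a + a') (b + b')" "rel a b \<Longrightarrow> rel a' b' \<Longrightarrow> rel (a * a') (b * b')"
    "rel (mterm {#} c) (mterm {#} c)" "rel a b \<Longrightarrow> a \<in> I \<longleftrightarrow> b \<in> J" "a \<in> I \<Longrightarrow> b \<in> J \<Longrightarrow> rel a b"
  using assms unfolding corr_def by blast+

lemma corr_sym: "corr V I W J rel \<Longrightarrow> corr W J V I (\<lambda>b a. rel a b)"
  unfolding corr_def by blast

lemma mterm_const_simps: "mterm {#} 0 = 0" "mterm {#} 1 = 1" "mterm {#} (- 1) = - (1 :: 'k mps)"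
  by (auto intro!: mps_eqI)

lemma corr_diff:
  assumes c: "corr V I W J rel" and "rel a b" "rel a b'"
  shows "b - b' \<in> J"
proof -
  have "rel (a + mterm {#} (-1) * a) (b + mterm {#} (-1) * b')"
    by (intro corrD(7,8,9)[OF c] assms)
  then have "rel 0 (b - b')" by (simp add: mterm_const_simps)
  then show ?thesis using corrD(10)[OF c] idealD(1)[OF corrD(1)[OF c]] by blast
qed

lemma corr_sum:
  assumes c: "corr V I W J rel" and "\<And>i. i \<in> F \<Longrightarrow> rel (f i) (g i)"
  shows "rel (sum f F) (sum g F)"
proof -
  have "rel 0 0" using corrD(9)[OF c, of 0] by (simp add: mterm_const_simps)
  then show ?thesis using assms(2)
    by (induction F rule: infinite_finite_induct) (auto intro: corrD(7)[OF c])
qed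

text \<open>
  A lift with nonzero constant term would be a unit, so the variable would be a unit modulo \<open>J\<close>, which forces
  \<open>J\<close> to be the unit ideal. In that case every series is a lift, and \<open>0\<close> is chosen.
\<close>

lemma lift_variable:
  assumes c: "corr V I W J rel" and V: "finite V" and W: "finite W" and i: "i \<in> W"
  shows "\<exists>h. h \<in> conv V \<and> cf h {#} = 0 \<and> rel h (mterm {#i#} 1)"
proof -
  have X: "mterm {#i#} 1 \<in> conv W" using i by (intro conv_single) simp
  have r1: "rel 1 1" using corrD(9)[OF c, of 1] by (simp add: mterm_const_simps)
  have I: "is_ideal (conv V) I" and J: "is_ideal (conv W) J" using corrD[OF c] by blast+
  show ?thesis
  proof (cases "1 \<in> J")
    case True
    then have "mterm {#i#} 1 \<in> J" using idealD(4)[OF J X True] by simp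
    then have "rel 0 (mterm {#i#} 1)" using corrD(11)[OF c] idealD(1)[OF I] by blast
    then show ?thesis using subringD(1)[OF conv_subring] by (intro exI[of _ 0]) auto
  next
    case False
    obtain a where a: "rel a (mterm {#i#} 1)" using corrD(6)[OF c X] by blast
    have aV: "a \<in> conv V" using corrD(3)[OF c a] .
    have "cf a {#} = 0"
    proof (rule ccontr)
      assume "cf a {#} \<noteq> 0"
      from unit_conv[OF V aV this] obtain u where u: "u \<in> conv V" "u * a = 1" by blast
      \<comment> \<open>Modulo \<open>J\<close> the lift \<open>s\<close> of \<open>a\<^sup>-\<^sup>1\<close> is inverse to the variable, but \<open>1 - s x\<^sub>i\<close> is a unit.\<close>
      obtain s where s: "rel u s" using corrD(5)[OF c u(1)] by blast
      have sW: "s \<in> conv W" using corrD(4)[OF c s] .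
      have "rel 1 (s * mterm {#i#} 1)" using corrD(8)[OF c s a] u by simp
      then have d: "1 - s * mterm {#i#} 1 \<in> J" by (rule corr_diff[OF c r1])
      have "cf (1 - s * mterm {#i#} 1) {#} \<noteq> 0"
        by (simp add: mult.commute[of s] cf_mterm_mult)
      from unit_conv[OF W idealD(2)[OF J d] this] obtain w where "w \<in> conv W" "w * (1 - s * mterm {#i#} 1) = 1" by blast
      then have "1 \<in> J" using idealD(4)[OF J _ d] by metis
      then show False using False by simp
    qed
    then show ?thesis using a aV by blast
  qed
qed

text \<open>
  The ideals \<open>I\<close> and \<open>J\<close> have the same preimage in \<open>k\<langle>V \<union> W\<rangle>\<close>.
\<close>

theorem ideal_rt_le_corr:
  assumes c: "corr V I W J rel" and V: "finite V" and W: "finite W" and disj: "V \<inter> W = {}" and l: "1 \<le> l"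
  shows "ideal_rt_le (conv V) I l \<longleftrightarrow> ideal_rt_le (conv W) J l"
proof -
  have I: "is_ideal (conv V) I" and J: "is_ideal (conv W) J" using corrD[OF c] by blast+
  have disj': "W \<inter> V = {}" using disj by blast
  let ?X = "\<lambda>i. mterm {#i#} 1 :: 'k mps"
  have "\<forall>i\<in>W. \<exists>h. h \<in> conv V \<and> cf h {#} = 0 \<and> rel h (?X i)"
    using lift_variable[OF c V W] by blast
  then obtain h where h: "\<And>i. i \<in> W \<Longrightarrow> h i \<in> conv V" "\<And>i. i \<in> W \<Longrightarrow> cf (h i) {#} = 0" "\<And>i. i \<in> W \<Longrightarrow> rel (h i) (?X i)" by metis
  have "\<forall>i\<in>V. \<exists>h. h \<in> conv W \<and> cf h {#} = 0 \<and> rel (?X i) h"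
    using lift_variable[OF corr_sym[OF c] W V] by blast
  then obtain g where g: "\<And>i. i \<in> V \<Longrightarrow> g i \<in> conv W" "\<And>i. i \<in> V \<Longrightarrow> cf (g i) {#} = 0" "\<And>i. i \<in> V \<Longrightarrow> rel (?X i) (g i)" by metis
  define T where "T = conv (V \<union> W)"
  have TW: "conv (W \<union> V) = T" unfolding T_def by (simp add: Un_commute)
  obtain \<pi> where \<pi>: "hom_on T \<pi>" "\<And>t. t \<in> T \<Longrightarrow> \<pi> t \<in> conv V" "\<And>a. a \<in> conv V \<Longrightarrow> \<pi> a = a"
    "\<And>i. i \<in> W \<Longrightarrow> \<pi> (?X i) = h i" "ideal_rt_le (conv V) I l = ideal_rt_le T {t \<in> T. \<pi> t \<in> I} l"
    using retraction_chain[of W V h, OF W V disj h(1,2)] I l unfolding T_def by blast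
  obtain \<rho> where \<rho>: "hom_on T \<rho>" "\<And>t. t \<in> T \<Longrightarrow> \<rho> t \<in> conv W" "\<And>a. a \<in> conv W \<Longrightarrow> \<rho> a = a"
    "\<And>i. i \<in> V \<Longrightarrow> \<rho> (?X i) = g i" "ideal_rt_le (conv W) J l = ideal_rt_le T {t \<in> T. \<rho> t \<in> J} l"
    using retraction_chain[of V W g, OF V W disj' g(1,2)] J l unfolding TW by blast
  have T: "is_subring T" unfolding T_def by (rule conv_subring)
  have X: "?X i \<in> T" if "i \<in> V \<union> W" for i unfolding T_def using that by (intro conv_single) simp
  have C: "mterm {#} a \<in> T" for a unfolding T_def by (rule const_conv)
  have relX: "rel (\<pi> (?X i)) (\<rho> (?X i)) \<and> cf (\<rho> (?X i)) {#} = 0 \<and> \<rho> (?X i) \<in> conv W" if "i \<in> V \<union> W" for i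
  proof (cases "i \<in> V")
    case True
    then have "\<pi> (?X i) = ?X i" by (intro \<pi>(3) conv_single) simp
    then show ?thesis using g[OF True] \<rho>(4)[OF True] by simp
  next
    case False
    then have i: "i \<in> W" using that by simp
    then have "\<rho> (?X i) = ?X i" by (intro \<rho>(3) conv_single) simp
    then show ?thesis using h(3)[OF i] \<pi>(4)[OF i] \<rho>(2)[OF X[OF that]] by simp
  qed
  have ord1: "ordge 1 (\<rho> (?X i))" if "i \<in> V \<union> W" for i
    using relX[OF that] unfolding ordge_def by (metis One_nat_def Suc_leI nonempty_has_size)
  \<comment> \<open>Modulo \<open>J\<close>, the lift \<open>b\<close> of \<open>\<pi> t\<close> agrees with \<open>\<rho> t\<close> to every order \<open>k\<close>: write \<open>t = a + \<Sum> q\<^sub>i x\<^sub>i\<close>. The two maps agree on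
    \<open>x\<^sub>i\<close>, whose image has order at least one, and on \<open>q\<^sub>i\<close> to order \<open>k\<close>.\<close>
  have approx: "\<exists>j\<in>J. ordge k ((b - \<rho> t) - j)" if "t \<in> T" "rel (\<pi> t) b" for k t b
    using that
  proof (induction k arbitrary: t b)
    case 0
    then show ?case using idealD(1)[OF J] by (auto simp: ordge_def)
  next
    case (Suc k)
    obtain a q where q: "\<And>i. i \<in> V \<union> W \<Longrightarrow> q i \<in> T" and t: "t = mterm {#} a + (\<Sum>i\<in>V \<union> W. q i * ?X i)"
      using var_decomposition[of "V \<union> W" t] V W Suc.prems unfolding T_def by auto
    have "\<forall>i\<in>V \<union> W. \<exists>b. rel (\<pi> (q i)) b" using corrD(5)[OF c] \<pi>(2) q by blast
    then obtain b' where b': "\<And>i. i \<in> V \<union> W \<Longrightarrow> rel (\<pi> (q i)) (b' i)" by metis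
    have "\<forall>i\<in>V \<union> W. \<exists>j\<in>J. ordge k ((b' i - \<rho> (q i)) - j)" using Suc.IH q b' by blast
    then obtain j where j: "\<And>i. i \<in> V \<union> W \<Longrightarrow> j i \<in> J" "\<And>i. i \<in> V \<union> W \<Longrightarrow> ordge k ((b' i - \<rho> (q i)) - j i)" by metis
    have qX: "q i * ?X i \<in> T" if "i \<in> V \<union> W" for i using subringD(4)[OF T q[OF that] X[OF that]] .
    have S: "(\<Sum>i\<in>V \<union> W. q i * ?X i) \<in> T" by (rule subring_sum[OF T qX])
    have \<pi>t: "\<pi> t = mterm {#} a + (\<Sum>i\<in>V \<union> W. \<pi> (q i) * \<pi> (?X i))"
    proof -
      have "\<pi> (\<Sum>i\<in>V \<union> W. q i * ?X i) = (\<Sum>i\<in>V \<union> W. \<pi> (q i * ?X i))"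
        by (rule hom_sum[OF \<pi>(1) T qX])
      also have "\<dots> = (\<Sum>i\<in>V \<union> W. \<pi> (q i) * \<pi> (?X i))"
        by (rule sum.cong[OF refl]) (rule homD(4)[OF \<pi>(1) T q X])
      finally show ?thesis unfolding t homD(3)[OF \<pi>(1) T C S] using \<pi>(3)[OF const_conv] by simp
    qed
    have \<rho>t: "\<rho> t = mterm {#} a + (\<Sum>i\<in>V \<union> W. \<rho> (q i) * \<rho> (?X i))"
    proof -
      have "\<rho> (\<Sum>i\<in>V \<union> W. q i * ?X i) = (\<Sum>i\<in>V \<union> W. \<rho> (q i * ?X i))"
        by (rule hom_sum[OF \<rho>(1) T qX])
      also have "\<dots> = (\<Sum>i\<in>V \<union> W. \<rho> (q i) * \<rho> (?X i))"
        by (rule sum.cong[OF refl]) (rule homD(4)[OF \<rho>(1) T q X])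
      finally show ?thesis unfolding t homD(3)[OF \<rho>(1) T C S] using \<rho>(3)[OF const_conv] by simp
    qed
    define B where "B = mterm {#} a + (\<Sum>i\<in>V \<union> W. b' i * \<rho> (?X i))"
    have "rel (\<pi> t) B" unfolding \<pi>t B_def
      by (intro corrD(7,8,9)[OF c] corr_sum[OF c] b') (use relX in auto)
    then have d: "b - B \<in> J" by (rule corr_diff[OF c Suc.prems(2)])
    have s: "(\<Sum>i\<in>V \<union> W. j i * \<rho> (?X i)) \<in> J"
      using relX by (intro ideal_sum[OF J] idealD(5)[OF J] j) auto
    have "ordge (k + 1) (\<Sum>i\<in>V \<union> W. (b' i - \<rho> (q i) - j i) * \<rho> (?X i))"
      by (intro ordge_sum ordge_mult j ord1)
    moreover have "(\<Sum>i\<in>V \<union> W. (b' i - \<rho> (q i) - j i) * \<rho> (?X i))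
      = (b - \<rho> t) - ((b - B) + (\<Sum>i\<in>V \<union> W. j i * \<rho> (?X i)))"
      unfolding \<rho>t B_def by (simp add: left_diff_distrib sum_subtractf)
    ultimately show ?case using idealD(3)[OF J d s] by (intro bexI[OF _ idealD(3)[OF J d s]]) simp
  qed
  have "\<pi> t \<in> I \<longleftrightarrow> \<rho> t \<in> J" if t: "t \<in> T" for t
  proof -
    obtain b where b: "rel (\<pi> t) b" using corrD(5)[OF c \<pi>(2)[OF t]] by blast
    have bW: "b - \<rho> t \<in> conv W" by (rule subringD(6)[OF conv_subring corrD(4)[OF c b] \<rho>(2)[OF t]])
    have d: "b - \<rho> t \<in> J" by (rule ideal_closed[OF W J bW approx[OF t b]])
    have "b \<in> J \<longleftrightarrow> \<rho> t \<in> J"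
      using ideal_minus(2)[OF conv_subring J _ d, of b] idealD(3)[OF J d, of "\<rho> t"] by auto
    then show ?thesis using corrD(10)[OF c b] by simp
  qed
  then have "{t \<in> T. \<pi> t \<in> I} = {t \<in> T. \<rho> t \<in> J}" by blast
  then show ?thesis using \<pi>(5) \<rho>(5) by simp
qed

end

section \<open>Rings with carrier sets inside a ring type\<close>

text \<open>
  A ring given by a record is transported along an injective map into a ring type. It inherits
  the ring axioms from the type.
\<close>

locale ring_emb =
  fixes Q :: "('b, 'c) ring_scheme" (structure) and E :: "'b \<Rightarrow> 'a::comm_ring_1"
  assumes inj: "inj_on E (carrier Q)"
    and closed: "\<zero> \<in> carrier Q" "\<one> \<in> carrier Q"
      "\<And>x y. x \<in> carrier Q \<Longrightarrow> y \<in> carrier Q \<Longrightarrow> x \<oplus> y \<in> carrier Q"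
      "\<And>x y. x \<in> carrier Q \<Longrightarrow> y \<in> carrier Q \<Longrightarrow> x \<otimes> y \<in> carrier Q"
    and neg: "\<And>x. x \<in> carrier Q \<Longrightarrow> \<exists>y\<in>carrier Q. E y = - E x"
    and hom: "E \<zero> = 0" "E \<one> = 1"
      "\<And>x y. x \<in> carrier Q \<Longrightarrow> y \<in> carrier Q \<Longrightarrow> E (x \<oplus> y) = E x + E y"
      "\<And>x y. x \<in> carrier Q \<Longrightarrow> y \<in> carrier Q \<Longrightarrow> E (x \<otimes> y) = E x * E y"
begin

lemma E_eq: "x \<in> carrier Q \<Longrightarrow> y \<in> carrier Q \<Longrightarrow> E x = E y \<longleftrightarrow> x = y"
  using inj by (auto dest: inj_onD)

lemma E_eq_0: "x \<in> carrier Q \<Longrightarrow> E x = 0 \<longleftrightarrow> x = \<zero>"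
  using E_eq[of x "\<zero>"] closed hom by auto

lemma cring: "cring Q"
proof (rule cringI)
  show "abelian_group Q"
  proof (rule abelian_groupI)
    fix x assume x: "x \<in> carrier Q"
    obtain y where "y \<in> carrier Q" "E y = - E x" using neg[OF x] by blast
    then show "\<exists>y\<in>carrier Q. y \<oplus> x = \<zero>"
      using x by (intro bexI[of _ y]) (auto simp: E_eq[symmetric] hom closed)
  qed (auto simp: E_eq[symmetric] hom closed algebra_simps)
  show "comm_monoid Q"
    by (rule comm_monoidI) (auto simp: E_eq[symmetric] hom closed algebra_simps)
qed (auto simp: E_eq[symmetric] hom closed algebra_simps)

sublocale Q: cring Q by (rule cring)

lemma E_neg: assumes x: "x \<in> carrier Q" shows "E (\<ominus> x) = - E x"
proof -
  have "E x + E (\<ominus> x) = 0" using x hom(3)[of x "\<ominus> x"] hom(1) by (simp add: Q.r_neg)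
  then show ?thesis by (simp add: add_eq_0_iff)
qed

lemma E_finsum: "(\<And>i. i \<in> F \<Longrightarrow> f i \<in> carrier Q) \<Longrightarrow> E (finsum Q f F) = (\<Sum>i\<in>F. E (f i))"
proof (induction F rule: infinite_finite_induct)
  case (infinite F)
  then show ?case by (simp add: finsum_def finprod_def hom)
qed (auto simp: hom Pi_def)

lemma E_finprod: "(\<And>i. i \<in> F \<Longrightarrow> f i \<in> carrier Q) \<Longrightarrow> E (finprod Q f F) = (\<Prod>i\<in>F. E (f i))"
proof (induction F rule: infinite_finite_induct)
  case (infinite F)
  then show ?case by (simp add: finprod_def hom)
qed (auto simp: hom Pi_def)

lemma E_pow: "x \<in> carrier Q \<Longrightarrow> E (x [^] (n::nat)) = E x ^ n"
  by (induction n) (auto simp: hom mult.commute)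

lemma E_subring: "is_subring (E ` carrier Q)"
  unfolding is_subring_def
proof safe
  show "0 \<in> E ` carrier Q" "1 \<in> E ` carrier Q" using closed hom by (metis image_eqI)+
  fix x y assume xy: "x \<in> carrier Q" "y \<in> carrier Q"
  show "E x + E y \<in> E ` carrier Q" "E x * E y \<in> E ` carrier Q"
    using xy closed hom by (metis image_eqI)+
  show "- E x \<in> E ` carrier Q" using neg[OF xy(1)] by force
qed

lemma ideal_image:
  assumes "ideal I Q" shows "is_ideal (E ` carrier Q) (E ` I)"
proof -
  interpret I: ideal I Q by (rule assms)
  show ?thesis unfolding is_ideal_def
  proof safe
    show "0 \<in> E ` I" using I.zero_closed hom by (metis image_eqI)
    show "E x \<in> E ` carrier Q" if "x \<in> I" for x using I.Icarr that by blast
    show "E x + E y \<in> E ` I" if "x \<in> I" "y \<in> I" for x y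
      using that I.a_closed I.Icarr hom(3) by (metis image_eqI)
    show "E a * E x \<in> E ` I" if "a \<in> carrier Q" "x \<in> I" for a x
      using that I.I_l_closed I.Icarr hom(4) by (metis image_eqI)
  qed
qed

lemma ideal_preimage:
  assumes H: "is_ideal (E ` carrier Q) H" shows "ideal {x \<in> carrier Q. E x \<in> H} Q"
proof (rule idealI[OF Q.ring_axioms])
  show "subgroup {x \<in> carrier Q. E x \<in> H} (add_monoid Q)"
  proof (rule Q.add.subgroupI)
    show "{x \<in> carrier Q. E x \<in> H} \<noteq> {}" using closed(1) hom(1) idealD(1)[OF H] by auto
    show "\<ominus> a \<in> {x \<in> carrier Q. E x \<in> H}" if "a \<in> {x \<in> carrier Q. E x \<in> H}" for a
      using that ideal_minus(1)[OF E_subring H] by (simp add: E_neg)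
    show "a \<oplus> b \<in> {x \<in> carrier Q. E x \<in> H}" if "a \<in> {x \<in> carrier Q. E x \<in> H}" "b \<in> {x \<in> carrier Q. E x \<in> H}" for a b
      using that idealD(3)[OF H] by (simp add: hom)
  qed auto
qed (use idealD(4,5)[OF H] in \<open>auto simp: hom\<close>)

lemma genideal_image:
  assumes X: "X \<subseteq> carrier Q"
  shows "E ` genideal Q X = gen_ideal (E ` carrier Q) (E ` X)"
proof
  have G: "is_ideal (E ` carrier Q) (gen_ideal (E ` carrier Q) (E ` X))"
    by (rule gen_ideal_ideal[OF E_subring]) (use X in auto)
  have "genideal Q X \<subseteq> {x \<in> carrier Q. E x \<in> gen_ideal (E ` carrier Q) (E ` X)}"
    by (rule Q.genideal_minimal[OF ideal_preimage[OF G]]) (use X gen_ideal_in[OF E_subring] in blast)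
  then show "E ` genideal Q X \<subseteq> gen_ideal (E ` carrier Q) (E ` X)" by blast
  show "gen_ideal (E ` carrier Q) (E ` X) \<subseteq> E ` genideal Q X"
    by (rule gen_ideal_least[OF ideal_image[OF Q.genideal_ideal[OF X]]]) (use Q.genideal_self[OF X] in blast)
qed

end

section \<open>Polynomial rings and Rees algebras\<close>

lemma lookup_mult_splits:
  "lookup (p * q) c = (\<Sum>(a, b)\<in>splits c. lookup p a * lookup q b)" for p q :: "'i multiset \<Rightarrow>\<^sub>0 'a::comm_ring_1"
proof -
  have U: "is_subring (UNIV :: 'a set)" by (auto simp: is_subring_def)
  have in_U: "p \<in> polys UNIV UNIV" for p :: "'i multiset \<Rightarrow>\<^sub>0 'a" by (auto simp: polys_def)
  from U in_U[of p] show ?thesis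
  proof (induction p rule: polys_induct)
    case (add a x p)
    from U in_U[of q] have "lookup (single a x * q) c = (\<Sum>(a', b)\<in>splits c. lookup (single a x) a' * lookup q b)"
    proof (induction q rule: polys_induct)
      case (add b y q)
      have "(\<Sum>(a', b')\<in>splits c. lookup (single a x) a' * lookup (single b y) b')
        = (\<Sum>z\<in>splits c. if z = (a, b) then x * y else 0)"
        by (rule sum.cong) (auto simp: lookup_single when_def split: if_splits)
      also have "\<dots> = lookup (single a x * single b y) c"
        by (simp add: finite_splits mult_single lookup_single when_def) (simp add: splits_def)
      finally show ?case using add
        by (simp add: distrib_left lookup_add sum.distrib case_prod_beta)
    qed simp
    then show ?case using add
      by (simp add: distrib_right lookup_add sum.distrib case_prod_beta)
  qed simp
qed

definition emb_poly :: "('b \<Rightarrow> 'a::comm_ring_1) \<Rightarrow> (nat multiset \<Rightarrow> 'b) \<Rightarrow> nat multiset \<Rightarrow>\<^sub>0 'a" where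
  "emb_poly e p = Abs_poly_mapping (\<lambda>a. e (p a))"

lemma monomials_eq: "monomials m = mons {..<m}"
  unfolding monomials_def mons_def ..

context ring_emb
begin

lemma lookup_emb_poly:
  assumes "p \<in> carrier (poly_ring Q m)" shows "lookup (emb_poly E p) a = E (p a)"
proof -
  have "{a. E (p a) \<noteq> 0} = {a. p a \<noteq> \<zero>}" using assms E_eq_0 unfolding poly_ring_def by auto
  then have "finite {a. E (p a) \<noteq> 0}" using assms unfolding poly_ring_def by auto
  then show ?thesis unfolding emb_poly_def by simp
qed

lemma keys_emb_poly: "p \<in> carrier (poly_ring Q m) \<Longrightarrow> keys (emb_poly E p) = {a. p a \<noteq> \<zero>}"
  using E_eq_0 by (auto simp: in_keys_iff lookup_emb_poly poly_ring_def)

text \<open>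
  To compute in the polynomial ring it is enough to compute coefficients of the images.
\<close>

lemma poly_ring_memI:
  assumes "\<And>a. p a \<in> carrier Q" "\<And>a. E (p a) = lookup r a" "r \<in> polys (E ` carrier Q) (mons {..<m})"
  shows "p \<in> carrier (poly_ring Q m) \<and> emb_poly E p = r"
proof -
  have z: "p a = \<zero> \<longleftrightarrow> lookup r a = 0" for a using E_eq_0[OF assms(1)] assms(2) by metis
  have "{a. p a \<noteq> \<zero>} = keys r" by (auto simp: z in_keys_iff)
  then have p: "p \<in> carrier (poly_ring Q m)"
    using assms(1,3) z unfolding poly_ring_def polys_def monomials_eq by (auto simp: in_keys_iff)
  moreover have "emb_poly E p = r" by (rule poly_mapping_eqI) (simp add: lookup_emb_poly[OF p] assms(2))
  ultimately show ?thesis by simp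
qed

lemma emb_poly_image: "emb_poly E ` carrier (poly_ring Q m) = polys (E ` carrier Q) (mons {..<m})"
proof safe
  fix p assume p: "p \<in> carrier (poly_ring Q m)"
  then show "emb_poly E p \<in> polys (E ` carrier Q) (mons {..<m})"
    unfolding polys_def using p by (auto simp: lookup_emb_poly[OF p] keys_emb_poly[OF p], auto simp: poly_ring_def monomials_eq)
next
  fix r :: "nat multiset \<Rightarrow>\<^sub>0 'a" assume r: "r \<in> polys (E ` carrier Q) (mons {..<m})"
  define p where "p a = inv_into (carrier Q) E (lookup r a)" for a
  have pc: "p a \<in> carrier Q" "E (p a) = lookup r a" for a
    using r unfolding p_def polys_def by (auto intro: inv_into_into f_inv_into_f)
  from poly_ring_memI[of p r, OF pc r] show "r \<in> emb_poly E ` carrier (poly_ring Q m)" by blast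
qed

lemma poly_ring_emb: "ring_emb (poly_ring Q m) (emb_poly E)"
proof -
  let ?P = "polys (E ` carrier Q) (mons {..<m})"
  note S = subringD[OF polys_subring[OF E_subring, of "{..<m}"]]
  have c: "\<And>a. p a \<in> carrier Q" if "p \<in> carrier (poly_ring Q m)" for p using that unfolding poly_ring_def by auto
  have i: "emb_poly E p \<in> ?P" if "p \<in> carrier (poly_ring Q m)" for p using that emb_poly_image by blast
  have z: "\<zero>\<^bsub>poly_ring Q m\<^esub> \<in> carrier (poly_ring Q m) \<and> emb_poly E \<zero>\<^bsub>poly_ring Q m\<^esub> = 0"
    by (rule poly_ring_memI) (auto simp: poly_ring_def hom closed S)
  have o: "\<one>\<^bsub>poly_ring Q m\<^esub> \<in> carrier (poly_ring Q m) \<and> emb_poly E \<one>\<^bsub>poly_ring Q m\<^esub> = 1"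
    by (rule poly_ring_memI) (auto simp: poly_ring_def hom closed S lookup_one when_def)
  have a: "p \<oplus>\<^bsub>poly_ring Q m\<^esub> q \<in> carrier (poly_ring Q m) \<and> emb_poly E (p \<oplus>\<^bsub>poly_ring Q m\<^esub> q) = emb_poly E p + emb_poly E q"
    if p: "p \<in> carrier (poly_ring Q m)" and q: "q \<in> carrier (poly_ring Q m)" for p q
  proof (rule poly_ring_memI)
    show "(p \<oplus>\<^bsub>poly_ring Q m\<^esub> q) a \<in> carrier Q" for a using c[OF p] c[OF q] by (simp add: poly_ring_def)
    show "E ((p \<oplus>\<^bsub>poly_ring Q m\<^esub> q) a) = lookup (emb_poly E p + emb_poly E q) a" for a
      using c[OF p] c[OF q] by (simp add: lookup_add lookup_emb_poly[OF p] lookup_emb_poly[OF q]) (simp add: poly_ring_def hom)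
  qed (intro S i p q)
  have t: "p \<otimes>\<^bsub>poly_ring Q m\<^esub> q \<in> carrier (poly_ring Q m) \<and> emb_poly E (p \<otimes>\<^bsub>poly_ring Q m\<^esub> q) = emb_poly E p * emb_poly E q"
    if p: "p \<in> carrier (poly_ring Q m)" and q: "q \<in> carrier (poly_ring Q m)" for p q
  proof (rule poly_ring_memI)
    fix b
    have m: "(p \<otimes>\<^bsub>poly_ring Q m\<^esub> q) b = (\<Oplus>a\<in>{a. a \<subseteq># b}. p a \<otimes> q (b - a))" by (simp add: poly_ring_def)
    show "(p \<otimes>\<^bsub>poly_ring Q m\<^esub> q) b \<in> carrier Q"
      unfolding m by (rule Q.finsum_closed) (use c[OF p] c[OF q] in auto)
    have "E ((p \<otimes>\<^bsub>poly_ring Q m\<^esub> q) b) = (\<Sum>a\<in>{a. a \<subseteq># b}. E (p a) * E (q (b - a)))"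
      unfolding m using c[OF p] c[OF q] by (subst E_finsum) (auto simp: hom)
    also have "\<dots> = lookup (emb_poly E p * emb_poly E q) b"
      unfolding lookup_mult_splits lookup_emb_poly[OF p] lookup_emb_poly[OF q] by (rule sum_splits)
    finally show "E ((p \<otimes>\<^bsub>poly_ring Q m\<^esub> q) b) = lookup (emb_poly E p * emb_poly E q) b" .
  qed (intro S i p q)
  show ?thesis
  proof
    show "inj_on (emb_poly E) (carrier (poly_ring Q m))"
    proof (rule inj_onI, rule ext)
      fix p q a assume p: "p \<in> carrier (poly_ring Q m)" and q: "q \<in> carrier (poly_ring Q m)" and "emb_poly E p = emb_poly E q"
      then have "E (p a) = E (q a)" by (metis lookup_emb_poly)
      then show "p a = q a" using E_eq[OF c[OF p] c[OF q]] by blast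
    qed
    show "\<exists>q\<in>carrier (poly_ring Q m). emb_poly E q = - emb_poly E p" if p: "p \<in> carrier (poly_ring Q m)" for p
      using S(5)[OF i[OF p]] emb_poly_image[of m] by (metis (no_types, lifting) image_iff)
  qed (use z o a t in auto)
qed

end

text \<open>
  Here \<open>e\<close> identifies the ring \<open>R\<close> with the subring \<open>A\<close> of a ring type, and the Rees algebra becomes the ring
  \<open>rees_polys\<close> of the polynomials whose coefficient of \<open>t\<^sup>d\<close> lies in \<open>I\<^sup>d\<close>, via \<open>rees_poly\<close>.
\<close>

locale rees = ring_emb R e
  for R :: "('b, 'c) ring_scheme" (structure) and e :: "'b \<Rightarrow> 'a::comm_ring_1" +
  fixes I :: "'b set"
  assumes I: "ideal I R"
begin

abbreviation "A \<equiv> e ` carrier R"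

definition ipow :: "nat \<Rightarrow> 'b set" where "ipow d = I [^]\<^bsub>ideals_set R\<^esub> d"

lemma ipow_simps: "ipow 0 = carrier R" "ipow (Suc d) = ideal_prod R (ipow d) I" "ipow 1 = I" "ideal (ipow d) R"
  "ideal_prod R (ipow i) (ipow j) = ipow (i + j)"
proof -
  interpret S: comm_monoid "ideals_set R" by (rule Q.ideals_set_is_comm_monoid)
  have IS: "I \<in> carrier (ideals_set R)" using I by (simp add: ideals_set_def)
  show "ipow 0 = carrier R" by (simp add: ipow_def) (simp add: ideals_set_def)
  show "ipow (Suc d) = ideal_prod R (ipow d) I" by (simp add: ipow_def) (simp add: ideals_set_def)
  show "ipow 1 = I" unfolding ipow_def by (rule S.nat_pow_eone[OF IS])
  show "ideal (ipow d) R" using S.nat_pow_closed[OF IS, of d] by (simp add: ipow_def ideals_set_def)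
  show "ideal_prod R (ipow i) (ipow j) = ipow (i + j)"
    using S.nat_pow_mult[OF IS, of i j] by (simp add: ipow_def ideals_set_def)
qed

definition epow :: "nat \<Rightarrow> 'a set" where "epow d = e ` ipow d"

lemma epow_ideal: "is_ideal A (epow d)"
  unfolding epow_def by (rule ideal_image[OF ipow_simps(4)])

lemma epow_0: "epow 0 = A" and epow_1: "epow 1 = e ` I"
  unfolding epow_def using ipow_simps by auto

lemma ipow_carrier: "x \<in> ipow d \<Longrightarrow> x \<in> carrier R"
  using ideal.Icarr[OF ipow_simps(4)] .

lemma epow_mult:
  assumes "x \<in> epow i" "y \<in> epow j" shows "x * y \<in> epow (i + j)"
proof -
  from assms obtain a b where ab: "a \<in> ipow i" "x = e a" "b \<in> ipow j" "y = e b" unfolding epow_def by auto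
  then have "a \<otimes> b \<in> ipow (i + j)" using ideal_prod.prod[of a "ipow i" b "ipow j" R] ipow_simps(5) by simp
  moreover have "x * y = e (a \<otimes> b)" using ab ipow_carrier by (simp add: hom)
  ultimately show ?thesis unfolding epow_def by blast
qed

lemma epow_preimage: "x \<in> carrier R \<Longrightarrow> e x \<in> epow d \<longleftrightarrow> x \<in> ipow d"
  unfolding epow_def using E_eq ipow_carrier by blast

definition rees_polys :: "'a poly set" where "rees_polys = {r. \<forall>d. Polynomial.coeff r d \<in> epow d}"

lemma rees_polys_subring: "is_subring rees_polys"
  unfolding is_subring_def rees_polys_def
proof safe
  fix d
  show "Polynomial.coeff 0 d \<in> epow d" using idealD(1)[OF epow_ideal] by simp
  show "Polynomial.coeff 1 d \<in> epow d"
    using idealD(1)[OF epow_ideal] subringD(2)[OF E_subring] epow_0 by (cases d) (auto simp: one_pCons coeff_pCons split: nat.splits)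
  fix r s assume r: "\<forall>d. Polynomial.coeff r d \<in> epow d"
  show "Polynomial.coeff (- r) d \<in> epow d" using r ideal_minus(1)[OF E_subring epow_ideal] by simp
  assume s: "\<forall>d. Polynomial.coeff s d \<in> epow d"
  show "Polynomial.coeff (r + s) d \<in> epow d" using r s idealD(3)[OF epow_ideal] by simp
  have "Polynomial.coeff r i * Polynomial.coeff s (d - i) \<in> epow d" if "i \<le> d" for i
    using epow_mult[of "Polynomial.coeff r i" i "Polynomial.coeff s (d - i)" "d - i"] r s that by simp
  then show "Polynomial.coeff (r * s) d \<in> epow d"
    unfolding Polynomial.coeff_mult by (intro ideal_sum[OF epow_ideal]) auto
qed

abbreviation "Rees \<equiv> rees_algebra R I"

definition rees_poly :: "(nat \<Rightarrow> 'b) \<Rightarrow> 'a poly" where "rees_poly p = Abs_poly (\<lambda>d. e (p d))"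

lemma carrier_Rees: "carrier Rees = {p \<in> up R. \<forall>d. p d \<in> ipow d}"
  unfolding rees_algebra_def ipow_def by (auto simp: UP_def)

lemma Rees_simps: "monoid.mult Rees = monoid.mult (UP R)" "monoid.one Rees = monoid.one (UP R)" "ring.zero Rees = ring.zero (UP R)"
   "ring.add Rees = ring.add (UP R)" "module.smult Rees = module.smult (UP R)"
  unfolding rees_algebra_def by auto

lemma up_eventually:
  assumes "p \<in> up R" shows "\<exists>n. \<forall>i>n. p i = \<zero>"
  using Q.bound_upD[OF assms] by (auto dest: bound.bound)

lemma coeff_rees_poly:
  assumes "p \<in> up R" shows "Polynomial.coeff (rees_poly p) d = e (p d)"
proof -
  obtain n where "\<And>i. n < i \<Longrightarrow> e (p i) = 0" using up_eventually[OF assms] hom(1) by metis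
  then show ?thesis unfolding rees_poly_def by (subst coeff_Abs_poly) auto
qed

lemma Rees_memI:
  assumes "\<And>d. p d \<in> carrier R" "\<And>d. e (p d) = Polynomial.coeff r d" "r \<in> rees_polys"
  shows "p \<in> carrier Rees \<and> rees_poly p = r"
proof -
  have "p d \<in> ipow d" for d using assms epow_preimage[OF assms(1)] unfolding rees_polys_def by auto
  moreover have "p \<in> up R"
  proof (rule mem_upI)
    have "bound \<zero> (Polynomial.degree r) p"
    proof
      fix m assume "Polynomial.degree r < m"
      then have "e (p m) = 0" using assms(2) by (simp add: coeff_eq_0)
      then show "p m = \<zero>" using E_eq_0[OF assms(1)] by simp
    qed
    then show "\<exists>n. bound \<zero> n p" by blast
  qed (rule assms)
  ultimately show ?thesis using assms(2) unfolding carrier_Rees by (auto intro!: poly_eqI simp: coeff_rees_poly)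
qed

lemma rees_poly_image: "rees_poly ` carrier Rees = rees_polys"
proof safe
  fix p assume "p \<in> carrier Rees"
  then show "rees_poly p \<in> rees_polys" unfolding rees_polys_def carrier_Rees by (auto simp: coeff_rees_poly epow_def)
next
  fix r assume r: "r \<in> rees_polys"
  define p where "p d = inv_into (carrier R) e (Polynomial.coeff r d)" for d
  have "Polynomial.coeff r d \<in> A" for d using r idealD(2)[OF epow_ideal] unfolding rees_polys_def by blast
  then have "p d \<in> carrier R" "e (p d) = Polynomial.coeff r d" for d
    unfolding p_def by (auto intro: inv_into_into f_inv_into_f)
  from Rees_memI[of p r, OF this r] show "r \<in> rees_poly ` carrier Rees" by blast
qed

lemma up_closed: "p \<in> up R \<Longrightarrow> p d \<in> carrier R"
  by (rule mem_upD)

lemma Rees_ops: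
  assumes p: "p \<in> carrier Rees" and q: "q \<in> carrier Rees"
  shows "p \<oplus>\<^bsub>Rees\<^esub> q \<in> carrier Rees \<and> rees_poly (p \<oplus>\<^bsub>Rees\<^esub> q) = rees_poly p + rees_poly q"
    and "p \<otimes>\<^bsub>Rees\<^esub> q \<in> carrier Rees \<and> rees_poly (p \<otimes>\<^bsub>Rees\<^esub> q) = rees_poly p * rees_poly q"
proof -
  note S = subringD[OF rees_polys_subring]
  have up: "p \<in> up R" "q \<in> up R" using p q unfolding carrier_Rees by auto
  have i: "rees_poly p \<in> rees_polys" "rees_poly q \<in> rees_polys" using p q rees_poly_image by blast+
  note c = up_closed[OF up(1)] up_closed[OF up(2)]
  have a: "p \<oplus>\<^bsub>Rees\<^esub> q = (\<lambda>i. p i \<oplus> q i)" using up by (simp add: Rees_simps UP_def)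
  have m: "p \<otimes>\<^bsub>Rees\<^esub> q = (\<lambda>n. \<Oplus>i\<in>{..n}. p i \<otimes> q (n - i))" using up by (simp add: Rees_simps UP_def)
  show "p \<oplus>\<^bsub>Rees\<^esub> q \<in> carrier Rees \<and> rees_poly (p \<oplus>\<^bsub>Rees\<^esub> q) = rees_poly p + rees_poly q"
    unfolding a by (rule Rees_memI) (auto simp: c hom coeff_rees_poly[OF up(1)] coeff_rees_poly[OF up(2)] intro: S i)
  show "p \<otimes>\<^bsub>Rees\<^esub> q \<in> carrier Rees \<and> rees_poly (p \<otimes>\<^bsub>Rees\<^esub> q) = rees_poly p * rees_poly q"
    unfolding m
  proof (rule Rees_memI)
    fix d
    show "(\<Oplus>i\<in>{..d}. p i \<otimes> q (d - i)) \<in> carrier R" by (rule Q.finsum_closed) (auto simp: c)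
    show "e (\<Oplus>i\<in>{..d}. p i \<otimes> q (d - i)) = Polynomial.coeff (rees_poly p * rees_poly q) d"
      by (subst E_finsum) (auto simp: c hom Polynomial.coeff_mult coeff_rees_poly[OF up(1)] coeff_rees_poly[OF up(2)])
  qed (intro S i)
qed

lemma Rees_consts:
  "\<zero>\<^bsub>Rees\<^esub> \<in> carrier Rees \<and> rees_poly \<zero>\<^bsub>Rees\<^esub> = 0" "\<one>\<^bsub>Rees\<^esub> \<in> carrier Rees \<and> rees_poly \<one>\<^bsub>Rees\<^esub> = 1"
proof -
  note S = subringD[OF rees_polys_subring]
  have z: "\<zero>\<^bsub>Rees\<^esub> = (\<lambda>i. \<zero>)" and o: "\<one>\<^bsub>Rees\<^esub> = (\<lambda>i. if i = 0 then \<one> else \<zero>)" by (simp_all add: Rees_simps UP_def)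
  show "\<zero>\<^bsub>Rees\<^esub> \<in> carrier Rees \<and> rees_poly \<zero>\<^bsub>Rees\<^esub> = 0"
    unfolding z by (rule Rees_memI) (auto simp: hom S)
  show "\<one>\<^bsub>Rees\<^esub> \<in> carrier Rees \<and> rees_poly \<one>\<^bsub>Rees\<^esub> = 1"
    unfolding o by (rule Rees_memI) (auto simp: hom S(2)[unfolded one_pCons] one_pCons coeff_pCons split: nat.splits)
qed

lemma Rees_smult:
  assumes a: "a \<in> carrier R" and p: "p \<in> carrier Rees"
  shows "a \<odot>\<^bsub>Rees\<^esub> p \<in> carrier Rees \<and> rees_poly (a \<odot>\<^bsub>Rees\<^esub> p) = [:e a:] * rees_poly p"
proof -
  have up: "p \<in> up R" using p unfolding carrier_Rees by auto
  have s: "a \<odot>\<^bsub>Rees\<^esub> p = (\<lambda>i. a \<otimes> p i)" using up a by (simp add: Rees_simps UP_def)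
  have i: "rees_poly p \<in> rees_polys" using p rees_poly_image by blast
  have "[:e a:] \<in> rees_polys" unfolding rees_polys_def
    using a idealD(1)[OF epow_ideal] epow_0 by (auto simp: coeff_pCons split: nat.splits)
  then show ?thesis unfolding s
    by (intro Rees_memI) (auto simp: a hom up_closed[OF up] coeff_rees_poly[OF up] intro: subringD(4)[OF rees_polys_subring _ i, of "[:e a:]", simplified])
qed

lemma Rees_emb: "ring_emb Rees rees_poly"
proof
  show "inj_on rees_poly (carrier Rees)"
  proof (rule inj_onI, rule ext)
    fix p q d assume p: "p \<in> carrier Rees" and q: "q \<in> carrier Rees" and "rees_poly p = rees_poly q"
    have up: "p \<in> up R" "q \<in> up R" using p q unfolding carrier_Rees by auto
    have "e (p d) = e (q d)" using coeff_rees_poly[OF up(1)] coeff_rees_poly[OF up(2)] \<open>rees_poly p = rees_poly q\<close> by metis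
    then show "p d = q d" using E_eq[OF up_closed[OF up(1)] up_closed[OF up(2)]] by blast
  qed
  show "\<exists>q\<in>carrier Rees. rees_poly q = - rees_poly p" if p: "p \<in> carrier Rees" for p
  proof -
    have "- rees_poly p \<in> rees_polys" using p rees_poly_image by (intro subringD(5)[OF rees_polys_subring]) blast
    then show ?thesis using rees_poly_image by (metis (no_types, lifting) image_iff)
  qed
qed (use Rees_consts Rees_ops in auto)

lemma rees_poly_monom:
  assumes "a \<in> I"
  shows "up_ring.monom (UP R) a 1 \<in> carrier Rees \<and> rees_poly (up_ring.monom (UP R) a 1) = [:0, e a:]"
proof -
  have a: "a \<in> carrier R" using ideal.Icarr[OF I assms] .
  have m: "up_ring.monom (UP R) a 1 = (\<lambda>i. if i = 1 then a else \<zero>)" using a by (simp add: UP_def)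
  have "[:0, e a:] \<in> rees_polys" unfolding rees_polys_def
    using assms epow_1 idealD(1)[OF epow_ideal] by (auto simp: coeff_pCons split: nat.splits)
  then show ?thesis unfolding m by (intro Rees_memI) (auto simp: a hom closed coeff_pCons split: nat.splits)
qed

lemma rees_component_1: "rees_component R I 1 = (\<lambda>a. up_ring.monom (UP R) a 1) ` I"
  unfolding rees_component_def using ipow_simps(3) unfolding ipow_def by simp

lemma rees_poly_poly_eval:
  assumes fs: "\<And>i. i < length fs \<Longrightarrow> fs ! i \<in> carrier Rees \<and> rees_poly (fs ! i) = [:0, f i:]"
    and p: "p \<in> carrier (poly_ring R (length fs))"
  shows "poly_eval R Rees fs p \<in> carrier Rees \<and> 
    rees_poly (poly_eval R Rees fs p) = rees_eval f (emb_poly e p)"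
proof -
  interpret M: ring_emb Rees rees_poly by (rule Rees_emb)
  let ?m = "length fs"
  have pc: "p a \<in> carrier R" for a using p unfolding poly_ring_def by auto
  have pow: "fs ! i [^]\<^bsub>Rees\<^esub> (k::nat) \<in> carrier Rees" if "i < ?m" for i k using fs[OF that] by simp
  have pr: "(\<Otimes>\<^bsub>Rees\<^esub>i \<in> {..<?m}. (fs ! i) [^]\<^bsub>Rees\<^esub> count a i) \<in> carrier Rees" for a
    using pow by (intro M.Q.finprod_closed) auto
  have epr: "rees_poly (\<Otimes>\<^bsub>Rees\<^esub>i \<in> {..<?m}. (fs ! i) [^]\<^bsub>Rees\<^esub> count a i) = prod_mset (image_mset (\<lambda>i. [:0, f i:]) a)"
    if a: "a \<in> mons {..<?m}" for a
  proof -
    have "rees_poly (\<Otimes>\<^bsub>Rees\<^esub>i \<in> {..<?m}. (fs ! i) [^]\<^bsub>Rees\<^esub> count a i) = (\<Prod>i\<in>{..<?m}. rees_poly ((fs ! i) [^]\<^bsub>Rees\<^esub> count a i))"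
      using pow by (intro M.E_finprod) auto
    also have "\<dots> = (\<Prod>i\<in>{..<?m}. [:0, f i:] ^ count a i)"
      using fs by (intro prod.cong) (auto simp: M.E_pow)
    also have "\<dots> = (\<Prod>i\<in>set_mset a. [:0, f i:] ^ count a i)"
      using a by (intro prod.mono_neutral_right) (auto simp: mons_def not_in_iff)
    finally show ?thesis by (simp add: image_prod_mset_multiplicity)
  qed
  have t: "p a \<odot>\<^bsub>Rees\<^esub> (\<Otimes>\<^bsub>Rees\<^esub>i \<in> {..<?m}. (fs ! i) [^]\<^bsub>Rees\<^esub> count a i) \<in> carrier Rees" for a
    using Rees_smult[OF pc pr] by simp
  have "rees_poly (poly_eval R Rees fs p) = (\<Sum>a\<in>{a. p a \<noteq> \<zero>}. rees_poly (p a \<odot>\<^bsub>Rees\<^esub> (\<Otimes>\<^bsub>Rees\<^esub>i \<in> {..<?m}. (fs ! i) [^]\<^bsub>Rees\<^esub> count a i)))"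
    unfolding poly_eval_def by (rule M.E_finsum[OF t])
  also have "\<dots> = (\<Sum>a\<in>{a. p a \<noteq> \<zero>}. [:e (p a):] * prod_mset (image_mset (\<lambda>i. [:0, f i:]) a))"
  proof (rule sum.cong[OF refl])
    fix a assume "a \<in> {a. p a \<noteq> \<zero>}"
    then have "a \<in> mons {..<?m}" using p unfolding poly_ring_def monomials_eq by auto
    from epr[OF this] Rees_smult[OF pc pr, of a a]
    show "rees_poly (p a \<odot>\<^bsub>Rees\<^esub> (\<Otimes>\<^bsub>Rees\<^esub>i \<in> {..<?m}. (fs ! i) [^]\<^bsub>Rees\<^esub> count a i))
      = [:e (p a):] * prod_mset (image_mset (\<lambda>i. [:0, f i:]) a)" by simp
  qed
  also have "\<dots> = rees_eval f (emb_poly e p)"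
    unfolding peval_def keys_emb_poly[OF p] lookup_emb_poly[OF p] ..
  finally have "rees_poly (poly_eval R Rees fs p) = rees_eval f (emb_poly e p)" .
  moreover have "poly_eval R Rees fs p \<in> carrier Rees"
    unfolding poly_eval_def using t by (intro M.Q.finsum_closed) auto
  ultimately show ?thesis by simp
qed

lemma generated_iff:
  assumes fs: "\<And>i. i < length fs \<Longrightarrow> fs ! i \<in> carrier Rees \<and> rees_poly (fs ! i) = [:0, f i:]"
  shows "relations_generated_upto R Rees fs l = relations R Rees fs \<longleftrightarrow> rt_le A {..<length fs} f l"
proof -
  let ?W = "poly_ring R (length fs)" and ?N = "{..<length fs}"
  interpret M: ring_emb Rees rees_poly by (rule Rees_emb)
  interpret W: ring_emb ?W "emb_poly e" by (rule poly_ring_emb)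
  have im: "emb_poly e ` carrier ?W = polys A (mons ?N)" by (rule emb_poly_image)
  have rel: "p \<in> relations R Rees fs \<longleftrightarrow> emb_poly e p \<in> Rel A ?N f" if p: "p \<in> carrier ?W" for p
  proof -
    have "emb_poly e p \<in> polys A (mons ?N)" using p im by blast
    then show ?thesis
      using rees_poly_poly_eval[OF fs p] p M.E_eq_0[of "poly_eval R Rees fs p"] unfolding relations_def Rel_def by simp
  qed
  have sub: "relations R Rees fs \<subseteq> carrier ?W" unfolding relations_def by auto
  have imR: "emb_poly e ` relations R Rees fs = Rel A ?N f"
  proof
    show "emb_poly e ` relations R Rees fs \<subseteq> Rel A ?N f" using rel sub by blast
    show "Rel A ?N f \<subseteq> emb_poly e ` relations R Rees fs"
    proof
      fix r assume r: "r \<in> Rel A ?N f"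
      then have "r \<in> emb_poly e ` carrier ?W" unfolding im Rel_def by simp
      then obtain p where p: "p \<in> carrier ?W" "r = emb_poly e p" by blast
      then show "r \<in> emb_poly e ` relations R Rees fs" using rel[OF p(1)] r by blast
    qed
  qed
  have deg: "(\<forall>a. p a \<noteq> \<zero> \<longrightarrow> size a \<le> l) \<longleftrightarrow> deg_le l (emb_poly e p)" if p: "p \<in> carrier ?W" for p
  proof -
    have "lookup (emb_poly e p) a \<noteq> 0 \<longleftrightarrow> p a \<noteq> \<zero>" for a
      using keys_emb_poly[OF p] by (metis in_keys_iff mem_Collect_eq)
    then show ?thesis unfolding deg_le_def by simp
  qed
  let ?X = "{p \<in> relations R Rees fs. \<forall>a. p a \<noteq> \<zero> \<longrightarrow> size a \<le> l}"
  have X: "emb_poly e ` ?X = {r \<in> Rel A ?N f. deg_le l r}"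
  proof
    show "emb_poly e ` ?X \<subseteq> {r \<in> Rel A ?N f. deg_le l r}"
    proof
      fix r assume "r \<in> emb_poly e ` ?X"
      then obtain p where p: "p \<in> ?X" "r = emb_poly e p" by blast
      then have "p \<in> carrier ?W" using sub by blast
      then show "r \<in> {r \<in> Rel A ?N f. deg_le l r}" using p rel[of p] deg[of p] by simp
    qed
    show "{r \<in> Rel A ?N f. deg_le l r} \<subseteq> emb_poly e ` ?X"
    proof
      fix r assume r: "r \<in> {r \<in> Rel A ?N f. deg_le l r}"
      then have "r \<in> emb_poly e ` relations R Rees fs" using imR by simp
      then obtain p where p: "p \<in> relations R Rees fs" "r = emb_poly e p" by blast
      then have "p \<in> carrier ?W" using sub by blast
      then have "p \<in> ?X" using p r deg[of p] by simp
      then show "r \<in> emb_poly e ` ?X" using p(2) by blast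
    qed
  qed
  have Xc: "?X \<subseteq> carrier ?W" using sub by auto
  have rg: "relations_generated_upto R Rees fs l = genideal ?W ?X"
    unfolding relations_generated_upto_def by (rule refl)
  have g: "emb_poly e ` relations_generated_upto R Rees fs l = low_gen A ?N f l"
  proof -
    have "emb_poly e ` genideal ?W ?X = gen_ideal (emb_poly e ` carrier ?W) (emb_poly e ` ?X)"
      by (rule W.genideal_image[OF Xc])
    also have "\<dots> = low_gen A ?N f l"
      unfolding low_gen_def by (rule arg_cong2[OF im X])
    finally show ?thesis unfolding rg .
  qed
  have gc: "relations_generated_upto R Rees fs l \<subseteq> carrier ?W"
    unfolding rg by (rule subsetI) (rule ideal.Icarr[OF W.Q.genideal_ideal[OF Xc]])
  have "emb_poly e ` relations_generated_upto R Rees fs l = emb_poly e ` relations R Rees fs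
      \<longleftrightarrow> relations_generated_upto R Rees fs l = relations R Rees fs"
    by (rule inj_on_image_eq_iff[OF W.inj gc sub])
  then have "relations_generated_upto R Rees fs l = relations R Rees fs \<longleftrightarrow> low_gen A ?N f l = Rel A ?N f"
    unfolding g imR by (rule sym)
  also have "\<dots> \<longleftrightarrow> rt_le A ?N f l"
    using low_gen_subset[OF E_subring, of ?N f l] unfolding rt_le_def by (metis subset_antisym subset_refl)
  finally show ?thesis .
qed

text \<open>
  The elements \<open>f\<^sub>i t\<close> generate the Rees algebra iff the \<open>f\<^sub>i\<close> generate \<open>I\<close>: one direction compares coefficients
  of \<open>t\<close>, the other holds because \<open>I\<^sup>d\<close> is spanned by \<open>d\<close>-fold products of elements of \<open>I\<close>.
\<close>

lemma generators_iff:
  assumes fs: "\<And>i. i < length fs \<Longrightarrow> fs ! i \<in> carrier Rees \<and> rees_poly (fs ! i) = [:0, f i:]"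
    and fI: "f ` {..<length fs} \<subseteq> e ` I"
  shows "poly_eval R Rees fs ` carrier (poly_ring R (length fs)) = carrier Rees \<longleftrightarrow> gen_ideal A (f ` {..<length fs}) = e ` I"
proof -
  let ?W = "poly_ring R (length fs)" and ?N = "{..<length fs}"
  interpret M: ring_emb Rees rees_poly by (rule Rees_emb)
  let ?ev = "rees_eval f"
  have fA: "f ` ?N \<subseteq> A" using fI ideal.Icarr[OF I] by blast
  have eI: "is_ideal A (e ` I)" by (rule ideal_image[OF I])
  have sub: "poly_eval R Rees fs ` carrier ?W \<subseteq> carrier Rees" using rees_poly_poly_eval[OF fs] by blast
  have "rees_poly ` poly_eval R Rees fs ` carrier ?W = ?ev ` emb_poly e ` carrier ?W"
    using rees_poly_poly_eval[OF fs] by (force simp: image_image)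
  then have im: "rees_poly ` poly_eval R Rees fs ` carrier ?W = ?ev ` polys A (mons ?N)" by (simp only: emb_poly_image)
  have iff: "poly_eval R Rees fs ` carrier ?W = carrier Rees \<longleftrightarrow> ?ev ` polys A (mons ?N) = rees_polys"
    unfolding im[symmetric] rees_poly_image[symmetric] by (rule inj_on_image_eq_iff[OF M.inj sub subset_refl, symmetric])
  have evsub: "?ev ` polys A (mons ?N) \<subseteq> rees_polys" unfolding im[symmetric] rees_poly_image[symmetric] using sub by blast
  have c1: "Polynomial.coeff (?ev p) 1 \<in> gen_ideal A (f ` ?N)" if "p \<in> polys A (mons ?N)" for p
    using E_subring that
  proof (induction p rule: polys_induct)
    case zero
    then show ?case by (simp add: gen_ideal.zero)
  next
    case (add a c p)
    have "Polynomial.coeff (?ev (single a c)) 1 \<in> gen_ideal A (f ` ?N)"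
    proof (cases "size a = 1")
      case True
      then obtain i where i: "a = {#i#}" using size_1_singleton_mset by auto
      then have "f i \<in> gen_ideal A (f ` ?N)" using add(1) gen_ideal_in[OF E_subring] by auto
      from gen_ideal_mult[OF E_subring add(2) this] show ?thesis by (simp add: peval_single i mult.commute)
    next
      case False
      then show ?thesis by (simp add: peval_single prod_mset_linear smult_monom gen_ideal.zero)
    qed
    then show ?case using add
      by (subst peval_add[OF E_subring hom_pCons polys_single[OF E_subring add(1,2)] add(3)]) (simp add: gen_ideal_add)
  qed
  have "?ev ` polys A (mons ?N) = rees_polys \<longleftrightarrow> gen_ideal A (f ` ?N) = e ` I"
  proof
    assume eq: "?ev ` polys A (mons ?N) = rees_polys"
    show "gen_ideal A (f ` ?N) = e ` I"
    proof
      show "gen_ideal A (f ` ?N) \<subseteq> e ` I" by (rule gen_ideal_least[OF eI fI])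
      show "e ` I \<subseteq> gen_ideal A (f ` ?N)"
      proof
        fix b assume "b \<in> e ` I"
        then have "[:0, b:] \<in> rees_polys" unfolding rees_polys_def using epow_1 idealD(1)[OF epow_ideal] by (auto simp: coeff_pCons split: nat.splits)
        then obtain p where p: "p \<in> polys A (mons ?N)" "[:0, b:] = ?ev p" using eq by blast
        then show "b \<in> gen_ideal A (f ` ?N)" using c1[OF p(1)] by (simp add: p(2)[symmetric])
      qed
    qed
  next
    assume eq: "gen_ideal A (f ` ?N) = e ` I"
    let ?Im = "?ev ` polys A (mons ?N)"
    have ImS: "is_subring ?Im" unfolding is_subring_def
    proof safe
      note h = homD[OF peval_hom[OF E_subring hom_pCons] polys_subring[OF E_subring]]
      note s = subringD[OF polys_subring[OF E_subring, of ?N]]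
      show "0 \<in> ?Im" "1 \<in> ?Im" using h(1,2) s(1,2) by (metis image_eqI)+
      fix p q assume "p \<in> polys A (mons ?N)" "q \<in> polys A (mons ?N)"
      then show "?ev p + ?ev q \<in> ?Im" "?ev p * ?ev q \<in> ?Im" "- ?ev p \<in> ?Im"
        using h(3-5) s(3-5) by (metis (no_types, lifting) image_eqI)+
    qed
    have "Polynomial.monom (e b) d \<in> ?Im" if "b \<in> ipow d" for b d
      using that
    proof (induction d arbitrary: b)
      case 0
      then have "e b \<in> A" using ipow_carrier by blast
      then have "single {#} (e b) \<in> polys A (mons ?N)" by (intro polys_single[OF E_subring]) simp_all
      then have "?ev (single {#} (e b)) \<in> ?Im" by (rule imageI)
      then show ?case by (simp add: peval_single monom_0)
    next
      case (Suc d)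
      then have "b \<in> ideal_prod R (ipow d) I" using ipow_simps(2) by simp
      then show ?case
      proof (induction b rule: ideal_prod.induct)
        case (prod u w)
        have uc: "u \<in> carrier R" "w \<in> carrier R" using prod ipow_carrier ideal.Icarr[OF I] by auto
        have "e w \<in> gen_ideal A (f ` ?N)" using eq prod by blast
        from linear_form[OF E_subring this] obtain L where "L \<in> polys A (mons ?N)" "?ev L = [:0, e w:]" by blast
        then have "[:0, e w:] \<in> ?Im" by (metis imageI)
        then have "Polynomial.monom (e u) d * [:0, e w:] \<in> ?Im"
          using Suc.IH[OF prod(1)] by (intro subringD(4)[OF ImS])
        moreover have "Polynomial.monom (e u) d * [:0, e w:] = Polynomial.monom (e (u \<otimes> w)) (Suc d)"
          using mult_monom[of "e u" d "e w" 1] by (simp add: hom uc monom_Suc monom_0)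
        ultimately show ?case by simp
      next
        case (sum s1 s2)
        have "s1 \<in> carrier R" "s2 \<in> carrier R"
          using sum Q.ideal_prod_in_carrier[OF ipow_simps(4) I] by blast+
        then show ?case using subringD(3)[OF ImS sum(3,4)] by (simp add: hom add_monom)
      qed
    qed
    then have mon: "Polynomial.monom x d \<in> ?Im" if "x \<in> epow d" for x d using that unfolding epow_def by auto
    have "rees_polys \<subseteq> ?Im"
    proof
      fix r assume r: "r \<in> rees_polys"
      have "(\<Sum>i\<le>Polynomial.degree r. Polynomial.monom (Polynomial.coeff r i) i) \<in> ?Im"
        by (rule subring_sum[OF ImS]) (use mon r in \<open>auto simp: rees_polys_def\<close>)
      then show "r \<in> ?Im" by (simp add: poly_as_sum_of_monoms)
    qed
    then show "?Im = rees_polys" using evsub by blast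
  qed
  then show ?thesis using iff by simp
qed

text \<open>
  The homogeneous generators of degree one are exactly the \<open>f\<^sub>i t\<close> with \<open>f\<^sub>i \<in> I\<close>, so the infimum over all systems
  of generators and degree bounds ranges over the \<open>l\<close> with \<open>ideal_rt_le\<close>.
\<close>

theorem ideal_relation_type_eq:
  "ideal_relation_type R I = (INF l\<in>{l. 1 \<le> l \<and> ideal_rt_le A (e ` I) l}. enat l)"
proof -
  let ?SG = "{fs. standard_generators R Rees (rees_component R I) fs}"
  let ?L = "\<lambda>fs. {l. 1 \<le> l \<and> relations_generated_upto R Rees fs l = relations R Rees fs}"
  have "(\<Union>fs\<in>?SG. ?L fs) = {l. 1 \<le> l \<and> ideal_rt_le A (e ` I) l}"
  proof safe
    fix fs and l :: nat
    assume sg: "standard_generators R Rees (rees_component R I) fs" and gen: "relations_generated_upto R Rees fs l = relations R Rees fs"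
    have "\<exists>a\<in>I. fs ! i = up_ring.monom (UP R) a 1" if "i < length fs" for i
      using sg that unfolding standard_generators_def rees_component_1 by (metis (no_types, lifting) image_iff nth_mem subsetD)
    then have "\<forall>i\<in>{..<length fs}. \<exists>a. a \<in> I \<and> fs ! i = up_ring.monom (UP R) a 1" by blast
    from bchoice[OF this] obtain a where a: "\<And>i. i < length fs \<Longrightarrow> a i \<in> I" "\<And>i. i < length fs \<Longrightarrow> fs ! i = up_ring.monom (UP R) (a i) 1" by auto
    define f where "f i = e (a i)" for i
    have fs: "fs ! i \<in> carrier Rees \<and> rees_poly (fs ! i) = [:0, f i:]" if "i < length fs" for i
      using rees_poly_monom[OF a(1)[OF that]] a(2)[OF that] by (simp add: f_def)
    have fI: "f ` {..<length fs} \<subseteq> e ` I" using a(1) by (auto simp: f_def)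
    have "gen_ideal A (f ` {..<length fs}) = e ` I"
      using sg generators_iff[OF fs fI] unfolding standard_generators_def by blast
    moreover have "rt_le A {..<length fs} f l" using gen generated_iff[OF fs] by blast
    moreover have "f ` {..<length fs} \<subseteq> A" using fI ideal.Icarr[OF I] by blast
    ultimately show "ideal_rt_le A (e ` I) l" unfolding ideal_rt_le_def by blast
  next
    fix l :: nat assume l: "1 \<le> l" and "ideal_rt_le A (e ` I) l"
    then obtain m f where f: "f ` {..<m::nat} \<subseteq> A" "gen_ideal A (f ` {..<m}) = e ` I" "rt_le A {..<m} f l"
      unfolding ideal_rt_le_def by blast
    have fI: "f i \<in> e ` I" if "i < m" for i using f(2) gen_ideal_in[OF E_subring, of "f i" "f ` {..<m}"] that by auto
    then have "\<forall>i\<in>{..<m}. \<exists>a. a \<in> I \<and> f i = e a" by blast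
    from bchoice[OF this] obtain a where a: "\<And>i. i < m \<Longrightarrow> a i \<in> I" "\<And>i. i < m \<Longrightarrow> f i = e (a i)" by auto
    define fs where "fs = map (\<lambda>i. up_ring.monom (UP R) (a i) 1) [0..<m]"
    have len: "length fs = m" unfolding fs_def by simp
    have fs: "fs ! i \<in> carrier Rees \<and> rees_poly (fs ! i) = [:0, f i:]" if "i < length fs" for i
      using that rees_poly_monom[OF a(1)[of i]] a(2)[of i] by (simp add: fs_def)
    have "set fs \<subseteq> rees_component R I 1" unfolding rees_component_1 fs_def using a(1) by auto
    moreover have "poly_eval R Rees fs ` carrier (poly_ring R (length fs)) = carrier Rees"
      using generators_iff[OF fs] fI f(2) len by auto
    ultimately have "standard_generators R Rees (rees_component R I) fs" unfolding standard_generators_def by blast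
    moreover have "relations_generated_upto R Rees fs l = relations R Rees fs"
      using generated_iff[OF fs] f(3) len by simp
    ultimately show "l \<in> (\<Union>fs\<in>?SG. ?L fs)" using l by blast
  qed
  moreover have "ideal_relation_type R I = (INF l\<in>(\<Union>fs\<in>?SG. ?L fs). enat l)"
    unfolding ideal_relation_type_def relation_type_def relation_type_wrt_def 
  proof (rule antisym)
    show "(INF fs\<in>?SG. INF l\<in>?L fs. enat l) \<le> (INF l\<in>(\<Union>fs\<in>?SG. ?L fs). enat l)"
    proof (rule INF_greatest)
      fix l assume "l \<in> (\<Union>fs\<in>?SG. ?L fs)"
      then obtain fs where fs: "fs \<in> ?SG" "l \<in> ?L fs" by blast
      show "(INF fs\<in>?SG. INF l\<in>?L fs. enat l) \<le> enat l"
        by (rule INF_lower2[OF fs(1)]) (rule INF_lower[OF fs(2)])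
    qed
    show "(INF l\<in>(\<Union>fs\<in>?SG. ?L fs). enat l) \<le> (INF fs\<in>?SG. INF l\<in>?L fs. enat l)"
      by (intro INF_greatest INF_lower) blast
  qed
  ultimately show ?thesis by simp
qed

end

section \<open>Renaming variables\<close>

text \<open>
  The substitution of variables \<open>x\<^sub>i \<mapsto> x\<^bsub>\<sigma> i\<^esub>\<close>. It makes the variables of the two rings disjoint.
\<close>

definition relabel :: "(nat \<Rightarrow> nat) \<Rightarrow> 'k::field mps \<Rightarrow> 'k mps" where
  "relabel \<sigma> f = Mps (\<lambda>b. if b \<in> range (image_mset \<sigma>) then cf f (inv_into UNIV (image_mset \<sigma>) b) else 0)"

lemma cf_relabel:
  assumes "inj \<sigma>"
  shows "cf (relabel \<sigma> f) (image_mset \<sigma> a) = cf f a" "b \<notin> range (image_mset \<sigma>) \<Longrightarrow> cf (relabel \<sigma> f) b = 0"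
  unfolding relabel_def using inv_f_f[OF multiset.inj_map[OF assms]] by auto

lemma relabel_eqI:
  assumes "inj \<sigma>" "\<And>a. cf g (image_mset \<sigma> a) = cf f a" "\<And>b. b \<notin> range (image_mset \<sigma>) \<Longrightarrow> cf g b = 0"
  shows "relabel \<sigma> f = g"
proof (rule mps_eqI)
  fix b show "cf (relabel \<sigma> f) b = cf g b"
  proof (cases "b \<in> range (image_mset \<sigma>)")
    case True
    then obtain a where "b = image_mset \<sigma> a" by blast
    then show ?thesis using cf_relabel(1)[OF assms(1), of f a] assms(2)[of a] by simp
  next
    case False
    then show ?thesis using cf_relabel(2)[OF assms(1)] assms(3) by metis
  qed
qed

lemma splits_image:
  assumes "inj \<sigma>"
  shows "splits (image_mset \<sigma> c) = (\<lambda>(a, b). (image_mset \<sigma> a, image_mset \<sigma> b)) ` splits c"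
proof
  show "splits (image_mset \<sigma> c) \<subseteq> (\<lambda>(a, b). (image_mset \<sigma> a, image_mset \<sigma> b)) ` splits c"
  proof
    fix x assume x: "x \<in> splits (image_mset \<sigma> c)"
    obtain a b where ab: "x = (a, b)" by force
    then have "image_mset \<sigma> c = a + b" using x by (simp add: splits_def)
    from image_mset_eq_plusD[OF this] obtain a' b' where "c = a' + b'" "a = image_mset \<sigma> a'" "b = image_mset \<sigma> b'" by blast
    then show "x \<in> (\<lambda>(a, b). (image_mset \<sigma> a, image_mset \<sigma> b)) ` splits c"
      using ab by (intro image_eqI[of _ _ "(a', b')"]) (auto simp: splits_def)
  qed
qed (auto simp: splits_def)

lemma relabel_hom:
  assumes \<sigma>: "inj \<sigma>"
  shows "relabel \<sigma> 0 = 0" "relabel \<sigma> 1 = 1" "relabel \<sigma> (f + g) = relabel \<sigma> f + relabel \<sigma> g"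
    "relabel \<sigma> (- f) = - relabel \<sigma> f" "relabel \<sigma> (f * g) = relabel \<sigma> f * relabel \<sigma> g"
    "relabel \<sigma> (mterm {#} c) = mterm {#} c" "relabel \<sigma> f = relabel \<sigma> g \<longleftrightarrow> f = g"
proof -
  note cr = cf_relabel[OF \<sigma>]
  show "relabel \<sigma> 0 = 0" by (rule relabel_eqI[OF \<sigma>]) auto
  show "relabel \<sigma> 1 = 1" by (rule relabel_eqI[OF \<sigma>]) (auto simp: image_iff)
  show "relabel \<sigma> (mterm {#} c) = mterm {#} c" by (rule relabel_eqI[OF \<sigma>]) (auto simp: image_iff)
  show "relabel \<sigma> (f + g) = relabel \<sigma> f + relabel \<sigma> g" by (rule relabel_eqI[OF \<sigma>]) (auto simp: cr)
  show "relabel \<sigma> (- f) = - relabel \<sigma> f" by (rule relabel_eqI[OF \<sigma>]) (auto simp: cr)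
  show "relabel \<sigma> (f * g) = relabel \<sigma> f * relabel \<sigma> g"
  proof (rule relabel_eqI[OF \<sigma>])
    fix c
    have inj: "inj_on (\<lambda>(a, b). (image_mset \<sigma> a, image_mset \<sigma> b)) (splits c)"
      using injD[OF multiset.inj_map[OF \<sigma>]] by (auto simp: inj_on_def)
    show "cf (relabel \<sigma> f * relabel \<sigma> g) (image_mset \<sigma> c) = cf (f * g) c"
      unfolding cf_mult splits_image[OF \<sigma>] by (subst sum.reindex[OF inj]) (auto simp: cr case_prod_beta)
  next
    fix c assume c: "c \<notin> range (image_mset \<sigma>)"
    have "cf (relabel \<sigma> f) a * cf (relabel \<sigma> g) b = 0" if "(a, b) \<in> splits c" for a b
    proof (cases "a \<in> range (image_mset \<sigma>) \<and> b \<in> range (image_mset \<sigma>)")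
      case True
      then obtain a' b' where "a = image_mset \<sigma> a'" "b = image_mset \<sigma> b'" by blast
      then have "c = image_mset \<sigma> (a' + b')" using that by (simp add: splits_def)
      then show ?thesis using c by blast
    next
      case False
      then show ?thesis using cr(2) by (metis mult_zero_left mult_zero_right)
    qed
    then show "cf (relabel \<sigma> f * relabel \<sigma> g) c = 0" unfolding cf_mult by (auto intro!: sum.neutral)
  qed
  show "relabel \<sigma> f = relabel \<sigma> g \<longleftrightarrow> f = g" using cr(1) by (metis mps_eqI)
qed

context valued_field
begin

lemma rpow_image: "rpow r (image_mset \<sigma> a) = rpow (\<lambda>i. r (\<sigma> i)) a"
  by (simp add: rpow_def image_mset.compositionality comp_def)

lemma relabel_conv:
  assumes \<sigma>: "inj \<sigma>"
  shows "relabel \<sigma> ` conv V = conv (\<sigma> ` V)"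
proof
  note cr = cf_relabel[OF \<sigma>]
  note injm = multiset.inj_map[OF \<sigma>]
  have mons: "image_mset \<sigma> a \<in> mons (\<sigma> ` V) \<longleftrightarrow> a \<in> mons V" for a
    by (simp add: mons_def inj_image_subset_iff[OF \<sigma>])
  show "relabel \<sigma> ` conv V \<subseteq> conv (\<sigma> ` V)"
  proof
    fix g assume "g \<in> relabel \<sigma> ` conv V"
    then obtain f r C where g: "g = relabel \<sigma> f" and f: "supp V f" and r: "\<And>i. 0 < r i" and C: "bdd r f C"
      unfolding conv_def by auto
    define s where "s j = (if j \<in> range \<sigma> then r (inv_into UNIV \<sigma> j) else 1)" for j
    have s: "0 < s j" for j using r by (simp add: s_def)
    have "s (\<sigma> i) = r i" for i using \<sigma> by (simp add: s_def)
    then have sp: "rpow s (image_mset \<sigma> a) = rpow r a" for a by (simp add: rpow_image)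
    have "bdd s g C" unfolding bdd_def
    proof (intro allI impI)
      fix F :: "nat multiset set" assume F: "finite F"
      let ?G = "(image_mset \<sigma>) -` F"
      have G: "finite ?G" by (rule finite_vimageI[OF F injm])
      have "(\<Sum>b\<in>F. v (cf g b) * rpow s b) = (\<Sum>b\<in>image_mset \<sigma> ` ?G. v (cf g b) * rpow s b)"
      proof (rule sum.mono_neutral_right[OF F])
        show "\<forall>b\<in>F - image_mset \<sigma> ` ?G. v (cf g b) * rpow s b = 0"
        proof
          fix b assume "b \<in> F - image_mset \<sigma> ` ?G"
          then have "b \<notin> range (image_mset \<sigma>)" by auto
          from cr(2)[OF this, of f] show "v (cf g b) * rpow s b = 0" by (simp add: g)
        qed
      qed auto
      also have "\<dots> = (\<Sum>a\<in>?G. v (cf f a) * rpow r a)"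
        by (subst sum.reindex) (auto simp: g cr sp intro: inj_on_subset[OF injm])
      also have "\<dots> \<le> C" by (rule bddD[OF C G])
      finally show "(\<Sum>b\<in>F. v (cf g b) * rpow s b) \<le> C" .
    qed
    moreover have "supp (\<sigma> ` V) g" unfolding supp_def
    proof (intro allI impI)
      fix b assume b: "cf g b \<noteq> 0"
      then obtain a where a: "b = image_mset \<sigma> a" using cr(2) g by blast
      then show "b \<in> mons (\<sigma> ` V)" using b f mons g cr(1) unfolding supp_def by metis
    qed
    ultimately show "g \<in> conv (\<sigma> ` V)" unfolding conv_def using s by blast
  qed
  show "conv (\<sigma> ` V) \<subseteq> relabel \<sigma> ` conv V"
  proof
    fix g assume "g \<in> conv (\<sigma> ` V)"
    then obtain r C where g: "supp (\<sigma> ` V) g" and r: "\<And>i. 0 < r i" and C: "bdd r g C"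
      unfolding conv_def by auto
    define f where "f = Mps (\<lambda>a. cf g (image_mset \<sigma> a))"
    have "relabel \<sigma> f = g"
    proof (rule relabel_eqI[OF \<sigma>])
      fix b assume b: "b \<notin> range (image_mset \<sigma>)"
      have "b \<in> range (image_mset \<sigma>)" if "b \<in> mons (\<sigma> ` V)"
      proof -
        have "image_mset \<sigma> (image_mset (inv_into UNIV \<sigma>) b) = b"
          using that by (auto simp: mons_def image_mset.compositionality comp_def f_inv_into_f intro!: image_mset_cong[of b _ id, simplified])
        then show ?thesis by (metis rangeI)
      qed
      then show "cf g b = 0" using b g unfolding supp_def by blast
    qed (simp add: f_def)
    moreover have "f \<in> conv V"
    proof -
      have "bdd (\<lambda>i. r (\<sigma> i)) f C" unfolding bdd_def
      proof (intro allI impI)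
        fix F :: "nat multiset set" assume F: "finite F"
        have "(\<Sum>b\<in>image_mset \<sigma> ` F. v (cf g b) * rpow r b) = (\<Sum>a\<in>F. v (cf f a) * rpow (\<lambda>i. r (\<sigma> i)) a)"
          by (subst sum.reindex[OF inj_on_subset[OF injm subset_UNIV]]) (simp add: f_def rpow_image)
        moreover have "(\<Sum>b\<in>image_mset \<sigma> ` F. v (cf g b) * rpow r b) \<le> C"
          using F by (intro bddD[OF C]) simp
        ultimately show "(\<Sum>a\<in>F. v (cf f a) * rpow (\<lambda>i. r (\<sigma> i)) a) \<le> C" by simp
      qed
      moreover have "supp V f" unfolding supp_def
      proof (intro allI impI)
        fix a assume "cf f a \<noteq> 0"
        then have "cf g (image_mset \<sigma> a) \<noteq> 0" by (simp add: f_def)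
        then have "image_mset \<sigma> a \<in> mons (\<sigma> ` V)" using g unfolding supp_def by blast
        then show "a \<in> mons V" unfolding mons .
      qed
      ultimately show ?thesis
        unfolding conv_def using r by (auto intro!: exI[of _ "\<lambda>i. r (\<sigma> i)"] exI[of _ C])
    qed
    ultimately show "g \<in> relabel \<sigma> ` conv V" by blast
  qed
qed

end

section \<open>Invariance of the relation type\<close>

lemma formal_series_simps:
  "f \<oplus>\<^bsub>formal_series n\<^esub> g = cf (Mps f + Mps g)" "f \<otimes>\<^bsub>formal_series n\<^esub> g = cf (Mps f * Mps g)"
  "\<zero>\<^bsub>formal_series n\<^esub> = cf 0" "\<one>\<^bsub>formal_series n\<^esub> = cf 1"
  unfolding formal_series_def by (auto simp: fun_eq_iff times_mps_def)

lemma Mps_constant: "Mps (constant_series c) = mterm {#} c"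
  by (rule mps_eqI) (simp add: constant_series_def)

context valued_field
begin

definition conv_ring :: "nat \<Rightarrow> (nat multiset \<Rightarrow> 'k) ring" where
  "conv_ring n = (formal_series n)\<lparr>carrier := {f. Mps f \<in> conv {..<n}}\<rparr>"

lemma conv_ring_emb:
  assumes \<sigma>: "inj \<sigma>"
  shows "ring_emb (conv_ring n) (\<lambda>f. relabel \<sigma> (Mps f))"
proof
  note S = subringD[OF conv_subring]
  have c: "carrier (conv_ring n) = {f. Mps f \<in> conv {..<n}}" unfolding conv_ring_def by simp
  show "inj_on (\<lambda>f. relabel \<sigma> (Mps f)) (carrier (conv_ring n))"
    by (rule inj_onI) (metis relabel_hom(7)[OF \<sigma>] cf_Mps)
  show "\<exists>y\<in>carrier (conv_ring n). relabel \<sigma> (Mps y) = - relabel \<sigma> (Mps x)" if "x \<in> carrier (conv_ring n)" for x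
    using that S(5) by (intro bexI[of _ "cf (- Mps x)"]) (auto simp: c relabel_hom[OF \<sigma>])
qed (auto simp: conv_ring_def formal_series_simps relabel_hom[OF \<sigma>] intro: subringD[OF conv_subring])

lemma conv_ring_image:
  assumes \<sigma>: "inj \<sigma>"
  shows "(\<lambda>f. relabel \<sigma> (Mps f)) ` carrier (conv_ring n) = conv (\<sigma> ` {..<n})"
proof -
  have "Mps ` carrier (conv_ring n) = conv {..<n}"
    unfolding conv_ring_def by (auto simp: image_iff) (metis Mps_cf)
  then show ?thesis unfolding relabel_conv[OF \<sigma>, symmetric] by (metis image_image)
qed

text \<open>
  The variables of the second ring are moved to \<open>n, \<dots>, n + m - 1\<close>. The isomorphism then becomes a
  correspondence of the kind treated above.
\<close>

theorem relation_type_conv_ring: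
  assumes I: "ideal I (conv_ring n)" and J: "ideal J (conv_ring m)"
    and h: "h \<in> ring_iso (conv_ring n Quot I) (conv_ring m Quot J)"
    and hc: "\<And>c. h (I +>\<^bsub>conv_ring n\<^esub> constant_series c) = J +>\<^bsub>conv_ring m\<^esub> constant_series c"
  shows "ideal_relation_type (conv_ring n) I = ideal_relation_type (conv_ring m) J"
proof -
  let ?R = "conv_ring n" and ?S = "conv_ring m"
  define \<sigma> where "\<sigma> i = i + n" for i :: nat
  have \<sigma>: "inj \<sigma>" unfolding \<sigma>_def by (simp add: inj_def)
  have id: "inj (id :: nat \<Rightarrow> nat)" by simp
  define e where "e = (\<lambda>f :: nat multiset \<Rightarrow> 'k. relabel id (Mps f))"
  define e' where "e' = (\<lambda>f :: nat multiset \<Rightarrow> 'k. relabel \<sigma> (Mps f))"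
  interpret R: rees ?R e I
    unfolding e_def by (intro rees.intro rees_axioms.intro conv_ring_emb id I)
  interpret S: rees ?S e' J
    unfolding e'_def by (intro rees.intro rees_axioms.intro conv_ring_emb \<sigma> J)
  define V where "V = {..<n}"
  define W where "W = \<sigma> ` {..<m}"
  have eV: "e ` carrier ?R = conv V" unfolding e_def V_def using conv_ring_image[OF id] by simp
  have eW: "e' ` carrier ?S = conv W" unfolding e'_def W_def by (rule conv_ring_image[OF \<sigma>])
  interpret I: ideal I ?R by (rule I)
  interpret J: ideal J ?S by (rule J)
  have RI: "ring (?R Quot I)" by (rule I.quotient_is_ring)
  have SJ: "ring (?S Quot J)" by (rule J.quotient_is_ring)
  have hh: "h \<in> ring_hom (?R Quot I) (?S Quot J)" "bij_betw h (carrier (?R Quot I)) (carrier (?S Quot J))"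
    using h unfolding ring_iso_def by auto
  define p where "p = h \<circ> (+>\<^bsub>?R\<^esub>) I"
  define q where "q = (+>\<^bsub>?S\<^esub>) J"
  have p: "p \<in> ring_hom ?R (?S Quot J)" unfolding p_def by (rule ring_hom_trans[OF I.rcos_ring_hom hh(1)])
  have q: "q \<in> ring_hom ?S (?S Quot J)" unfolding q_def by (rule J.rcos_ring_hom)
  have Rq: "carrier (?R Quot I) = (\<lambda>f. I +>\<^bsub>?R\<^esub> f) ` carrier ?R"
    unfolding FactRing_def A_RCOSETS_def' by auto
  have Sq: "carrier (?S Quot J) = q ` carrier ?S"
    unfolding FactRing_def A_RCOSETS_def' q_def by auto
  have z: "\<zero>\<^bsub>?R Quot I\<^esub> = I" "\<zero>\<^bsub>?S Quot J\<^esub> = J" by (simp_all add: FactRing_def)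
  have hz: "h I = J" using ring_hom_zero[OF hh(1) RI SJ] unfolding z .
  have Iz: "I \<in> carrier (?R Quot I)" using ring.ring_simprules(2)[OF RI] unfolding z .
  have qJ: "q g = J \<longleftrightarrow> g \<in> J" if "g \<in> carrier ?S" for g
    unfolding q_def using J.a_rcos_const[of g] J.a_rcos_self[OF that] by auto
  have pI: "p f = J \<longleftrightarrow> f \<in> I" if f: "f \<in> carrier ?R" for f
  proof -
    have "I +>\<^bsub>?R\<^esub> f \<in> carrier (?R Quot I)" using f unfolding Rq by blast
    then have "h (I +>\<^bsub>?R\<^esub> f) = h I \<longleftrightarrow> I +>\<^bsub>?R\<^esub> f = I"
      by (rule inj_on_eq_iff[OF bij_betw_imp_inj_on[OF hh(2)] _ Iz])
    also have "\<dots> \<longleftrightarrow> f \<in> I" using I.a_rcos_const[of f] I.a_rcos_self[OF f] by auto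
    finally show ?thesis unfolding p_def hz by simp
  qed
  have cst: "constant_series c \<in> carrier (conv_ring N)" for c :: 'k and N
    unfolding conv_ring_def by (simp add: Mps_constant const_conv)
  define rel where "rel a b \<longleftrightarrow> (\<exists>f\<in>carrier ?R. \<exists>g\<in>carrier ?S. a = e f \<and> b = e' g \<and> p f = q g)" for a b
  have relI: "rel (e f) (e' g)" if "f \<in> carrier ?R" "g \<in> carrier ?S" "p f = q g" for f g
    using that unfolding rel_def by blast
  have "corr V (e ` I) W (e' ` J) rel"
    unfolding corr_def
  proof (intro conjI allI ballI impI)
    show "is_ideal (conv V) (e ` I)" using R.ideal_image[OF I] eV by simp
    show "is_ideal (conv W) (e' ` J)" using S.ideal_image[OF J] eW by simp
    show "a \<in> conv V" "b \<in> conv W" if "rel a b" for a b using that eV eW unfolding rel_def by blast+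
    show "\<exists>b. rel a b" if "a \<in> conv V" for a
    proof -
      obtain f where f: "f \<in> carrier ?R" "a = e f" using \<open>a \<in> conv V\<close> eV by blast
      have "p f \<in> carrier (?S Quot J)" by (rule ring_hom_closed[OF p f(1)])
      then show ?thesis unfolding Sq using relI f by blast
    qed
    show "\<exists>a. rel a b" if "b \<in> conv W" for b
    proof -
      obtain g where g: "g \<in> carrier ?S" "b = e' g" using \<open>b \<in> conv W\<close> eW by blast
      have "q g \<in> carrier (?S Quot J)" by (rule ring_hom_closed[OF q g(1)])
      then have "q g \<in> h ` carrier (?R Quot I)" using hh(2) unfolding bij_betw_def by simp
      then obtain f where "f \<in> carrier ?R" "q g = p f" unfolding Rq p_def by auto
      then show ?thesis using relI[of f g] g by auto
    qed
    show "rel (mterm {#} c) (mterm {#} c)" for c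
    proof -
      have "rel (e (constant_series c)) (e' (constant_series c))"
        by (rule relI[OF cst cst]) (simp add: p_def q_def hc)
      then show ?thesis by (simp add: e_def e'_def Mps_constant relabel_hom[OF id] relabel_hom[OF \<sigma>])
    qed
    show "a \<in> e ` I \<longleftrightarrow> b \<in> e' ` J" if r: "rel a b" for a b
    proof -
      obtain f g where fg: "f \<in> carrier ?R" "g \<in> carrier ?S" "a = e f" "b = e' g" "p f = q g"
        using r unfolding rel_def by blast
      have "a \<in> e ` I \<longleftrightarrow> f \<in> I" using fg R.E_eq I.Icarr by blast
      moreover have "b \<in> e' ` J \<longleftrightarrow> g \<in> J" using fg S.E_eq J.Icarr by blast
      ultimately show ?thesis using pI[OF fg(1)] qJ[OF fg(2)] fg(5) by simp
    qed
    show "rel a b" if ab: "a \<in> e ` I" "b \<in> e' ` J" for a b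
    proof -
      obtain f g where fg: "f \<in> I" "g \<in> J" "a = e f" "b = e' g" using ab by blast
      have c: "f \<in> carrier ?R" "g \<in> carrier ?S" using fg I.Icarr J.Icarr by blast+
      have "p f = J" "q g = J" using pI[OF c(1)] qJ[OF c(2)] fg(1,2) by blast+
      then show ?thesis unfolding fg(3,4) by (intro relI[OF c]) simp
    qed
    fix a b a' b' assume r: "rel a b" "rel a' b'"
    obtain f g where fg: "f \<in> carrier ?R" "g \<in> carrier ?S" "a = e f" "b = e' g" "p f = q g"
      using r(1) unfolding rel_def by blast
    obtain f' g' where fg': "f' \<in> carrier ?R" "g' \<in> carrier ?S" "a' = e f'" "b' = e' g'" "p f' = q g'"
      using r(2) unfolding rel_def by blast
    have "rel (e (f \<oplus>\<^bsub>?R\<^esub> f')) (e' (g \<oplus>\<^bsub>?S\<^esub> g'))"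
      by (rule relI) (simp_all add: fg fg' R.closed S.closed ring_hom_add[OF p] ring_hom_add[OF q])
    then show "rel (a + a') (b + b')" using fg fg' by (simp add: R.hom S.hom)
    have "rel (e (f \<otimes>\<^bsub>?R\<^esub> f')) (e' (g \<otimes>\<^bsub>?S\<^esub> g'))"
      by (rule relI) (simp_all add: fg fg' R.closed S.closed ring_hom_mult[OF p] ring_hom_mult[OF q])
    then show "rel (a * a') (b * b')" using fg fg' by (simp add: R.hom S.hom)
  qed
  then have "ideal_rt_le (conv V) (e ` I) l \<longleftrightarrow> ideal_rt_le (conv W) (e' ` J) l" if "1 \<le> l" for l
    by (rule ideal_rt_le_corr) (use that in \<open>auto simp: V_def W_def \<sigma>_def\<close>)
  then have "{l. 1 \<le> l \<and> ideal_rt_le (conv V) (e ` I) l} = {l. 1 \<le> l \<and> ideal_rt_le (conv W) (e' ` J) l}" by blast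
  then show ?thesis
    unfolding R.ideal_relation_type_eq S.ideal_relation_type_eq eV eW by simp
qed

lemma convergent_series_eq: "convergent_series v n = conv_ring n"
proof -
  have "{f \<in> carrier (formal_series n). \<exists>r. (\<forall>i<n. 0 < r i) \<and>
      (\<lambda>a. v (f a) * (\<Prod>i\<in>#a. r i)) summable_on monomials n} = {f. Mps f \<in> conv {..<n}}"
  proof safe
    fix f :: "nat multiset \<Rightarrow> 'k" and r
    assume f: "f \<in> carrier (formal_series n)" and r: "\<forall>i<n. 0 < r i"
      and s: "(\<lambda>a. v (f a) * (\<Prod>i\<in>#a. r i)) summable_on monomials n"
    define r' where "r' i = (if i < n then r i else 1)" for i
    have r': "0 < r' i" for i using r by (simp add: r'_def)
    have eq: "rpow r' a = (\<Prod>i\<in>#a. r i)" if "a \<in> monomials n" for a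
      unfolding rpow_def using that by (intro arg_cong[of _ _ prod_mset] image_mset_cong) (auto simp: r'_def monomials_def)
    have nn: "0 \<le> v (f a) * rpow r' a" for a using v_nonneg rpow_pos[of r', OF r'] by (simp add: less_imp_le)
    have supp: "supp {..<n} (Mps f)" using f unfolding supp_def formal_series_def monomials_eq by auto
    have "(\<lambda>a. v (f a) * rpow r' a) summable_on monomials n"
      using s by (rule summable_on_cong[THEN iffD1, rotated]) (simp add: eq)
    then have "bdd r' (Mps f) (\<Sum>\<^sub>\<infinity>a\<in>monomials n. v (f a) * rpow r' a)"
      unfolding bdd_def
    proof (intro allI impI)
      fix F :: "nat multiset set"
      assume s': "(\<lambda>a. v (f a) * rpow r' a) summable_on monomials n" and F: "finite F"
      have "(\<Sum>a\<in>F. v (cf (Mps f) a) * rpow r' a) = (\<Sum>a\<in>F \<inter> monomials n. v (f a) * rpow r' a)"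
        using F supp unfolding cf_Mps monomials_eq by (intro sum.mono_neutral_right) (auto simp: supp_def v_eq_0)
      also have "\<dots> \<le> (\<Sum>\<^sub>\<infinity>a\<in>monomials n. v (f a) * rpow r' a)"
        using F by (intro finite_sum_le_infsum s' nn) auto
      finally show "(\<Sum>a\<in>F. v (cf (Mps f) a) * rpow r' a) \<le> (\<Sum>\<^sub>\<infinity>a\<in>monomials n. v (f a) * rpow r' a)" .
    qed
    then show "Mps f \<in> conv {..<n}" unfolding conv_def using supp r' by blast
  next
    fix f assume "Mps f \<in> conv {..<n}"
    then obtain r C where s: "supp {..<n} (Mps f)" and r: "\<And>i. 0 < r i" and C: "bdd r (Mps f) C"
      unfolding conv_def by auto
    show "f \<in> carrier (formal_series n)" using s unfolding supp_def formal_series_def monomials_eq by auto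
    have "(\<lambda>a. v (f a) * rpow r a) summable_on monomials n"
    proof (rule nonneg_bdd_above_summable_on)
      show "0 \<le> v (f a) * rpow r a" for a using v_nonneg rpow_pos[of r, OF r] by (simp add: less_imp_le)
      show "bdd_above (sum (\<lambda>a. v (f a) * rpow r a) ` {F. F \<subseteq> monomials n \<and> finite F})"
        by (rule bdd_aboveI[of _ C]) (use bddD[OF C] in auto)
    qed
    then show "\<exists>r. (\<forall>i<n. 0 < r i) \<and> (\<lambda>a. v (f a) * (\<Prod>i\<in>#a. r i)) summable_on monomials n"
      using r unfolding rpow_def by blast
  qed
  then show ?thesis unfolding convergent_series_def conv_ring_def by simp
qed

end

text \<open>
  The count shows that a geometric series dominates the sum of all monomials at small radii.
\<close>

lemma card_monomials_le:
  assumes V: "finite V"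
  shows "card {a \<in> mons V. size a = k} \<le> card V ^ k"
proof (induction k)
  case 0
  have "{a \<in> mons V. size a = 0} = {{#}}" by auto
  then show ?case by simp
next
  case (Suc k)
  let ?D = "{a \<in> mons V. size a = k}"
  have fin: "finite ?D" by (rule finite_subset[OF _ finite_mons_le[OF V, of k]]) auto
  have "{a \<in> mons V. size a = Suc k} \<subseteq> (\<Union>i\<in>V. add_mset i ` ?D)"
  proof
    fix a assume a: "a \<in> {a \<in> mons V. size a = Suc k}"
    then obtain i b where "a = add_mset i b" by (metis (mono_tags) mem_Collect_eq size_eq_Suc_imp_eq_union)
    then show "a \<in> (\<Union>i\<in>V. add_mset i ` ?D)" using a by auto
  qed
  then have "card {a \<in> mons V. size a = Suc k} \<le> card (\<Union>i\<in>V. add_mset i ` ?D)"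
    using V fin by (intro card_mono) auto
  also have "\<dots> \<le> (\<Sum>i\<in>V. card (add_mset i ` ?D))" by (rule card_UN_le[OF V])
  also have "\<dots> \<le> (\<Sum>i\<in>V. card ?D)" by (intro sum_mono card_image_le fin)
  also have "\<dots> \<le> card V ^ Suc k" using Suc by simp
  finally show ?case .
qed

definition trivial_absval :: "'k::field \<Rightarrow> real" where
  "trivial_absval x = (if x = 0 then 0 else 1)"

interpretation trivial: valued_field trivial_absval
  by unfold_locales (auto simp: trivial_absval_def)

text \<open>
  For the trivial absolute value every series has norm at most \<open>\<Sum> (n r)\<^sup>k \<le> 2\<close> at the radii
  \<open>r = 1 / (2 (n + 1))\<close>.
\<close>

lemma formal_series_eq: "(formal_series n :: (nat multiset \<Rightarrow> 'k::field) ring) = trivial.conv_ring n"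
proof -
  define r :: real where "r = 1 / (2 * (n + 1))"
  have r: "0 < r" "n * r \<le> 1 / 2" unfolding r_def by (auto simp: field_simps)
  have rp: "rpow (\<lambda>_. r) a = r ^ size a" for a by (induction a) auto
  have "trivial.bdd (\<lambda>_. r) f 2" if s: "trivial.supp {..<n} f" for f :: "'k mps"
    unfolding trivial.bdd_def
  proof (intro allI impI)
    fix F :: "nat multiset set" assume F: "finite F"
    define N where "N = Max (insert 0 (size ` F))"
    have N: "size a \<le> N" if "a \<in> F" for a using F that by (auto simp: N_def)
    let ?D = "\<lambda>k. {a \<in> mons {..<n}. size a = k}"
    have fin: "finite (?D k)" for k by (rule finite_subset[OF _ finite_mons_le[of "{..<n}" k]]) auto
    have "(\<Sum>a\<in>F. trivial_absval (cf f a) * rpow (\<lambda>_. r) a) = (\<Sum>a\<in>F \<inter> mons {..<n}. trivial_absval (cf f a) * rpow (\<lambda>_. r) a)"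
      using s F by (intro sum.mono_neutral_right) (auto simp: trivial.supp_def trivial_absval_def)
    also have "\<dots> \<le> (\<Sum>a\<in>F \<inter> mons {..<n}. r ^ size a)"
      using r by (intro sum_mono) (auto simp: rp trivial_absval_def)
    also have "\<dots> \<le> (\<Sum>a\<in>(\<Union>k\<in>{..N}. ?D k). r ^ size a)"
      using r N fin by (intro sum_mono2) auto
    also have "\<dots> = (\<Sum>k\<le>N. \<Sum>a\<in>?D k. r ^ size a)"
      by (rule sum.UNION_disjoint) (use fin in auto)
    also have "\<dots> = (\<Sum>k\<le>N. card (?D k) * r ^ k)"
      by (intro sum.cong) auto
    also have "\<dots> \<le> (\<Sum>k\<le>N. (1 / 2) ^ k)"
    proof (rule sum_mono)
      fix k
      have "real (card (?D k)) \<le> real (n ^ k)" using card_monomials_le[of "{..<n}" k] by (simp flip: of_nat_power)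
      then have "card (?D k) * r ^ k \<le> real (n ^ k) * r ^ k" using r by (intro mult_right_mono) auto
      also have "\<dots> = (n * r) ^ k" by (simp add: power_mult_distrib)
      also have "\<dots> \<le> (1 / 2) ^ k" using r by (intro power_mono) auto
      finally show "card (?D k) * r ^ k \<le> (1 / 2) ^ k" .
    qed
    also have "\<dots> = 2 - (1 / 2) ^ N" by (induction N) auto
    also have "\<dots> \<le> 2" by simp
    finally show "(\<Sum>a\<in>F. trivial_absval (cf f a) * rpow (\<lambda>_. r) a) \<le> 2" .
  qed
  then have "trivial.conv {..<n} = {f :: 'k mps. trivial.supp {..<n} f}"
    unfolding trivial.conv_def using r(1) by fastforce
  then have "{f :: nat multiset \<Rightarrow> 'k. Mps f \<in> trivial.conv {..<n}} = carrier (formal_series n)"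
    by (auto simp: trivial.supp_def formal_series_def monomials_eq)
  then show ?thesis unfolding trivial.conv_ring_def by (simp add: formal_series_def)
qed

theorem theorem2p3:
  fixes R S :: "(nat multiset \<Rightarrow> 'k::field) ring"
    and n m :: nat
    and I J :: "(nat multiset \<Rightarrow> 'k) set"
  assumes "(R = formal_series n \<and> S = formal_series m) \<or>
           (\<exists>absval. complete_valued_field absval \<and>
              R = convergent_series absval n \<and> S = convergent_series absval m)"
    and "ideal I R"
    and "ideal J S"
    and "\<exists>h \<in> ring_iso (R Quot I) (S Quot J).
           \<forall>c. h (I +>\<^bsub>R\<^esub> constant_series c) = J +>\<^bsub>S\<^esub> constant_series c"
  shows "ideal_relation_type R I = ideal_relation_type S J"
proof -
  obtain v where v: "valued_field v" "R = valued_field.conv_ring v n" "S = valued_field.conv_ring v m"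
  proof -
    consider "R = formal_series n" "S = formal_series m"
      | absval where "complete_valued_field absval" "R = convergent_series absval n" "S = convergent_series absval m"
      using assms(1) by blast
    then show ?thesis
    proof cases
      case 1
      then show ?thesis using that[OF trivial.valued_field_axioms] by (simp add: formal_series_eq)
    next
      case 2
      then interpret C: complete_valued_field absval by simp
      interpret valued_field absval
        by unfold_locales (rule C.absval_nonneg C.absval_eq_0_iff C.absval_mult C.absval_triangle)+
      show ?thesis using that[OF valued_field_axioms] 2 by (simp add: convergent_series_eq)
    qed
  qed
  interpret valued_field v by (rule v(1))
  obtain h where "h \<in> ring_iso (R Quot I) (S Quot J)"
    "\<And>c. h (I +>\<^bsub>R\<^esub> constant_series c) = J +>\<^bsub>S\<^esub> constant_series c" using assms(4) by blast
  then show ?thesis using relation_type_conv_ring[of I n J m h] assms(2,3) v(2,3) by simp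
qed

end
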